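(* Let $F:=(5,\{01,12,23,30,04\})$ be the $4$-cycle plus a pendant edge. Then $$\lambda_F=\frac{5^6}{2^8\cdot 3^5}=\frac{15625}{62208}.$$ Moreover, there is a flag algebra certificate on $N=5$ vertices for the upper bound $\lambda_F\le \frac{5^6}{2^8\cdot 3^5}$ that satisfies the following properties. (A) For the single-vertex type $1$, the zero eigenspace of the matrix $X^1$ has dimension $1$. (B) For the type $\nu:=(3,\{01,02\})$ (the cherry), the zero eigenspace of the matrix $X^\nu$ has dimension $1$. (C) The zero eigenspace of the matrix $X^\sigma$ for the type $\sigma:=(3,\{\})$ (with 3 vertices and no edges) does not contain any non-zero linear combination of $4$-vertex $\sigma$-flags in which the unlabelled vertex sends at most one edge to the roots. (D) The zero eigenspace of the matrix $X^\mu$ for the type $\mu:=(3,\{01\})$ (with 3 vertices and one edge) does not contain any non-zero linear combination of $4$-vertex $\mu$-flags in which the unlabelled vertex sends at most one edge to the roots.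
   Context: Graphs are finite and simple. $[m]:=\{0,\dots,m-1\}$, $ij$ abbreviates the unordered pair $\{i,j\}$, and $(m,E)$ denotes the graph with vertex set $[m]$ and edge set $E$. Inducibility: for a graph $F$ with $\kappa$ vertices and a graph $G$ with $n\ge\kappa$ vertices, $\lambda_F(G)$ is the number of $\kappa$-subsets of $V(G)$ that induce a subgraph isomorphic to $F$, divided by $\binom{n}{\kappa}$. Further, $\lambda_F(n):=\max\{\lambda_F(G): G\text{ is an } n\text{-vertex graph}\}$ and $\lambda_F:=\lim_{n\to\infty}\lambda_F(n)$ (the limit exists). Flag algebra certificates. $\mathcal{F}^0_N$ is the set of $N$-vertex graphs up to isomorphism (one representative each), and $P(F',G)$ is the number of $v(F')$-subsets of $V(G)$ inducing a copy of $F'$. A type $\tau$ is a graph with vertex set $[q]$. A $\tau$-flag is a pair $(H,h)$ with $H$ a graph and $h:[q]\to V(H)$ an embedding of $\tau$ (injective, preserving edges and non-edges); the vertices of $h([q])$ are the roots (labelled vertices), and isomorphisms of $\tau$-flags must preserve each labelled root. $\mathcal{F}^\tau_s$ is the set of $s$-vertex $\tau$-flags up to isomorphism, in a fixed order. For $\tau$-flags, $P((F',f'),(H,h))$ is the number of $(v(F')-q)$-subsets $X\subseteq V(H)\setminus h([q])$ such that $(H[X\cup h([q])],h)$ is isomorphic to $(F',f')$, and $\mathbf{V}^{\tau,s}_{(H,h)}:=\big(P((F',f'),(H,h))\big)_{(F',f')\in\mathcal{F}^\tau_s}$. A flag algebra certificate on $N\ge v(F)$ vertices for the bound $\lambda_F\le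 u$ consists of a positive semi-definite matrix $X^\tau$, indexed by $\mathcal{F}^\tau_s$ with $s=(N+q)/2$, for each type $\tau$ on $[q]$ with $1\le q\le N-2$ and $q\equiv N\pmod 2$ (where from each class of types isomorphic as unlabelled graphs only one representative is listed and the zero matrix is used for all others; here $1,\nu,\sigma,\mu$ are among the listed representatives), and of real numbers $c_{F'}\ge0$ for $F'\in\mathcal{F}^0_N$, such that for every graph $G$ of order $n\to\infty$ $$\sum_{F'\in\mathcal{F}^0_N}(u-\lambda_F(F'))P(F',G)=\sum_{\substack{1\le q\le N-2\\ q\equiv N \bmod 2}}\ \sum_{f:[q]\hookrightarrow V(G)}\big(\mathbf{V}^{\tau,s}_{(G,f)}\big)^{T}X^\tau\,\mathbf{V}^{\tau,s}_{(G,f)}+\sum_{F'\in\mathcal{F}^0_N}c_{F'} P(F',G)+O(n^{N-1}),$$ where the inner sum is over injections $f$, $s=(N+q)/2$, and $\tau$ is the graph on $[q]$ for which $f$ is an embedding of $\tau$ into $G$. For $N=5$ one has $s=3$ when $q=1$ and $s=4$ when $q=3$. The zero eigenspace of $X^\tau$ is its kernel in $\mathbb{R}^{\mathcal{F}^\tau_s}$; a linear combination of certain $\tau$-flags means a vector in $\mathbb{R}^{\mathcal{F}^\tau_s}$ supported on the coordinates indexed by those flags. *)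

theory Defs
  imports Complex_Main "HOL-Library.FuncSet" "Jordan_Normal_Form.Matrix_Kernel"
begin

section \<open>Graphs\<close>

type_synonym 'a sgraph = "'a set \<times> 'a set set"

abbreviation verts :: "'a sgraph \<Rightarrow> 'a set" where "verts \<equiv> fst"
abbreviation edges :: "'a sgraph \<Rightarrow> 'a set set" where "edges \<equiv> snd"

abbreviation order :: "'a sgraph \<Rightarrow> nat" where "order G \<equiv> card (verts G)"

definition is_graph :: "'a sgraph \<Rightarrow> bool" where
  "is_graph G \<longleftrightarrow> finite (verts G) \<and> (\<forall>e\<in>edges G. e \<subseteq> verts G \<and> card e = 2)"

definition induced :: "'a sgraph \<Rightarrow> 'a set \<Rightarrow> 'a sgraph" where
  "induced G X = (X, {e \<in> edges G. e \<subseteq> X})"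

text \<open>A map on vertices that preserves edges and non-edges.\<close>

definition edge_compat :: "('a \<Rightarrow> 'b) \<Rightarrow> 'a sgraph \<Rightarrow> 'b sgraph \<Rightarrow> bool" where
  "edge_compat \<phi> G H \<longleftrightarrow>
     (\<forall>u\<in>verts G. \<forall>v\<in>verts G. {u, v} \<in> edges G \<longleftrightarrow> {\<phi> u, \<phi> v} \<in> edges H)"

definition graph_iso :: "'a sgraph \<Rightarrow> 'b sgraph \<Rightarrow> bool" where
  "graph_iso G H \<longleftrightarrow> (\<exists>\<phi>. bij_betw \<phi> (verts G) (verts H) \<and> edge_compat \<phi> G H)"


section \<open>Inducibility\<close>

definition ind_count :: "'b sgraph \<Rightarrow> 'a sgraph \<Rightarrow> nat" where
  "ind_count F G =
     card {X. X \<subseteq> verts G \<and> card X = order F \<and> graph_iso F (induced G X)}"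

definition ind_density :: "'b sgraph \<Rightarrow> 'a sgraph \<Rightarrow> real" where
  "ind_density F G = real (ind_count F G) / real (order G choose order F)"

definition max_ind_density :: "'b sgraph \<Rightarrow> nat \<Rightarrow> real" where
  "max_ind_density F n =
     Max {ind_density F G | G :: nat sgraph. is_graph G \<and> order G = n}"

definition inducibility :: "'b sgraph \<Rightarrow> real" where
  "inducibility F = lim (max_ind_density F)"

lemma finite_ind_densities:
  "finite {ind_density F G | G :: nat sgraph. is_graph G \<and> order G = n}"
proof (rule finite_subset)
  show "{ind_density F G | G :: nat sgraph. is_graph G \<and> order G = n} \<subseteq>
      (\<lambda>k. real k / real (n choose order F)) ` {..n choose order F}"
  proof clarify
    fix V :: "nat set" and E
    assume G: "is_graph (V, E)" and n: "n = order (V, E)"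
    then have fin: "finite V" by (simp add: is_graph_def)
    have "ind_count F (V, E) \<le> card {X. X \<subseteq> V \<and> card X = order F}"
      unfolding ind_count_def by (rule card_mono) (use fin in auto)
    also have "\<dots> = card V choose order F"
      by (rule n_subsets[OF fin])
    finally have "ind_count F (V, E) \<le> order (V, E) choose order F" by simp
    then show "ind_density F (V, E) \<in>
        (\<lambda>k. real k / real (order (V, E) choose order F)) ` {..order (V, E) choose order F}"
      unfolding ind_density_def by (intro image_eqI[OF refl]) simp
  qed
qed simp


section \<open>Representatives of isomorphism classes\<close>

text \<open>One element of each class of \<open>R\<close> on \<open>A\<close>, listed in a fixed order.\<close>

definition rep_list :: "('x \<Rightarrow> 'x \<Rightarrow> bool) \<Rightarrow> 'x set \<Rightarrow> 'x list" where
  "rep_list R A =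
     (SOME xs. distinct xs \<and> set xs \<subseteq> A \<and> (\<forall>x\<in>A. \<exists>!y. y \<in> set xs \<and> R x y))"

lemma rep_list_exists:
  assumes "finite A" and refl: "\<And>x. R x x" and sym: "\<And>x y. R x y \<Longrightarrow> R y x"
    and trans: "\<And>x y z. R x y \<Longrightarrow> R y z \<Longrightarrow> R x z"
  shows "\<exists>xs. distinct xs \<and> set xs \<subseteq> A \<and> (\<forall>x\<in>A. \<exists>!y. y \<in> set xs \<and> R x y)"
  using \<open>finite A\<close>
proof (induction A rule: finite_induct)
  case empty
  then show ?case by simp
next
  case (insert a A)
  then obtain xs where xs: "distinct xs" "set xs \<subseteq> A"
    "\<And>x. x \<in> A \<Longrightarrow> \<exists>!y. y \<in> set xs \<and> R x y" by blast
  show ?case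
  proof (cases "\<exists>b\<in>A. R a b")
    case True
    then obtain b where b: "b \<in> A" "R a b" by blast
    have "\<exists>!y. y \<in> set xs \<and> R a y"
      using xs(3)[OF b(1)] b(2) sym trans by metis
    with xs show ?thesis by (intro exI[of _ xs]) auto
  next
    case False
    have "\<exists>!y. y \<in> set (a # xs) \<and> R x y" if "x \<in> insert a A" for x
    proof (cases "x = a")
      case True
      with False xs(2) refl show ?thesis by auto
    next
      case x: False
      with that have "x \<in> A" by simp
      with False have "\<not> R x a" using sym by blast
      with xs(3)[OF \<open>x \<in> A\<close>] show ?thesis by auto
    qed
    moreover have "distinct (a # xs)" using xs insert.hyps by auto
    ultimately show ?thesis using xs(2)
      by (intro exI[of _ "a # xs"]) auto
  qed
qed

definition graph_reps :: "nat \<Rightarrow> nat sgraph list" where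
  "graph_reps N = rep_list graph_iso {G. is_graph G \<and> verts G = {..<N}}"


section \<open>Types and flags\<close>

definition is_type :: "nat \<Rightarrow> nat sgraph \<Rightarrow> bool" where
  "is_type q \<tau> \<longleftrightarrow> is_graph \<tau> \<and> verts \<tau> = {..<q}"

type_synonym 'a flag = "'a sgraph \<times> (nat \<Rightarrow> 'a)"

definition injections :: "nat \<Rightarrow> 'a set \<Rightarrow> (nat \<Rightarrow> 'a) set" where
  "injections q A = {f \<in> {..<q} \<rightarrow>\<^sub>E A. inj_on f {..<q}}"

definition is_flag :: "nat sgraph \<Rightarrow> 'a flag \<Rightarrow> bool" where
  "is_flag \<tau> = (\<lambda>(H, h). is_graph H \<and> h \<in> injections (order \<tau>) (verts H) \<and> edge_compat h \<tau> H)"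

definition roots :: "nat sgraph \<Rightarrow> 'a flag \<Rightarrow> 'a set" where
  "roots \<tau> = (\<lambda>(H, h). h ` verts \<tau>)"

definition flag_iso :: "nat sgraph \<Rightarrow> 'a flag \<Rightarrow> 'b flag \<Rightarrow> bool" where
  "flag_iso \<tau> = (\<lambda>(H, h) (H', h').
     \<exists>\<phi>. bij_betw \<phi> (verts H) (verts H') \<and> edge_compat \<phi> H H' \<and> (\<forall>i\<in>verts \<tau>. \<phi> (h i) = h' i))"

definition flag_reps :: "nat sgraph \<Rightarrow> nat \<Rightarrow> nat flag list" where
  "flag_reps \<tau> s = rep_list (flag_iso \<tau>) {(H, h). is_flag \<tau> (H, h) \<and> verts H = {..<s}}"

definition flag_count :: "nat sgraph \<Rightarrow> 'b flag \<Rightarrow> 'a flag \<Rightarrow> nat" where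
  "flag_count \<tau> = (\<lambda>(F, f) (H, h).
     card {X. X \<subseteq> verts H - roots \<tau> (H, h) \<and> card X = order F - order \<tau> \<and>
              flag_iso \<tau> (induced H (X \<union> roots \<tau> (H, h)), h) (F, f)})"

definition flag_vec :: "nat sgraph \<Rightarrow> nat \<Rightarrow> 'a flag \<Rightarrow> real vec" where
  "flag_vec \<tau> s \<Phi> = vec_of_list (map (\<lambda>\<Psi>. real (flag_count \<tau> \<Psi> \<Phi>)) (flag_reps \<tau> s))"

text \<open>The type on \<open>[q]\<close> of which \<open>f\<close> is an embedding into \<open>G\<close>, for an injection \<open>f\<close>.\<close>

definition type_of :: "nat \<Rightarrow> (nat \<Rightarrow> 'a) \<Rightarrow> 'a sgraph \<Rightarrow> nat sgraph" where
  "type_of q f G = ({..<q}, {{i, j} | i j. i < q \<and> j < q \<and> {f i, f j} \<in> edges G})"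

lemma edge_compat_type_of: "edge_compat f (type_of q f G) G"
  unfolding edge_compat_def type_of_def by (auto simp: doubleton_eq_iff insert_commute)

lemma is_type_type_of:
  assumes "is_graph G"
  shows "is_type q (type_of q f G)"
proof -
  have "card {i, j} = 2" if "{f i, f j} \<in> edges G" for i j
  proof -
    from that assms have "card {f i, f j} = 2" by (auto simp: is_graph_def)
    then have "i \<noteq> j" by auto
    then show ?thesis by simp
  qed
  then show ?thesis
    unfolding is_type_def is_graph_def type_of_def by auto
qed

lemma type_of_unique:
  assumes "is_type q \<tau>" and "edge_compat f \<tau> G"
  shows "\<tau> = type_of q f G"
proof (rule prod_eqI)
  have V: "verts \<tau> = {..<q}" using assms(1) by (simp add: is_type_def)
  then show "verts \<tau> = verts (type_of q f G)" by (simp add: type_of_def)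
  have "\<exists>i j. e = {i, j} \<and> i < q \<and> j < q" if "e \<in> edges \<tau>" for e
  proof -
    from that assms(1) have "card e = 2" "e \<subseteq> {..<q}"
      by (auto simp: is_type_def is_graph_def)
    then show ?thesis by (auto simp: card_2_iff)
  qed
  with assms(2) V show "edges \<tau> = edges (type_of q f G)"
    unfolding edge_compat_def type_of_def by fastforce
qed


section \<open>Flag algebra certificates\<close>

definition type_sizes :: "nat \<Rightarrow> nat set" where
  "type_sizes N = {q. 1 \<le> q \<and> q + 2 \<le> N \<and> q mod 2 = N mod 2}"

definition flag_size :: "nat \<Rightarrow> nat \<Rightarrow> nat" where
  "flag_size N q = (N + q) div 2"

text \<open>A choice of one representative from each class of types that are isomorphic as
  unlabelled graphs.\<close>

definition type_listing :: "nat \<Rightarrow> nat sgraph set \<Rightarrow> bool" where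
  "type_listing N T \<longleftrightarrow>
     (\<forall>\<tau>\<in>T. \<exists>q\<in>type_sizes N. is_type q \<tau>) \<and>
     (\<forall>q\<in>type_sizes N. \<forall>\<tau>. is_type q \<tau> \<longrightarrow> (\<exists>!\<tau>'. \<tau>' \<in> T \<and> graph_iso \<tau> \<tau>'))"

definition psd :: "nat \<Rightarrow> real mat \<Rightarrow> bool" where
  "psd d A \<longleftrightarrow>
     A \<in> carrier_mat d d \<and> transpose_mat A = A \<and>
     (\<forall>v\<in>carrier_vec d. 0 \<le> v \<bullet> (A *\<^sub>v v))"

text \<open>\<open>T\<close> is the set of listed types, \<open>X \<tau>\<close> the matrix of the type \<open>\<tau>\<close> (rows and columns follow
  the order of \<^term>\<open>flag_reps \<tau> s\<close>), and \<open>c\<close> the family of slack coefficients.\<close>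

definition certificate ::
  "'b sgraph \<Rightarrow> nat \<Rightarrow> real \<Rightarrow> nat sgraph set \<Rightarrow> (nat sgraph \<Rightarrow> real mat) \<Rightarrow>
   (nat sgraph \<Rightarrow> real) \<Rightarrow> bool" where
  "certificate F N u T X c \<longleftrightarrow>
     order F \<le> N \<and>
     type_listing N T \<and>
     (\<forall>q\<in>type_sizes N. \<forall>\<tau>. is_type q \<tau> \<longrightarrow>
        (let d = length (flag_reps \<tau> (flag_size N q))
         in psd d (X \<tau>) \<and> (\<tau> \<notin> T \<longrightarrow> X \<tau> = 0\<^sub>m d d))) \<and>
     (\<forall>F'\<in>set (graph_reps N). 0 \<le> c F') \<and>
     (\<exists>C n\<^sub>0. \<forall>G :: nat sgraph. is_graph G \<and> n\<^sub>0 \<le> order G \<longrightarrow>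
        \<bar>(\<Sum>F'\<in>set (graph_reps N). (u - ind_density F F') * real (ind_count F' G))
          - ((\<Sum>q\<in>type_sizes N. \<Sum>f\<in>injections q (verts G).
                let \<tau> = type_of q f G; v = flag_vec \<tau> (flag_size N q) (G, f)
                in v \<bullet> (X \<tau> *\<^sub>v v))
             + (\<Sum>F'\<in>set (graph_reps N). c F' * real (ind_count F' G)))\<bar>
        \<le> C * real (order G) ^ (N - 1))"


section \<open>Linear combinations of flags\<close>

definition supported_on :: "'x list \<Rightarrow> ('x \<Rightarrow> bool) \<Rightarrow> real vec \<Rightarrow> bool" where
  "supported_on xs Q v \<longleftrightarrow>
     v \<in> carrier_vec (length xs) \<and> (\<forall>i<length xs. v $ i \<noteq> 0 \<longrightarrow> Q (xs ! i))"

text \<open>The number of edges between unlabelled vertices and roots.\<close>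

definition edges_to_roots :: "nat sgraph \<Rightarrow> 'a flag \<Rightarrow> nat" where
  "edges_to_roots \<tau> = (\<lambda>(H, h).
     card {{x, r} | x r. x \<in> verts H - roots \<tau> (H, h) \<and> r \<in> roots \<tau> (H, h) \<and> {x, r} \<in> edges H})"


section \<open>Specific graphs and types\<close>

definition C4_pendant :: "nat sgraph" where
  "C4_pendant = ({..<5}, {{0,1}, {1,2}, {2,3}, {3,0}, {0,4}})"

definition type_one :: "nat sgraph" where "type_one = ({..<1}, {})"
definition type_nu :: "nat sgraph" where "type_nu = ({..<3}, {{0,1}, {0,2}})"
definition type_sigma :: "nat sgraph" where "type_sigma = ({..<3}, {})"
definition type_mu :: "nat sgraph" where "type_mu = ({..<3}, {{0,1}})"

end

theory Submission
  imports
    Defs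
    "HOL-Combinatorics.Multiset_Permutations"
    "HOL-Real_Asymp.Real_Asymp"
begin

text \<open>The extremal configuration is a balanced random bipartite graph of edge density \<open>5 / 6\<close>:
  five random vertices split as \<open>3 + 2\<close> with probability \<open>5 / 8\<close> and then span \<open>K\<^sub>2\<^sub>,\<^sub>3\<close> minus an edge
  with probability \<open>(5 / 6)\<^sup>5\<close>. Averaging over bipartite graphs with these weights gives the lower
  bound.

  For the upper bound, each certificate matrix is a sum of weighted squares of integer linear forms.
  Up to \<open>O(n\<^sup>4)\<close>, the sum of the quadratic forms counts ordered 5-tuples of distinct vertices with a
  weight that depends only on the graph they induce. So it suffices to compare, for every graph on
  five vertices, the total weight of its 120 orderings with \<open>u - \<lambda>\<^sub>F\<close>; the differences are the slack
  coefficients. The kernels are no larger than forced: the flag densities seen from the roots of the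
  extremal configuration always lie in them.\<close>

section \<open>The certificate\<close>

text \<open>The density 5/6 maximises p^5 (1 - p), the chance that a prescribed edge of K_2,3 is the
  only one missing. The extremal configuration is random, so every bipartite graph on five vertices
  has positive density in it. By complementary slackness all bipartite slacks must vanish, and every
  squared form must annihilate the flag densities seen from any placement of the roots.
  Floating-point matrices meet such equations only approximately; integer forms orthogonal to the
  density vectors meet them exactly, and the weights are left to solve the slack equations. The
  scale 302330880 is 5 * 6^10, a multiple of 62208. A second obstacle is that
  \<open>rep_list\<close> is an arbitrary choice: neither the order of the flags nor the
  representatives can be computed. Complete numerical invariants of flags therefore replace matrix
  positions, and sums over representatives are turned into sums over vertex sets and then over
  vertex tuples, where evaluation is possible.\<close>

definition gram :: "(int \<times> int list) list \<Rightarrow> nat \<Rightarrow> nat \<Rightarrow> int" where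
  "gram sq a b = (\<Sum>(w, l)\<leftarrow>sq. w * l ! a * l ! b)"

text \<open>The forms were found by rounding the analytic centre of the semidefinite program; their weights
  solve exactly the linear equations that make the slack of every bipartite graph vanish. All
  weights are scaled by \<open>302330880\<close>. Coefficient \<open>k\<close> of a form belongs to the flags numbered \<open>k\<close> by
  \<open>unlabelled_code\<close> below.\<close>

definition squares_one :: "(int \<times> int list) list" where
  "squares_one = [
     (1464104, [0, 1, -2, -2, 1, 1]),
     (122814, [0, 1, -2, -2, 1, 0]),
     (6068, [0, 3, 6, -1, -4, -6]),
     (714, [0, 9, 16, -3, -11, -18]),
     (42, [5, -16, -33, 0, 19, 35])]"

definition squares_sigma :: "(int \<times> int list) list" where
  "squares_sigma = [
     (5988, [5, -6, -10, 9, -6, 13, 9, -14]),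
     (5988, [5, -10, -6, 9, -6, 9, 13, -14]),
     (5988, [5, -6, -6, 13, -10, 9, 9, -14]),
     (7338, [5, -16, -15, 24, -16, 23, 24, -21])]"

definition squares_mu :: "(int \<times> int list) list" where
  "squares_mu = [
     (3359855, [0, 1, -1, 0, 0, 1, -1, 0]),
     (31312, [10, -9, -6, -1, -9, 8, 11, 0]),
     (72328, [5, -2, -2, -1, -3, 2, 2, -3]),
     (252905, [5, -2, -2, -1, -3, 2, 2, -4]),
     (668, [20, -18, -12, -1, -18, 16, 22, 0]),
     (62784, [5, -9, -4, 0, -4, 6, 11, -1])]"

definition squares_nu :: "(int \<times> int list) list" where
  "squares_nu = [
     (824226, [0, 0, 3, 1, 2, 1, -1, 1]),
     (418864, [5, 0, 2, 0, 1, -1, -2, -1]),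
     (1051938, [5, -1, 2, 1, 2, -1, -1, -1]),
     (1192862, [0, 1, 1, 1, -2, -1, -1, 0]),
     (2145992, [0, 1, 1, 0, -2, -1, -1, 0]),
     (11599001, [0, 0, 1, 0, -1, 0, 0, 0]),
     (70410, [0, 4, -5, 0, -4, 0, -3, -2])]"

text \<open>The Gram matrices are expanded beforehand because the finite check visits all 120
  orderings of each graph; every visit should cost a lookup and not a sum over squares.\<close>

definition table_one :: "int list list" where
  "table_one = [
     [1050, -3360, -6930, 0, 3990, 7350],
     [-3360, 1710116, -2939620, -3211318, 1430648, 1215692],
     [-6930, -2939620, 6794642, 6276992, -3471466, -3400798],
     [0, -3211318, 6276992, 6360166, -3126002, -2853244],
     [3990, 1430648, -3471466, -3126002, 1785562, 1779038],
     [7350, 1215692, -3400798, -2853244, 1779038, 1965338]]"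

definition table_sigma :: "int list list" where
  "table_sigma = [
     [632550, -1245720, -1209030, 1808700, -1245720, 1772010, 1808700, -2027970],
     [-1245720, 2908464, 2695248, -4147128, 2812656, -4029720, -4242936, 4309872],
     [-1209030, 2695248, 2680986, -3971016, 2695248, -3956754, -3971016, 4155774],
     [1808700, -4147128, -3971016, 6208716, -4242936, 5936796, 6112908, -6297144],
     [-1245720, 2812656, 2695248, -4242936, 2908464, -4029720, -4147128, 4309872],
     [1772010, -4029720, -3956754, 5936796, -4029720, 5863830, 5936796, -6143046],
     [1808700, -4242936, -3971016, 6112908, -4147128, 5936796, 6208716, -6297144],
     [-2027970, 4309872, 4155774, -6297144, 4309872, -6143046, -6297144, 6757002]]"

definition table_mu :: "int list list" where
  "table_mu = [
     [13098825, -9136170, -6547050, -1952645, -9192735, 7854570, 10443690, -6456940],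
     [-9136170, 12498995, 2036437, 944298, 6964326, -3778261, -14240819, 3022264],
     [-6547050, 2036437, 6888755, 846354, 4791078, -7798835, -2946517, 2708344],
     [-1952645, 944298, 846354, 357213, 1269531, -911650, -1009594, 1228604],
     [-9192735, 6964326, 4791078, 1269531, 6684345, -5905062, -8078310, 3936948],
     [7854570, -3778261, -7798835, -911650, -5905062, 9095987, 5075413, -2833912],
     [10443690, -14240819, -2946517, -1009594, -8078310, 5075413, 16369715, -3147832],
     [-6456940, 3022264, 2708344, 1228604, 3936948, -2833912, -3147832, 4760216]]"

definition table_nu :: "int list list" where
  "table_nu = [
     [36770050, -5259690, 14708020, 5259690, 12613700, -7354010, -9448330, -7354010],
     [-5259690, 5517352, -173222, 140924, -9908144, -2286916, -3131836, 488658],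
     [14708020, -173222, 29999347, 5769416, -6877673, -3807780, -8534714, 235174],
     [5259690, 140924, 5769416, 3069026, 1366604, -1420574, -3069026, -227712],
     [12613700, -9908144, -6877673, 1366604, 34004497, 5803420, 2932572, -311008],
     [-7354010, -2286916, -3807780, -1420574, 5803420, 5633882, 4404294, 2295028],
     [-9448330, -3131836, -8534714, -3069026, 2932572, 4404294, 7524164, 1487900],
     [-7354010, 488658, 235174, -227712, -311008, 2295028, 1487900, 2576668]]"

lemma table_one: "a < 6 \<Longrightarrow> b < 6 \<Longrightarrow> gram squares_one a b = table_one ! a ! b"
proof -
  have "\<forall>a\<in>set [0..<6]. \<forall>b\<in>set [0..<6]. gram squares_one a b = table_one ! a ! b"
    by code_simp
  then show "a < 6 \<Longrightarrow> b < 6 \<Longrightarrow> gram squares_one a b = table_one ! a ! b"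
    by simp
qed

lemma table_sigma: "a < 8 \<Longrightarrow> b < 8 \<Longrightarrow> gram squares_sigma a b = table_sigma ! a ! b"
proof -
  have "\<forall>a\<in>set [0..<8]. \<forall>b\<in>set [0..<8]. gram squares_sigma a b = table_sigma ! a ! b"
    by code_simp
  then show "a < 8 \<Longrightarrow> b < 8 \<Longrightarrow> gram squares_sigma a b = table_sigma ! a ! b"
    by simp
qed

lemma table_mu: "a < 8 \<Longrightarrow> b < 8 \<Longrightarrow> gram squares_mu a b = table_mu ! a ! b"
proof -
  have "\<forall>a\<in>set [0..<8]. \<forall>b\<in>set [0..<8]. gram squares_mu a b = table_mu ! a ! b"
    by code_simp
  then show "a < 8 \<Longrightarrow> b < 8 \<Longrightarrow> gram squares_mu a b = table_mu ! a ! b"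
    by simp
qed

lemma table_nu: "a < 8 \<Longrightarrow> b < 8 \<Longrightarrow> gram squares_nu a b = table_nu ! a ! b"
proof -
  have "\<forall>a\<in>set [0..<8]. \<forall>b\<in>set [0..<8]. gram squares_nu a b = table_nu ! a ! b"
    by code_simp
  then show "a < 8 \<Longrightarrow> b < 8 \<Longrightarrow> gram squares_nu a b = table_nu ! a ! b"
    by simp
qed

text \<open>The flag number read off directly from adjacencies. It also has a value when vertices
  coincide, as happens in tuples with repetitions.\<close>

definition pair_code :: "('a \<Rightarrow> 'a \<Rightarrow> bool) \<Rightarrow> 'a \<Rightarrow> 'a \<Rightarrow> 'a \<Rightarrow> nat" where
  "pair_code e r x y = of_bool (e r x) + of_bool (e r y) + 3 * of_bool (e x y)"

definition star_code :: "('a \<Rightarrow> 'a \<Rightarrow> bool) \<Rightarrow> 'a \<Rightarrow> 'a \<Rightarrow> 'a \<Rightarrow> 'a \<Rightarrow> nat" where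
  "star_code e a b c x = of_bool (e a x) + 2 * of_bool (e b x) + 4 * of_bool (e c x)"

text \<open>Each isomorphism class of types has a matrix for one labelling only: a single edge must
  join the first two roots, and the centre of a cherry must come first. All other labellings get the
  empty sum.\<close>

definition root_squares :: "bool \<Rightarrow> bool \<Rightarrow> bool \<Rightarrow> (int \<times> int list) list" where
  "root_squares p q r =
    (if r then [] else if p then if q then squares_nu else squares_mu
     else if q then [] else squares_sigma)"

text \<open>The entries are scaled by \<open>4 \<cdot> 302330880\<close>: the matrix of the single-vertex type is evaluated at
  ordered instead of unordered pairs, twice, so it enters with the relative weight \<open>1 / 4\<close>.\<close>

definition gram_term :: "('a \<Rightarrow> 'a \<Rightarrow> bool) \<Rightarrow> 'a list \<Rightarrow> int" where
  "gram_term e xs = (case xs of [a, b, c, x, y] \<Rightarrow>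
     gram squares_one (pair_code e a b c) (pair_code e a x y)
     + 4 * gram (root_squares (e a b) (e a c) (e b c)) (star_code e a b c x) (star_code e a b c y)
   | _ \<Rightarrow> 0)"

definition table_term ::
  "int list list \<Rightarrow> int list list \<Rightarrow> int list list \<Rightarrow> int list list \<Rightarrow>
   ('a \<Rightarrow> 'a \<Rightarrow> bool) \<Rightarrow> 'a list \<Rightarrow> int" where
  "table_term T1 Ts Tm Tn e xs = (case xs of [a, b, c, x, y] \<Rightarrow>
     T1 ! pair_code e a b c ! pair_code e a x y
     + (if e b c then 0
        else if e a b then
          4 * (if e a c then Tn else Tm) ! star_code e a b c x ! star_code e a b c y
        else if e a c then 0
        else 4 * Ts ! star_code e a b c x ! star_code e a b c y)
   | _ \<Rightarrow> 0)"

lemma pair_code_less: "pair_code e r x y < 6"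
  by (simp add: pair_code_def)

lemma star_code_less: "star_code e a b c x < 8"
  by (simp add: star_code_def)

lemma gram_Nil [simp]: "gram [] a b = 0"
  by (simp add: gram_def)

lemma gram_term_eq_table_term:
  "gram_term e xs = table_term table_one table_sigma table_mu table_nu e xs"
  by (simp add: gram_term_def table_term_def root_squares_def pair_code_less star_code_less
      table_one table_sigma table_mu table_nu split: list.split)

section \<open>The finite check over adjacency matrices on five vertices\<close>

definition adj_rows :: "bool list \<Rightarrow> bool list list" where
  "adj_rows b =
    [[False, b ! 0, b ! 1, b ! 2, b ! 3],
     [b ! 0, False, b ! 4, b ! 5, b ! 6],
     [b ! 1, b ! 4, False, b ! 7, b ! 8],
     [b ! 2, b ! 5, b ! 7, False, b ! 9],
     [b ! 3, b ! 6, b ! 8, b ! 9, False]]"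

definition row_sums :: "bool list list \<Rightarrow> nat list" where
  "row_sums A = map (\<lambda>r. length (filter (\<lambda>x. x) r)) A"

definition table_sum ::
  "int list list \<Rightarrow> int list list \<Rightarrow> int list list \<Rightarrow> int list list \<Rightarrow>
   nat list list \<Rightarrow> bool list list \<Rightarrow> int" where
  "table_sum T1 Ts Tm Tn ps A = sum_list (map (table_term T1 Ts Tm Tn (\<lambda>i j. A ! i ! j)) ps)"

text \<open>Ordering the vertices by degree leaves 84 of the 1024 adjacency matrices to be evaluated. The
  tables are parameters so that \<open>code_simp\<close> does not unfold them at every lookup;
  \<open>303750000\<close> is \<open>4 \<cdot> 302330880 \<cdot> 15625 / 62208\<close>.\<close>

definition sorted_bound ::
  "int list list \<Rightarrow> int list list \<Rightarrow> int list list \<Rightarrow> int list list \<Rightarrow>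
   nat list list \<Rightarrow> bool list list \<Rightarrow> bool" where
  "sorted_bound T1 Ts Tm Tn ps A =
    (if sorted (row_sums A) then table_sum T1 Ts Tm Tn ps A \<le> 303750000 else True)"

text \<open>The 1024 edge vectors are checked in four blocks of 256, one for each choice of the
  first two entries. A matrix with unsorted row sums passes without any table lookup.\<close>

lemma sorted_bound_0:
  "\<forall>b\<in>set (List.n_lists 8 [False, True]).
     sorted_bound table_one table_sigma table_mu table_nu
       (permutations_of_set_list [0, 1, 2, 3, 4]) (adj_rows (False # False # b))"
  by code_simp

lemma sorted_bound_1:
  "\<forall>b\<in>set (List.n_lists 8 [False, True]).
     sorted_bound table_one table_sigma table_mu table_nu
       (permutations_of_set_list [0, 1, 2, 3, 4]) (adj_rows (False # True # b))"
  by code_simp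

lemma sorted_bound_2:
  "\<forall>b\<in>set (List.n_lists 8 [False, True]).
     sorted_bound table_one table_sigma table_mu table_nu
       (permutations_of_set_list [0, 1, 2, 3, 4]) (adj_rows (True # False # b))"
  by code_simp

lemma sorted_bound_3:
  "\<forall>b\<in>set (List.n_lists 8 [False, True]).
     sorted_bound table_one table_sigma table_mu table_nu
       (permutations_of_set_list [0, 1, 2, 3, 4]) (adj_rows (True # True # b))"
  by code_simp

lemma sorted_bound_all:
  assumes "length b = 10"
  shows "sorted_bound table_one table_sigma table_mu table_nu
    (permutations_of_set_list [0, 1, 2, 3, 4]) (adj_rows b)"
proof -
  obtain p q b' where b: "b = p # q # b'" "length b' = 8"
    using assms by (auto simp: length_Suc_conv eval_nat_numeral)
  have "b' \<in> set (List.n_lists 8 [False, True])"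
    using b(2) by (auto simp: set_n_lists)
  note bound = sorted_bound_0[rule_format, OF this] sorted_bound_1[rule_format, OF this]
    sorted_bound_2[rule_format, OF this] sorted_bound_3[rule_format, OF this]
  show ?thesis
    using bound unfolding b(1) by (cases p; cases q) (simp_all only:)
qed

text \<open>\<open>C4_pendant\<close> has density 1 in itself, so here the bound must drop by the
  whole scale \<open>4 * 302330880\<close>. One labelling suffices because the total over all
  orderings is invariant under isomorphism.\<close>

lemma table_sum_C4_pendant:
  "table_sum table_one table_sigma table_mu table_nu (permutations_of_set_list [0, 1, 2, 3, 4])
     (adj_rows [True, False, True, True, True, False, False, True, False, False])
   \<le> 303750000 - 4 * 302330880"
  by code_simp

section \<open>Representatives\<close>

lemma graph_iso_refl: "graph_iso G G"
  unfolding graph_iso_def edge_compat_def by (rule exI[of _ id]) simp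

lemma graph_iso_sym:
  assumes "graph_iso G H"
  shows "graph_iso H G"
proof -
  obtain \<phi> where \<phi>: "bij_betw \<phi> (verts G) (verts H)" "edge_compat \<phi> G H"
    using assms unfolding graph_iso_def by blast
  let ?\<psi> = "inv_into (verts G) \<phi>"
  have \<psi>: "bij_betw ?\<psi> (verts H) (verts G)"
    by (rule bij_betw_inv_into[OF \<phi>(1)])
  moreover have "edge_compat ?\<psi> H G"
    unfolding edge_compat_def
  proof (intro ballI)
    fix u v assume "u \<in> verts H" "v \<in> verts H"
    then show "{u, v} \<in> edges H \<longleftrightarrow> {?\<psi> u, ?\<psi> v} \<in> edges G"
      using \<phi>(2) bij_betw_apply[OF \<psi>] bij_betw_inv_into_right[OF \<phi>(1)]
      unfolding edge_compat_def by simp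
  qed
  ultimately show ?thesis unfolding graph_iso_def by blast
qed

lemma graph_iso_trans:
  assumes "graph_iso G H" "graph_iso H K"
  shows "graph_iso G K"
proof -
  obtain \<phi> \<psi> where "bij_betw \<phi> (verts G) (verts H)" "edge_compat \<phi> G H"
    "bij_betw \<psi> (verts H) (verts K)" "edge_compat \<psi> H K"
    using assms unfolding graph_iso_def by blast
  then show ?thesis
    unfolding graph_iso_def edge_compat_def
    by (intro exI[of _ "\<psi> \<circ> \<phi>"]) (simp add: bij_betw_trans bij_betw_apply)
qed

lemma rep_list_someI:
  assumes "\<exists>xs. distinct xs \<and> set xs \<subseteq> A \<and> (\<forall>x\<in>A. \<exists>!y. y \<in> set xs \<and> R x y)"
  shows "distinct (rep_list R A)" "set (rep_list R A) \<subseteq> A"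
    "\<And>x. x \<in> A \<Longrightarrow> \<exists>!y. y \<in> set (rep_list R A) \<and> R x y"
proof -
  have "distinct (rep_list R A) \<and> set (rep_list R A) \<subseteq> A \<and>
      (\<forall>x\<in>A. \<exists>!y. y \<in> set (rep_list R A) \<and> R x y)"
    unfolding rep_list_def by (rule someI_ex[OF assms])
  then show "distinct (rep_list R A)" "set (rep_list R A) \<subseteq> A"
    "\<And>x. x \<in> A \<Longrightarrow> \<exists>!y. y \<in> set (rep_list R A) \<and> R x y"
    by simp_all
qed

text \<open>\<open>rep_list_exists\<close> asks for an equivalence relation on the whole type.
  Equality of \<open>f\<close>-values is one and agrees with \<open>R\<close> on \<open>A\<close>.
  The invariant then enumerates the classes although the list itself is an unknown choice.\<close>

lemma rep_list_spec:
  assumes "finite A"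
    and "\<And>x y. x \<in> A \<Longrightarrow> y \<in> A \<Longrightarrow> R x y \<longleftrightarrow> f x = f y"
  shows "distinct (rep_list R A)" "set (rep_list R A) \<subseteq> A"
    "bij_betw f (set (rep_list R A)) (f ` A)"
proof -
  have "\<exists>xs. distinct xs \<and> set xs \<subseteq> A \<and> (\<forall>x\<in>A. \<exists>!y. y \<in> set xs \<and> f x = f y)"
    by (rule rep_list_exists[OF assms(1), where R = "\<lambda>x y. f x = f y"]) auto
  then have "\<exists>xs. distinct xs \<and> set xs \<subseteq> A \<and> (\<forall>x\<in>A. \<exists>!y. y \<in> set xs \<and> R x y)"
    using assms(2) by (elim ex_forward) (simp add: subset_iff cong: conj_cong)
  note * = rep_list_someI[OF this]
  show "distinct (rep_list R A)" and sub: "set (rep_list R A) \<subseteq> A" by fact+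
  have ex: "\<exists>!y. y \<in> set (rep_list R A) \<and> f x = f y" if "x \<in> A" for x
  proof -
    have "\<exists>!y. y \<in> set (rep_list R A) \<and> R x y" by (rule *(3)[OF that])
    moreover have "y \<in> set (rep_list R A) \<and> R x y \<longleftrightarrow> y \<in> set (rep_list R A) \<and> f x = f y" for y
      using sub assms(2)[OF that, of y] by blast
    ultimately show ?thesis by simp
  qed
  show "bij_betw f (set (rep_list R A)) (f ` A)"
    unfolding bij_betw_def
  proof
    show "inj_on f (set (rep_list R A))"
      using ex sub by (intro inj_onI) (metis subset_iff)
    show "f ` set (rep_list R A) = f ` A"
    proof
      show "f ` A \<subseteq> f ` set (rep_list R A)"
      proof
        fix z assume "z \<in> f ` A"
        then obtain x where "x \<in> A" "z = f x" by blast
        with ex[of x] show "z \<in> f ` set (rep_list R A)" by auto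
      qed
    qed (use sub in blast)
  qed
qed

lemma finite_graphs_on: "finite {G :: nat sgraph. is_graph G \<and> verts G = {..<N}}"
proof (rule finite_subset)
  show "{G :: nat sgraph. is_graph G \<and> verts G = {..<N}} \<subseteq> {{..<N}} \<times> Pow (Pow {..<N})"
    by (auto simp: is_graph_def) (meson lessThan_iff subsetD)
qed auto

lemma graph_reps_spec:
  "set (graph_reps N) \<subseteq> {G. is_graph G \<and> verts G = {..<N}}"
  "is_graph G \<Longrightarrow> verts G = {..<N} \<Longrightarrow> \<exists>!H. H \<in> set (graph_reps N) \<and> graph_iso G H"
proof -
  let ?A = "{G :: nat sgraph. is_graph G \<and> verts G = {..<N}}"
  have "\<exists>xs. distinct xs \<and> set xs \<subseteq> ?A \<and> (\<forall>x\<in>?A. \<exists>!y. y \<in> set xs \<and> graph_iso x y)"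
    by (rule rep_list_exists[OF finite_graphs_on graph_iso_refl graph_iso_sym graph_iso_trans])
  note * = rep_list_someI[OF this, folded graph_reps_def]
  show "set (graph_reps N) \<subseteq> ?A" by (rule *(2))
  show "is_graph G \<Longrightarrow> verts G = {..<N} \<Longrightarrow> \<exists>!H. H \<in> set (graph_reps N) \<and> graph_iso G H"
    by (rule *(3)) simp
qed

lemma is_graph_induced: "is_graph G \<Longrightarrow> X \<subseteq> verts G \<Longrightarrow> is_graph (induced G X)"
  unfolding is_graph_def induced_def by (auto intro: finite_subset)

lemma verts_induced [simp]: "verts (induced G X) = X"
  by (simp add: induced_def)

lemma edges_induced: "e \<in> edges (induced G X) \<longleftrightarrow> e \<in> edges G \<and> e \<subseteq> X"
  by (simp add: induced_def)

lemma is_graph_transport: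
  assumes "is_graph G" and "bij_betw \<phi> W (verts G)"
  defines "H \<equiv> (W, {{x, y} | x y. x \<in> W \<and> y \<in> W \<and> {\<phi> x, \<phi> y} \<in> edges G})"
  shows "is_graph H" "edge_compat \<phi> H G"
proof -
  have "card {x, y} = 2" if "{\<phi> x, \<phi> y} \<in> edges G" for x y
  proof -
    have "card {\<phi> x, \<phi> y} = 2" using assms(1) that by (auto simp: is_graph_def)
    then have "x \<noteq> y" by auto
    then show ?thesis by simp
  qed
  moreover have "finite W"
    using assms(1,2) bij_betw_finite by (auto simp: is_graph_def)
  ultimately show "is_graph H" unfolding is_graph_def H_def by auto
  show "edge_compat \<phi> H G"
    unfolding edge_compat_def H_def by (auto simp: doubleton_eq_iff insert_commute)
qed

text \<open>A graph on any vertex set is first pulled back along a bijection to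
  \<open>{..<N}\<close>, where the representatives live.\<close>

lemma ex_rep:
  assumes "is_graph G" "order G = N"
  shows "\<exists>!H. H \<in> set (graph_reps N) \<and> graph_iso G H"
proof -
  obtain \<phi> where \<phi>: "bij_betw \<phi> {..<N} (verts G)"
    using assms ex_bij_betw_nat_finite[of "verts G"]
    by (auto simp: is_graph_def lessThan_atLeast0)
  let ?H = "({..<N}, {{x, y} | x y. x \<in> {..<N} \<and> y \<in> {..<N} \<and> {\<phi> x, \<phi> y} \<in> edges G})"
  have H: "is_graph ?H" "graph_iso ?H G"
    using is_graph_transport[OF assms(1) \<phi>] \<phi> unfolding graph_iso_def by auto
  then have ex1: "\<exists>!K. K \<in> set (graph_reps N) \<and> graph_iso ?H K"
    by (intro graph_reps_spec(2)) auto
  have "graph_iso G K \<longleftrightarrow> graph_iso ?H K" for K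
    using graph_iso_trans[OF H(2)] graph_iso_trans[OF graph_iso_sym[OF H(2)]] by blast
  then show ?thesis using ex1 by blast
qed

text \<open>Double counting: a vertex set of size \<open>N\<close> induces a copy of exactly one
  representative. This is how the unknown representatives leave the sums.\<close>

lemma sum_over_reps:
  fixes G :: "nat sgraph" and h :: "nat sgraph \<Rightarrow> real"
  assumes "is_graph G"
    and "\<And>H K. is_graph H \<Longrightarrow> is_graph K \<Longrightarrow> graph_iso H K \<Longrightarrow> h H = h K"
  shows "(\<Sum>X | X \<subseteq> verts G \<and> card X = N. h (induced G X))
    = (\<Sum>F\<in>set (graph_reps N). h F * real (ind_count F G))"
proof -
  let ?A = "{X. X \<subseteq> verts G \<and> card X = N}"
  have fin: "finite ?A" using assms(1) by (simp add: is_graph_def)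
  have gr: "is_graph F" "order F = N" if "F \<in> set (graph_reps N)" for F
    using that graph_reps_spec(1)[of N] by auto
  have ind: "is_graph (induced G X)" "order (induced G X) = N" if "X \<in> ?A" for X
    using that is_graph_induced[OF assms(1)] by auto
  have "(\<Sum>F\<in>set (graph_reps N). h F * real (ind_count F G))
      = (\<Sum>F\<in>set (graph_reps N). \<Sum>X\<in>?A. if graph_iso F (induced G X) then h F else 0)"
  proof (rule sum.cong[OF refl])
    fix F assume F: "F \<in> set (graph_reps N)"
    have "{X. X \<subseteq> verts G \<and> card X = order F \<and> graph_iso F (induced G X)}
        = ?A \<inter> {X. graph_iso F (induced G X)}"
      using gr(2)[OF F] by auto
    then show "h F * real (ind_count F G) = (\<Sum>X\<in>?A. if graph_iso F (induced G X) then h F else 0)"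
      using fin by (simp add: ind_count_def sum.If_cases)
  qed
  also have "\<dots> = (\<Sum>X\<in>?A. \<Sum>F\<in>set (graph_reps N). if graph_iso F (induced G X) then h F else 0)"
    by (rule sum.swap)
  also have "\<dots> = (\<Sum>X\<in>?A. h (induced G X))"
  proof (rule sum.cong[OF refl])
    fix X assume X: "X \<in> ?A"
    obtain K where K: "K \<in> set (graph_reps N)" "graph_iso (induced G X) K"
      "\<And>H. H \<in> set (graph_reps N) \<Longrightarrow> graph_iso (induced G X) H \<Longrightarrow> H = K"
      using ex_rep[OF ind[OF X]] by blast
    have "graph_iso F (induced G X) \<longleftrightarrow> F = K" if "F \<in> set (graph_reps N)" for F
      using K(3)[OF that graph_iso_sym] graph_iso_sym[OF K(2)] by blast
    then have "(\<Sum>F\<in>set (graph_reps N). if graph_iso F (induced G X) then h F else 0)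
        = (\<Sum>F\<in>set (graph_reps N). if F = K then h K else 0)"
      by (intro sum.cong) simp_all
    also have "\<dots> = h K" using K(1) by simp
    also have "\<dots> = h (induced G X)"
      by (rule assms(2)[OF _ _ graph_iso_sym[OF K(2)], OF gr(1)[OF K(1)] ind(1)[OF X]])
    finally show "(\<Sum>F\<in>set (graph_reps N). if graph_iso F (induced G X) then h F else 0)
        = h (induced G X)" .
  qed
  finally show ?thesis ..
qed

section \<open>Flags with at most two unlabelled vertices\<close>

text \<open>Numbers the isomorphism classes of flags of a fixed type with one root and two unlabelled
  vertices, or with three roots and one unlabelled vertex; \<open>X\<close> is the set of unlabelled vertices.\<close>

definition unlabelled_code :: "nat \<Rightarrow> 'a flag \<Rightarrow> 'a set \<Rightarrow> nat" where
  "unlabelled_code q = (\<lambda>(H, h) X.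
     if q = 1 then
       card {x \<in> X. {h 0, x} \<in> edges H} + 3 * of_bool (\<exists>x\<in>X. \<exists>y\<in>X. {x, y} \<in> edges H)
     else
       of_bool (\<exists>x\<in>X. {h 0, x} \<in> edges H) + 2 * of_bool (\<exists>x\<in>X. {h 1, x} \<in> edges H)
       + 4 * of_bool (\<exists>x\<in>X. {h 2, x} \<in> edges H))"

definition flag_code :: "nat sgraph \<Rightarrow> 'a flag \<Rightarrow> nat" where
  "flag_code \<tau> \<Phi> = unlabelled_code (order \<tau>) \<Phi> (verts (fst \<Phi>) - roots \<tau> \<Phi>)"

definition code_bound :: "nat \<Rightarrow> nat" where
  "code_bound q = (if q = 1 then 6 else 8)"

definition rest_size :: "nat \<Rightarrow> nat" where
  "rest_size q = (if q = 1 then 2 else 1)"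

lemma is_graph_no_loop: "is_graph G \<Longrightarrow> {x, x} \<notin> edges G"
  by (auto simp: is_graph_def)

lemma flag_basics:
  assumes "is_flag \<tau> (H, h)" "is_type q \<tau>"
  shows "is_graph H" "inj_on h {..<q}" "h ` {..<q} \<subseteq> verts H" "roots \<tau> (H, h) = h ` {..<q}"
    "\<And>i j. i < q \<Longrightarrow> j < q \<Longrightarrow> {i, j} \<in> edges \<tau> \<longleftrightarrow> {h i, h j} \<in> edges H" "order \<tau> = q"
    "finite (verts H)"
  using assms by (auto simp: is_flag_def is_type_def injections_def roots_def edge_compat_def
      is_graph_def)

text \<open>Only unlabelled vertices need attention: on the roots the map must take
  \<open>h i\<close> to \<open>h' i\<close>, and edges among roots agree because both sides embed
  \<open>\<tau>\<close>.\<close>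

lemma flag_isoI:
  assumes F: "is_flag \<tau> (H, h)" "is_flag \<tau> (H', h')" "is_type q \<tau>"
    and \<psi>: "bij_betw \<psi> (verts H - h ` {..<q}) (verts H' - h' ` {..<q})"
    and e1: "\<And>x y. x \<in> verts H - h ` {..<q} \<Longrightarrow> y \<in> verts H - h ` {..<q} \<Longrightarrow>
      {x, y} \<in> edges H \<longleftrightarrow> {\<psi> x, \<psi> y} \<in> edges H'"
    and e2: "\<And>x i. x \<in> verts H - h ` {..<q} \<Longrightarrow> i < q \<Longrightarrow>
      {h i, x} \<in> edges H \<longleftrightarrow> {h' i, \<psi> x} \<in> edges H'"
  shows "flag_iso \<tau> (H, h) (H', h')"
proof -
  note f = flag_basics[OF F(1,3)] and f' = flag_basics[OF F(2,3)]
  let ?R = "h ` {..<q}" and ?R' = "h' ` {..<q}"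
  define \<phi> where "\<phi> x = (if x \<in> ?R then h' (inv_into {..<q} h x) else \<psi> x)" for x
  have hi: "\<phi> (h i) = h' i" if "i < q" for i
    using that f(2) by (simp add: \<phi>_def)
  have "bij_betw h {..<q} ?R" using f(2) by (simp add: bij_betw_def)
  then have "bij_betw (inv_into {..<q} h) ?R {..<q}" by (rule bij_betw_inv_into)
  moreover have "bij_betw h' {..<q} ?R'" using f'(2) by (simp add: bij_betw_def)
  ultimately have "bij_betw (h' \<circ> inv_into {..<q} h) ?R ?R'" by (rule bij_betw_trans)
  then have "bij_betw \<phi> ?R ?R'"
    by (rule bij_betw_cong[THEN iffD1, rotated]) (simp add: \<phi>_def)
  moreover have "bij_betw \<phi> (verts H - ?R) (verts H' - ?R')"
    by (rule bij_betw_cong[THEN iffD1, OF _ \<psi>]) (simp add: \<phi>_def)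
  ultimately have "bij_betw \<phi> (?R \<union> (verts H - ?R)) (?R' \<union> (verts H' - ?R'))"
    by (rule bij_betw_combine) auto
  then have bij: "bij_betw \<phi> (verts H) (verts H')"
    using f(3) f'(3) by (simp add: Un_absorb1)
  have "{u, v} \<in> edges H \<longleftrightarrow> {\<phi> u, \<phi> v} \<in> edges H'" if uv: "u \<in> verts H" "v \<in> verts H" for u v
  proof -
    consider i j where "u = h i" "v = h j" "i < q" "j < q"
      | i where "u = h i" "i < q" "v \<in> verts H - ?R"
      | i where "v = h i" "i < q" "u \<in> verts H - ?R"
      | "u \<in> verts H - ?R" "v \<in> verts H - ?R"
      using uv by blast
    then show ?thesis
    proof cases
      case 1
      then show ?thesis using hi f(5)[of i j] f'(5)[of i j] by simp
    next
      case 2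
      then show ?thesis using hi e2 by (simp add: \<phi>_def)
    next
      case 3
      then show ?thesis using hi e2[of u i] by (simp add: \<phi>_def insert_commute)
    next
      case 4
      then show ?thesis using e1 by (simp add: \<phi>_def)
    qed
  qed
  moreover have "verts \<tau> = {..<q}" using F(3) by (simp add: is_type_def)
  ultimately show ?thesis
    unfolding flag_iso_def edge_compat_def using bij hi by auto
qed

lemma flag_iso_code:
  assumes F: "is_flag \<tau> (H, h)" "is_flag \<tau> (H', h')" "is_type q \<tau>" and q: "q = 1 \<or> q = 3"
    and iso: "flag_iso \<tau> (H, h) (H', h')"
  shows "flag_code \<tau> (H, h) = flag_code \<tau> (H', h')"
proof -
  note f = flag_basics[OF F(1,3)] and f' = flag_basics[OF F(2,3)]
  let ?U = "verts H - h ` {..<q}" and ?U' = "verts H' - h' ` {..<q}"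
  obtain \<phi> where \<phi>: "bij_betw \<phi> (verts H) (verts H')" "edge_compat \<phi> H H'"
    "\<And>i. i < q \<Longrightarrow> \<phi> (h i) = h' i"
    using iso F(3) unfolding flag_iso_def is_type_def by auto
  have img: "\<phi> ` h ` {..<q} = h' ` {..<q}" using \<phi>(3) by (auto simp: image_iff)
  have U': "?U' = \<phi> ` ?U"
    using \<phi>(1) f(3) inj_on_image_set_diff[of \<phi> "verts H" "verts H" "h ` {..<q}"]
    by (simp add: bij_betw_def img)
  have inj: "inj_on \<phi> ?U" using \<phi>(1) by (auto simp: bij_betw_def inj_on_def)
  have e1: "{x, y} \<in> edges H \<longleftrightarrow> {\<phi> x, \<phi> y} \<in> edges H'" if "x \<in> ?U" "y \<in> ?U" for x y
    using that \<phi>(2) by (auto simp: edge_compat_def)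
  have e2: "{h i, x} \<in> edges H \<longleftrightarrow> {h' i, \<phi> x} \<in> edges H'" if "x \<in> ?U" "i < q" for i x
    using that \<phi>(2,3) f(3) by (auto simp: edge_compat_def)
  have "{x \<in> ?U'. {h' 0, x} \<in> edges H'} = \<phi> ` {x \<in> ?U. {h 0, x} \<in> edges H}" if "0 < q"
    unfolding U' using e2[OF _ that] by auto
  then have c: "card {x \<in> ?U'. {h' 0, x} \<in> edges H'} = card {x \<in> ?U. {h 0, x} \<in> edges H}" if "0 < q"
    using that inj by (simp add: card_image inj_on_def)
  have ex: "(\<exists>x\<in>?U'. {h' i, x} \<in> edges H') \<longleftrightarrow> (\<exists>x\<in>?U. {h i, x} \<in> edges H)" if "i < q" for i
    unfolding U' using e2[OF _ that] by auto
  have ex2: "(\<exists>x\<in>?U'. \<exists>y\<in>?U'. {x, y} \<in> edges H') \<longleftrightarrow> (\<exists>x\<in>?U. \<exists>y\<in>?U. {x, y} \<in> edges H)"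
    unfolding U' using e1 by auto
  show ?thesis
    using q
  proof
    assume "q = 1"
    then show ?thesis using c ex2 f(4,6) f'(4)
      by (simp add: flag_code_def unlabelled_code_def)
  next
    assume "q = 3"
    then show ?thesis using ex[of 0] ex[of 1] ex[of 2] f(4,6) f'(4)
      by (simp add: flag_code_def unlabelled_code_def)
  qed
qed

lemma code3_eq:
  "of_bool a + 2 * of_bool b + 4 * of_bool c = (of_bool a' + 2 * of_bool b' + 4 * of_bool c' :: nat)
   \<longleftrightarrow> (a = a') \<and> (b = b') \<and> (c = c')"
  by (auto simp: of_bool_def split: if_splits)

text \<open>The code is a complete invariant. With one root it gives the number of root edges and
  the adjacency of the two unlabelled vertices, which fixes the flag up to exchanging them. With
  three roots its binary digits tell the neighbours of the single unlabelled vertex.\<close>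

lemma flag_code_iso:
  assumes F: "is_flag \<tau> (H, h)" "is_flag \<tau> (H', h')" "is_type q \<tau>" and q: "q = 1 \<or> q = 3"
    and size: "order H = q + rest_size q" "order H' = q + rest_size q"
    and eq: "flag_code \<tau> (H, h) = flag_code \<tau> (H', h')"
  shows "flag_iso \<tau> (H, h) (H', h')"
proof -
  note f = flag_basics[OF F(1,3)] and f' = flag_basics[OF F(2,3)]
  let ?U = "verts H - h ` {..<q}" and ?U' = "verts H' - h' ` {..<q}"
  have card: "card ?U = rest_size q" "card ?U' = rest_size q"
    using f(2,3,7) f'(2,3,7) size by (simp_all add: card_Diff_subset card_image)
  show ?thesis
    using q
  proof
    assume q: "q = 1"
    obtain x y where U: "?U = {x, y}" "x \<noteq> y"
      using card(1) q by (auto simp: rest_size_def card_2_iff)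
    obtain x' y' where U': "?U' = {x', y'}" "x' \<noteq> y'"
      using card(2) q by (auto simp: rest_size_def card_2_iff)
    define a b a' b' where "a \<equiv> {h 0, x} \<in> edges H" and "b \<equiv> {h 0, y} \<in> edges H"
      and "a' \<equiv> {h' 0, x'} \<in> edges H'" and "b' \<equiv> {h' 0, y'} \<in> edges H'"
    have "{z \<in> ?U. {h 0, z} \<in> edges H} = (if a then {x} else {}) \<union> (if b then {y} else {})"
      unfolding U a_def b_def by auto
    then have c: "card {z \<in> ?U. {h 0, z} \<in> edges H} = of_bool a + of_bool b"
      using U(2) by (simp add: of_bool_def)
    have "{z \<in> ?U'. {h' 0, z} \<in> edges H'} = (if a' then {x'} else {}) \<union> (if b' then {y'} else {})"
      unfolding U' a'_def b'_def by auto
    then have c': "card {z \<in> ?U'. {h' 0, z} \<in> edges H'} = of_bool a' + of_bool b'"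
      using U'(2) by (simp add: of_bool_def)
    have e: "(\<exists>x\<in>?U. \<exists>y\<in>?U. {x, y} \<in> edges H) \<longleftrightarrow> {x, y} \<in> edges H"
      unfolding U using is_graph_no_loop[OF f(1)] by (auto simp: insert_commute)
    have e': "(\<exists>x\<in>?U'. \<exists>y\<in>?U'. {x, y} \<in> edges H') \<longleftrightarrow> {x', y'} \<in> edges H'"
      unfolding U' using is_graph_no_loop[OF f'(1)] by (auto simp: insert_commute)
    have "of_bool a + of_bool b + 3 * of_bool ({x, y} \<in> edges H)
        = (of_bool a' + of_bool b' + 3 * of_bool ({x', y'} \<in> edges H') :: nat)"
      using eq c c' e e' f(4,6) f'(4) q
      by (simp add: flag_code_def unlabelled_code_def)
    \<comment> \<open>At most two edges reach the root, so the factor 3 separates the two parts of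
      the code.\<close>
    then have xy: "{x, y} \<in> edges H \<longleftrightarrow> {x', y'} \<in> edges H'"
      and ab: "a = a' \<and> b = b' \<or> a = b' \<and> b = a'"
      by (auto simp: of_bool_def split: if_splits)
    \<comment> \<open>If the root edges match crosswise, \<open>x'\<close> and \<open>y'\<close>
      exchange their places.\<close>
    obtain x'' y'' where 1: "?U' = {x'', y''}" "x'' \<noteq> y''"
      "a \<longleftrightarrow> {h' 0, x''} \<in> edges H'" "b \<longleftrightarrow> {h' 0, y''} \<in> edges H'"
      "{x'', y''} = {x', y'}"
    proof (cases "a = a' \<and> b = b'")
      case True
      then show ?thesis using that[of x' y'] U' by (simp add: a'_def b'_def)
    next
      case False
      then have "a = b' \<and> b = a'" using ab by blast
      then show ?thesis using that[of y' x'] U' by (simp add: a'_def b'_def insert_commute)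
    qed
    have e'': "{x, y} \<in> edges H \<longleftrightarrow> {x'', y''} \<in> edges H'"
      by (simp only: 1(5) xy)
    let ?\<psi> = "\<lambda>z. if z = x then x'' else y''"
    show ?thesis
    proof (rule flag_isoI[OF F])
      show "bij_betw ?\<psi> ?U ?U'"
        unfolding U(1) 1(1) using U(2) 1(2) by (auto simp: bij_betw_def inj_on_def)
      show "{u, v} \<in> edges H \<longleftrightarrow> {?\<psi> u, ?\<psi> v} \<in> edges H'" if "u \<in> ?U" "v \<in> ?U" for u v
        using that e'' U is_graph_no_loop[OF f(1)] is_graph_no_loop[OF f'(1)]
        by (auto simp: insert_commute)
      show "{h i, u} \<in> edges H \<longleftrightarrow> {h' i, ?\<psi> u} \<in> edges H'" if "u \<in> ?U" "i < q" for u i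
        using that U 1(3,4) q unfolding a_def b_def by auto
    qed
  next
    assume q: "q = 3"
    obtain x where U: "?U = {x}"
      using card(1) q by (auto simp: rest_size_def card_1_singleton_iff)
    obtain x' where U': "?U' = {x'}"
      using card(2) q by (auto simp: rest_size_def card_1_singleton_iff)
    have "flag_code \<tau> (H, h) = of_bool ({h 0, x} \<in> edges H) + 2 * of_bool ({h 1, x} \<in> edges H)
        + 4 * of_bool ({h 2, x} \<in> edges H)"
      unfolding flag_code_def unlabelled_code_def fst_conv f(4) U f(6) prod.case using q by simp
    moreover have "flag_code \<tau> (H', h') = of_bool ({h' 0, x'} \<in> edges H')
        + 2 * of_bool ({h' 1, x'} \<in> edges H') + 4 * of_bool ({h' 2, x'} \<in> edges H')"
      unfolding flag_code_def unlabelled_code_def fst_conv f'(4) U' f(6) prod.case using q by simp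
    ultimately have "({h 0, x} \<in> edges H) = ({h' 0, x'} \<in> edges H')"
      "({h 1, x} \<in> edges H) = ({h' 1, x'} \<in> edges H')"
      "({h 2, x} \<in> edges H) = ({h' 2, x'} \<in> edges H')"
      using eq by (simp_all only: code3_eq)
    note h012 = this
    have *: "({h i, x} \<in> edges H) = ({h' i, x'} \<in> edges H')" if "i < 3" for i
    proof -
      have "i = 0 \<or> i = 1 \<or> i = 2" using that by linarith
      then show ?thesis using h012 by (elim disjE) (simp_all only:)
    qed
    show ?thesis
    proof (rule flag_isoI[OF F, of "\<lambda>_. x'"])
      show "bij_betw (\<lambda>_. x') ?U ?U'" unfolding U U' by (simp add: bij_betw_def)
      show "{u, v} \<in> edges H \<longleftrightarrow> {x', x'} \<in> edges H'" if "u \<in> ?U" "v \<in> ?U" for u v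
      proof -
        have "u = x" "v = x" using that unfolding U by simp_all
        then show ?thesis using is_graph_no_loop[OF f(1)] is_graph_no_loop[OF f'(1)] by simp
      qed
      show "{h i, u} \<in> edges H \<longleftrightarrow> {h' i, x'} \<in> edges H'" if "u \<in> ?U" "i < q" for u i
      proof -
        have "u = x" using that(1) unfolding U by simp
        then show ?thesis using *[of i] that(2) q by simp
      qed
    qed
  qed
qed

lemma flag_code_less:
  assumes F: "is_flag \<tau> (H, h)" "is_type q \<tau>" and q: "q = 1 \<or> q = 3"
    and size: "order H = q + rest_size q"
  shows "flag_code \<tau> (H, h) < code_bound q"
proof -
  note f = flag_basics[OF F]
  let ?U = "verts H - h ` {..<q}"
  have "card ?U = rest_size q"
    using f(2,3,7) size by (simp add: card_Diff_subset card_image)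
  moreover have "card {x \<in> ?U. {h 0, x} \<in> edges H} \<le> card ?U"
    using f(7) by (intro card_mono) auto
  ultimately show ?thesis
    using q f(4,6) by (auto simp: flag_code_def unlabelled_code_def code_bound_def rest_size_def)
qed

lemma finite_flags_on: "finite {(H :: nat sgraph, h :: nat \<Rightarrow> nat). is_flag \<tau> (H, h) \<and> verts H = {..<s}}"
proof (rule finite_subset)
  show "{(H :: nat sgraph, h :: nat \<Rightarrow> nat). is_flag \<tau> (H, h) \<and> verts H = {..<s}}
      \<subseteq> ({{..<s}} \<times> Pow (Pow {..<s})) \<times> ({..<order \<tau>} \<rightarrow>\<^sub>E {..<s})"
    by (auto simp: is_flag_def injections_def is_graph_def) (meson lessThan_iff subsetD)
qed (auto intro: finite_PiE)

text \<open>The roots sit at the first \<open>q\<close> numbers, and \<open>N\<close> is a freely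
  chosen set of edges not inside the roots; suitable choices of \<open>N\<close> realise every
  code.\<close>

lemma ex_flag_extension:
  assumes \<tau>: "is_type q \<tau>" and "q \<le> s" and N: "\<forall>e\<in>N. e \<subseteq> {..<s} \<and> card e = 2 \<and> \<not> e \<subseteq> {..<q}"
  defines "H \<equiv> ({..<s}, edges \<tau> \<union> N)" and "h \<equiv> restrict (\<lambda>i. i) {..<q}"
  shows "is_flag \<tau> (H, h)" "roots \<tau> (H, h) = {..<q}"
    "\<And>x y. q \<le> x \<Longrightarrow> {x, y} \<in> edges H \<longleftrightarrow> {x, y} \<in> N"
    "\<And>x y. q \<le> y \<Longrightarrow> {x, y} \<in> edges H \<longleftrightarrow> {x, y} \<in> N"
proof -
  have V: "verts \<tau> = {..<q}" and E: "\<And>e. e \<in> edges \<tau> \<Longrightarrow> e \<subseteq> {..<q} \<and> card e = 2"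
    using \<tau> by (auto simp: is_type_def is_graph_def)
  have "is_graph H"
    unfolding is_graph_def H_def using E N \<open>q \<le> s\<close> by fastforce
  moreover have "h \<in> injections (order \<tau>) (verts H)"
    using \<open>q \<le> s\<close> by (auto simp: injections_def H_def h_def V inj_on_def)
  moreover have "edge_compat h \<tau> H"
    using N by (auto simp: edge_compat_def H_def h_def V)
  ultimately show "is_flag \<tau> (H, h)" by (simp add: is_flag_def)
  show "roots \<tau> (H, h) = {..<q}" by (auto simp: roots_def V h_def)
  show "{x, y} \<in> edges H \<longleftrightarrow> {x, y} \<in> N" if "q \<le> x" for x y
    using E[of "{x, y}"] that by (auto simp: H_def)
  show "{x, y} \<in> edges H \<longleftrightarrow> {x, y} \<in> N" if "q \<le> y" for x y
    using E[of "{x, y}"] that by (auto simp: H_def)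
qed

lemma ex_flag_code:
  assumes \<tau>: "is_type q \<tau>" and q: "q = 1 \<or> q = 3" and k: "k < code_bound q"
  shows "\<exists>H h. is_flag \<tau> (H, h) \<and> verts H = {..<q + rest_size q} \<and> flag_code \<tau> (H, h) = k"
  using q
proof
  assume q: "q = 1"
  have "k = 0 \<or> k = 1 \<or> k = 2 \<or> k = 3 \<or> k = 4 \<or> k = 5"
    using k q by (auto simp: code_bound_def numeral_eq_Suc less_Suc_eq)
  \<comment> \<open>For \<open>k < 6\<close> the remainder modulo 3 is the number of root edges. A
    single one is given to the first unlabelled vertex.\<close>
  then have abc: "k = of_bool (k mod 3 > 0) + of_bool (k mod 3 = 2) + 3 * of_bool (k \<ge> 3)"
    by (elim disjE) simp_all
  define a b c where "a \<longleftrightarrow> k mod 3 > 0" and "b \<longleftrightarrow> k mod 3 = 2" and "c \<longleftrightarrow> k \<ge> 3"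
  note abc = abc[folded this]
  define N :: "nat set set" where "N = {e. a \<and> e = {0, 1} \<or> b \<and> e = {0, 2} \<or> c \<and> e = {1, 2}}"
  define H where "H = ({..<3 :: nat}, edges \<tau> \<union> N)"
  define h :: "nat \<Rightarrow> nat" where "h = restrict (\<lambda>i. i) {..<1}"
  have "\<forall>e\<in>N. e \<subseteq> {..<3} \<and> card e = 2 \<and> \<not> e \<subseteq> {..<1}"
    by (auto simp: N_def)
  note fl = ex_flag_extension[where s = 3 and N = N, OF \<tau>[unfolded q] _ this, folded H_def h_def,
      OF one_le_numeral]
  have "{..<3} - {..<1} = {1, 2 :: nat}" by auto
  moreover have "verts H = {..<3}" by (simp add: H_def)
  ultimately have U: "verts (fst (H, h)) - roots \<tau> (H, h) = {1, 2}"
    unfolding fl(2) by (simp only: fst_conv)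
  have N: "{0, 1} \<in> N \<longleftrightarrow> a" "{0, 2} \<in> N \<longleftrightarrow> b" "{1, 2} \<in> N \<longleftrightarrow> c" "{1, 1} \<notin> N" "{2, 2} \<notin> N"
    unfolding N_def by (simp_all add: doubleton_eq_iff)
  have "h 0 = 0" by (simp add: h_def)
  then have "{x \<in> {1, 2}. {h 0, x} \<in> edges H} = (if a then {1} else {}) \<union> (if b then {2} else {})"
    using fl(4)[of 1 0] fl(4)[of 2 0] N(1,2) by auto
  then have 1: "card {x \<in> {1, 2}. {h 0, x} \<in> edges H} = of_bool a + of_bool b" by simp
  have "{1, 1} \<notin> edges H" "{1, 2} \<in> edges H \<longleftrightarrow> c" "{2, 2} \<notin> edges H"
    using fl(3)[of 1 1] fl(3)[of 1 2] fl(3)[of 2 2] N(3-5) by simp_all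
  moreover have "{2, 1} \<in> edges H \<longleftrightarrow> {1, 2} \<in> edges H" by (simp only: insert_commute)
  moreover have "(\<exists>x\<in>{1, 2 :: nat}. \<exists>y\<in>{1, 2 :: nat}. P x y) \<longleftrightarrow> P 1 1 \<or> P 1 2 \<or> P 2 1 \<or> P 2 2" for P
    by blast
  ultimately have 2: "(\<exists>x\<in>{1, 2}. \<exists>y\<in>{1, 2}. {x, y} \<in> edges H) = c"
    by (simp only: simp_thms)
  have "order \<tau> = 1" using \<tau> q by (simp add: is_type_def)
  then have "flag_code \<tau> (H, h) = k"
    unfolding flag_code_def U unlabelled_code_def using 1 2 abc by simp
  then show ?thesis
    using fl(1) q by (intro exI[of _ H] exI[of _ h]) (simp add: H_def rest_size_def)
next
  assume q: "q = 3"
  have "k = 0 \<or> k = 1 \<or> k = 2 \<or> k = 3 \<or> k = 4 \<or> k = 5 \<or> k = 6 \<or> k = 7"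
    using k q by (auto simp: code_bound_def numeral_eq_Suc less_Suc_eq)
  then have abc: "k = of_bool (odd k) + 2 * of_bool (odd (k div 2)) + 4 * of_bool (k \<ge> 4)"
    by (elim disjE) simp_all
  define a b c where "a \<longleftrightarrow> odd k" and "b \<longleftrightarrow> odd (k div 2)" and "c \<longleftrightarrow> k \<ge> 4"
  note abc = abc[folded this]
  define N :: "nat set set" where "N = {e. a \<and> e = {0, 3} \<or> b \<and> e = {1, 3} \<or> c \<and> e = {2, 3}}"
  define H where "H = ({..<4 :: nat}, edges \<tau> \<union> N)"
  define h :: "nat \<Rightarrow> nat" where "h = restrict (\<lambda>i. i) {..<3}"
  have "\<forall>e\<in>N. e \<subseteq> {..<4} \<and> card e = 2 \<and> \<not> e \<subseteq> {..<3}"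
    by (auto simp: N_def)
  note N2 = this
  have le: "3 \<le> (4 :: nat)" by simp
  note fl = ex_flag_extension[where s = 4 and N = N, OF \<tau>[unfolded q] le N2, folded H_def h_def]
  have "{..<4} - {..<3} = {3 :: nat}" by auto
  moreover have "verts H = {..<4}" by (simp add: H_def)
  ultimately have U: "verts (fst (H, h)) - roots \<tau> (H, h) = {3}"
    unfolding fl(2) by (simp only: fst_conv)
  have "({h 0, 3} \<in> edges H) = a" "({h 1, 3} \<in> edges H) = b" "({h 2, 3} \<in> edges H) = c"
    unfolding fl(4)[of 3, OF order_refl] by (simp_all add: h_def N_def doubleton_eq_iff)
  moreover have "order \<tau> = 3" using \<tau> q by (simp add: is_type_def)
  ultimately have "flag_code \<tau> (H, h) = k"
    unfolding flag_code_def U unlabelled_code_def using abc by simp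
  then show ?thesis
    using fl(1) q by (intro exI[of _ H] exI[of _ h]) (simp add: H_def rest_size_def)
qed

text \<open>The position of a flag in \<open>flag_reps\<close> is unknown, but codes map positions
  bijectively onto an initial segment. From here on vectors and matrices are handled through
  codes.\<close>

lemma flag_reps_codes:
  assumes \<tau>: "is_type q \<tau>" and q: "q = 1 \<or> q = 3"
  defines "rs \<equiv> flag_reps \<tau> (q + rest_size q)"
  shows "distinct rs" "\<And>\<Phi>. \<Phi> \<in> set rs \<Longrightarrow> is_flag \<tau> \<Phi> \<and> verts (fst \<Phi>) = {..<q + rest_size q}"
    "bij_betw (flag_code \<tau>) (set rs) {..<code_bound q}"
    "bij_betw (\<lambda>i. flag_code \<tau> (rs ! i)) {..<length rs} {..<code_bound q}"
proof -
  let ?A = "{(H :: nat sgraph, h :: nat \<Rightarrow> nat). is_flag \<tau> (H, h) \<and> verts H = {..<q + rest_size q}}"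
  have iso: "flag_iso \<tau> \<Phi> \<Psi> \<longleftrightarrow> flag_code \<tau> \<Phi> = flag_code \<tau> \<Psi>" if "\<Phi> \<in> ?A" "\<Psi> \<in> ?A" for \<Phi> \<Psi>
  proof -
    obtain H h H' h' where "\<Phi> = (H, h)" "\<Psi> = (H', h')" by (cases \<Phi>; cases \<Psi>) blast
    with that show ?thesis
      using flag_iso_code[of \<tau> H h H' h', OF _ _ \<tau> q] flag_code_iso[of \<tau> H h H' h', OF _ _ \<tau> q]
      by auto
  qed
  note spec = rep_list_spec[of ?A "flag_iso \<tau>" "flag_code \<tau>", OF finite_flags_on iso,
      folded flag_reps_def]
  have img: "flag_code \<tau> ` ?A = {..<code_bound q}"
  proof
    show "flag_code \<tau> ` ?A \<subseteq> {..<code_bound q}"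
    proof
      fix k assume "k \<in> flag_code \<tau> ` ?A"
      then obtain H h where "k = flag_code \<tau> (H, h)" "is_flag \<tau> (H, h)" "verts H = {..<q + rest_size q}"
        by blast
      then show "k \<in> {..<code_bound q}" using flag_code_less[OF _ \<tau> q, of H h] by simp
    qed
    show "{..<code_bound q} \<subseteq> flag_code \<tau> ` ?A"
    proof
      fix k assume "k \<in> {..<code_bound q}"
      then obtain H h where "is_flag \<tau> (H, h)" "verts H = {..<q + rest_size q}" "flag_code \<tau> (H, h) = k"
        using ex_flag_code[OF \<tau> q, of k] by blast
      then show "k \<in> flag_code \<tau> ` ?A" by (intro image_eqI[of _ _ "(H, h)"]) auto
    qed
  qed
  show d: "distinct rs" unfolding rs_def by (rule spec(1)) auto
  have "set rs \<subseteq> ?A" unfolding rs_def by (rule spec(2)) auto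
  then show "\<And>\<Phi>. \<Phi> \<in> set rs \<Longrightarrow> is_flag \<tau> \<Phi> \<and> verts (fst \<Phi>) = {..<q + rest_size q}"
    by auto
  show b: "bij_betw (flag_code \<tau>) (set rs) {..<code_bound q}"
    unfolding rs_def img[symmetric] by (rule spec(3)) auto
  show "bij_betw (\<lambda>i. flag_code \<tau> (rs ! i)) {..<length rs} {..<code_bound q}"
    using bij_betw_trans[OF bij_betw_nth[OF d refl refl] b] by (simp add: comp_def)
qed

lemma is_flag_type_of:
  assumes "is_graph G" "f \<in> injections q (verts G)"
  shows "is_flag (type_of q f G) (G, f)"
  using assms edge_compat_type_of[of f q G] by (simp add: is_flag_def type_of_def)

lemma is_flag_induced:
  assumes "is_flag \<tau> (G, f)" "is_type q \<tau>" "X \<subseteq> verts G - f ` {..<q}" and q: "q = 1 \<or> q = 3"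
  shows "is_flag \<tau> (induced G (X \<union> f ` {..<q}), f)"
    "flag_code \<tau> (induced G (X \<union> f ` {..<q}), f) = unlabelled_code q (G, f) X"
proof -
  note f = flag_basics[OF assms(1,2)]
  let ?I = "induced G (X \<union> f ` {..<q})"
  have sub: "X \<union> f ` {..<q} \<subseteq> verts G" using assms(3) f(3) by blast
  have inj: "f \<in> injections q (verts G)"
    using assms(1) f(6) by (simp add: is_flag_def)
  then have "f \<in> injections q (X \<union> f ` {..<q})"
    by (auto simp: injections_def PiE_def)
  moreover have "edge_compat f \<tau> ?I"
    using f(5) assms(2) by (auto simp: edge_compat_def edges_induced is_type_def)
  ultimately show "is_flag \<tau> (?I, f)"
    using is_graph_induced[OF f(1) sub] f(6) by (simp add: is_flag_def)
  have "roots \<tau> (?I, f) = f ` {..<q}" using assms(2) by (simp add: roots_def is_type_def)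
  then have U: "verts (fst (?I, f)) - roots \<tau> (?I, f) = X"
    using assms(3) by auto
  have e: "\<And>x y. x \<in> X \<Longrightarrow> y \<in> X \<Longrightarrow> {x, y} \<in> edges ?I \<longleftrightarrow> {x, y} \<in> edges G"
    "\<And>i y. i < q \<Longrightarrow> y \<in> X \<Longrightarrow> {f i, y} \<in> edges ?I \<longleftrightarrow> {f i, y} \<in> edges G"
    by (auto simp: edges_induced)
  have "unlabelled_code q (?I, f) X = unlabelled_code q (G, f) X"
  proof -
    have "{x \<in> X. {f 0, x} \<in> edges ?I} = {x \<in> X. {f 0, x} \<in> edges G}"
      using e(2)[of 0] q by (intro Collect_cong conj_cong) auto
    moreover have "(\<exists>x\<in>X. \<exists>y\<in>X. {x, y} \<in> edges ?I) = (\<exists>x\<in>X. \<exists>y\<in>X. {x, y} \<in> edges G)"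
      using e(1) by blast
    moreover have "(\<exists>x\<in>X. {f i, x} \<in> edges ?I) = (\<exists>x\<in>X. {f i, x} \<in> edges G)" if "i < q" for i
      using e(2)[OF that] by blast
    ultimately show ?thesis
      using q by (elim disjE) (simp_all add: unlabelled_code_def)
  qed
  then show "flag_code \<tau> (?I, f) = unlabelled_code q (G, f) X"
    unfolding flag_code_def U f(6) .
qed

text \<open>Each unlabelled set adds 1 to exactly one coordinate of the flag vector, the one that
  carries its code. A linear form with coefficients given by code thus becomes a sum over unlabelled
  sets, and the order of \<open>flag_reps\<close> disappears.\<close>

lemma flag_vec_sum:
  fixes G :: "nat sgraph" and L :: "nat \<Rightarrow> real"
  assumes G: "is_graph G" and f: "f \<in> injections q (verts G)" and q: "q = 1 \<or> q = 3"
  defines "\<tau> \<equiv> type_of q f G"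
  defines "rs \<equiv> flag_reps \<tau> (q + rest_size q)"
  defines "\<X> \<equiv> {X. X \<subseteq> verts G - f ` {..<q} \<and> card X = rest_size q}"
  shows "(\<Sum>i<length rs. L (flag_code \<tau> (rs ! i)) * flag_vec \<tau> (q + rest_size q) (G, f) $ i)
    = (\<Sum>X\<in>\<X>. L (unlabelled_code q (G, f) X))"
proof -
  have \<tau>: "is_type q \<tau>" unfolding \<tau>_def by (rule is_type_type_of[OF G])
  have F: "is_flag \<tau> (G, f)" unfolding \<tau>_def by (rule is_flag_type_of[OF G f])
  note fb = flag_basics[OF F \<tau>]
  note rep = flag_reps_codes[OF \<tau> q, folded rs_def]
  let ?c = "unlabelled_code q (G, f)" and ?p = "\<lambda>i. flag_code \<tau> (rs ! i)"
  have fin: "finite \<X>" unfolding \<X>_def using fb(7) by simp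
  have flagX: "is_flag \<tau> (induced G (X \<union> f ` {..<q}), f)" "order (induced G (X \<union> f ` {..<q})) = q + rest_size q"
    "flag_code \<tau> (induced G (X \<union> f ` {..<q}), f) = ?c X" if "X \<in> \<X>" for X
  proof -
    have X: "X \<subseteq> verts G - f ` {..<q}" "card X = rest_size q" using that by (auto simp: \<X>_def)
    then show "is_flag \<tau> (induced G (X \<union> f ` {..<q}), f)" "flag_code \<tau> (induced G (X \<union> f ` {..<q}), f) = ?c X"
      using is_flag_induced[OF F \<tau> _ q] by blast+
    have "finite X" using X(1) fb(7) by (meson finite_Diff finite_subset)
    then have "card (X \<union> f ` {..<q}) = card X + card (f ` {..<q})"
      using X(1) by (intro card_Un_disjoint) auto
    then show "order (induced G (X \<union> f ` {..<q})) = q + rest_size q"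
      using X(2) fb(2) by (simp add: card_image)
  qed
  have cnt: "flag_vec \<tau> (q + rest_size q) (G, f) $ i = (\<Sum>X\<in>\<X>. of_bool (?c X = ?p i))"
    if i: "i < length rs" for i
  proof -
    obtain H h where Hh: "rs ! i = (H, h)" by fastforce
    have H: "is_flag \<tau> (H, h)" "order H = q + rest_size q"
      using rep(2)[OF nth_mem[OF i]] Hh by auto
    have "flag_iso \<tau> (induced G (X \<union> f ` {..<q}), f) (H, h) \<longleftrightarrow> ?c X = ?p i" if "X \<in> \<X>" for X
      using flag_iso_code[OF flagX(1)[OF that] H(1) \<tau> q] flagX(3)[OF that]
        flag_code_iso[OF flagX(1)[OF that] H(1) \<tau> q flagX(2)[OF that] H(2)] Hh by auto
    then have "{X. X \<subseteq> verts G - f ` {..<q} \<and> card X = order H - q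
        \<and> flag_iso \<tau> (induced G (X \<union> f ` {..<q}), f) (H, h)} = {X \<in> \<X>. ?c X = ?p i}"
      unfolding H(2) \<X>_def by auto
    then have "flag_count \<tau> (rs ! i) (G, f) = card {X \<in> \<X>. ?c X = ?p i}"
      unfolding flag_count_def Hh prod.case fb(4,6) by simp
    then show ?thesis
      using i fin unfolding flag_vec_def rs_def[symmetric]
      by (simp add: vec_of_list_index sum.If_cases Int_def of_bool_def)
  qed
  have "(\<Sum>i<length rs. L (?p i) * flag_vec \<tau> (q + rest_size q) (G, f) $ i)
      = (\<Sum>i<length rs. \<Sum>X\<in>\<X>. L (?p i) * of_bool (?c X = ?p i))"
    by (simp add: cnt sum_distrib_left)
  also have "\<dots> = (\<Sum>X\<in>\<X>. \<Sum>i<length rs. L (?p i) * of_bool (?c X = ?p i))"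
    by (rule sum.swap)
  also have "\<dots> = (\<Sum>X\<in>\<X>. L (?c X))"
  proof (rule sum.cong[OF refl])
    fix X assume X: "X \<in> \<X>"
    have "?c X < code_bound q"
      using flag_code_less[OF flagX(1)[OF X] \<tau> q flagX(2)[OF X]] flagX(3)[OF X] by simp
    moreover have "(\<Sum>i<length rs. L (?p i) * of_bool (?c X = ?p i))
        = (\<Sum>a<code_bound q. L a * of_bool (?c X = a))"
      by (rule sum.reindex_bij_betw[OF rep(4)])
    ultimately show "(\<Sum>i<length rs. L (?p i) * of_bool (?c X = ?p i)) = L (?c X)"
      by (simp add: of_bool_def if_distrib sum.delta cong: if_cong)
  qed
  finally show ?thesis .
qed

section \<open>Weighted sums of squares of linear forms\<close>

text \<open>\<open>p\<close> takes a matrix index to the code of its flag: coefficient lists are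
  ordered by code, matrices by \<open>flag_reps\<close>.\<close>

definition sos_mat :: "nat \<Rightarrow> (nat \<Rightarrow> nat) \<Rightarrow> (int \<times> int list) list \<Rightarrow> real mat" where
  "sos_mat n p sq = mat n n (\<lambda>(i, j). real_of_int (gram sq (p i) (p j)) / 302330880)"

definition lin_form :: "nat \<Rightarrow> (nat \<Rightarrow> nat) \<Rightarrow> int list \<Rightarrow> real vec \<Rightarrow> real" where
  "lin_form n p l v = (\<Sum>i<n. real_of_int (l ! p i) * v $ i)"

lemma gram_Cons: "gram ((w, l) # sq) a b = w * l ! a * l ! b + gram sq a b"
  by (simp add: gram_def)

lemma gram_commute: "gram sq a b = gram sq b a"
  by (induction sq) (auto simp: gram_Cons)

lemma sos_mat_mult:
  assumes "v \<in> carrier_vec n" "i < n"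
  shows "(sos_mat n p sq *\<^sub>v v) $ i
    = (\<Sum>(w, l)\<leftarrow>sq. real_of_int (w * l ! p i) * lin_form n p l v) / 302330880"
proof -
  have "(\<Sum>j<n. real_of_int (gram sq (p i) (p j)) * v $ j)
      = (\<Sum>(w, l)\<leftarrow>sq. real_of_int (w * l ! p i) * lin_form n p l v)"
    by (induction sq)
      (auto simp: gram_Cons lin_form_def distrib_right sum.distrib sum_distrib_left mult.assoc)
  moreover have "(sos_mat n p sq *\<^sub>v v) $ i
      = (\<Sum>j<n. real_of_int (gram sq (p i) (p j)) / 302330880 * v $ j)"
    using assms by (simp add: sos_mat_def scalar_prod_def lessThan_atLeast0)
  ultimately show ?thesis
    by (simp only: sum_divide_distrib[symmetric] times_divide_eq_left)
qed

lemma sos_mat_quadratic: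
  assumes "v \<in> carrier_vec n"
  shows "v \<bullet> (sos_mat n p sq *\<^sub>v v)
    = (\<Sum>(w, l)\<leftarrow>sq. real_of_int w * (lin_form n p l v)\<^sup>2) / 302330880"
proof -
  have "v \<bullet> (sos_mat n p sq *\<^sub>v v) = (\<Sum>i<n. v $ i * (sos_mat n p sq *\<^sub>v v) $ i)"
    by (simp add: scalar_prod_def lessThan_atLeast0 sos_mat_def)
  also have "\<dots> = (\<Sum>i<n. v $ i * (\<Sum>(w, l)\<leftarrow>sq. real_of_int (w * l ! p i) * lin_form n p l v)) / 302330880"
    using assms by (simp add: sos_mat_mult sum_divide_distrib)
  also have "(\<Sum>i<n. v $ i * (\<Sum>(w, l)\<leftarrow>sq. real_of_int (w * l ! p i) * lin_form n p l v))
      = (\<Sum>(w, l)\<leftarrow>sq. real_of_int w * (lin_form n p l v)\<^sup>2)"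
  proof (induction sq)
    case (Cons x sq)
    obtain w l where x: "x = (w, l)" by fastforce
    have "(\<Sum>i<n. v $ i * (real_of_int (w * l ! p i) * lin_form n p l v))
        = real_of_int w * lin_form n p l v * (\<Sum>i<n. real_of_int (l ! p i) * v $ i)"
      by (simp add: sum_distrib_left mult_ac)
    also have "\<dots> = real_of_int w * (lin_form n p l v)\<^sup>2"
      by (simp add: lin_form_def[symmetric] power2_eq_square)
    finally show ?case using Cons x by (simp add: distrib_left sum.distrib)
  qed simp
  finally show ?thesis .
qed

lemma sum_list_nonneg_eq_0:
  fixes g :: "'x \<Rightarrow> real"
  assumes "\<And>x. x \<in> set xs \<Longrightarrow> 0 \<le> g x" "sum_list (map g xs) = 0" "x \<in> set xs"
  shows "g x = 0"
  using assms sum_list_nonneg_eq_0_iff[of "map g xs"] by auto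

lemma psd_sos_mat:
  assumes "\<forall>(w, l)\<in>set sq. 0 \<le> w"
  shows "psd n (sos_mat n p sq)"
proof -
  have "transpose_mat (sos_mat n p sq) = sos_mat n p sq"
    by (rule eq_matI) (auto simp: sos_mat_def gram_commute)
  moreover have "0 \<le> v \<bullet> (sos_mat n p sq *\<^sub>v v)" if "v \<in> carrier_vec n" for v
    unfolding sos_mat_quadratic[OF that] using assms
    by (intro divide_nonneg_nonneg sum_list_nonneg) auto
  ultimately show ?thesis by (simp add: psd_def sos_mat_def)
qed

text \<open>The quadratic form vanishes on the kernel, and with positive weights a sum of squares
  vanishes only if every square does.\<close>

lemma mat_kernel_sos_mat:
  assumes "\<forall>(w, l)\<in>set sq. 0 < w"
  shows "v \<in> mat_kernel (sos_mat n p sq)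
    \<longleftrightarrow> v \<in> carrier_vec n \<and> (\<forall>(w, l)\<in>set sq. lin_form n p l v = 0)"
proof
  have A: "sos_mat n p sq \<in> carrier_mat n n" by (simp add: sos_mat_def)
  {
    assume "v \<in> mat_kernel (sos_mat n p sq)"
    then have v: "v \<in> carrier_vec n" "sos_mat n p sq *\<^sub>v v = 0\<^sub>v n"
      using mat_kernelD[OF A] by auto
    have "(\<Sum>(w, l)\<leftarrow>sq. real_of_int w * (lin_form n p l v)\<^sup>2) = 0"
      using sos_mat_quadratic[OF v(1), of p sq] v by simp
    then have "(\<lambda>(w, l). real_of_int w * (lin_form n p l v)\<^sup>2) x = 0" if "x \<in> set sq" for x
      by (rule sum_list_nonneg_eq_0[rotated]) (use assms that in \<open>auto simp: less_imp_le\<close>)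
    then show "v \<in> carrier_vec n \<and> (\<forall>(w, l)\<in>set sq. lin_form n p l v = 0)"
      using assms v(1) by fastforce
  }
  {
    assume v: "v \<in> carrier_vec n \<and> (\<forall>(w, l)\<in>set sq. lin_form n p l v = 0)"
    then have "map (\<lambda>(w, l). real_of_int (w * l ! p i) * lin_form n p l v) sq = map (\<lambda>_. 0) sq" for i
      by (intro map_cong) auto
    then have "sos_mat n p sq *\<^sub>v v = 0\<^sub>v n"
      using v sos_mat_mult[of v n _ p sq] by (intro eq_vecI) (simp_all add: sos_mat_def del: map_eq_conv)
    then show "v \<in> mat_kernel (sos_mat n p sq)"
      using v by (intro mat_kernelI[OF A]) auto
  }
qed

text \<open>Passing to coordinates numbered by code turns kernel conditions into concrete linear
  systems.\<close>

lemma lin_form_reindex: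
  assumes "bij_betw p {..<n} {..<m}"
  shows "lin_form n p l v = (\<Sum>a<m. real_of_int (l ! a) * v $ inv_into {..<n} p a)"
proof -
  have "lin_form n p l v = (\<Sum>i<n. real_of_int (l ! p i) * v $ inv_into {..<n} p (p i))"
    unfolding lin_form_def using assms
    by (intro sum.cong refl) (simp add: bij_betw_inv_into_left)
  also have "\<dots> = (\<Sum>a<m. real_of_int (l ! a) * v $ inv_into {..<n} p a)"
    by (rule sum.reindex_bij_betw[OF assms])
  finally show ?thesis .
qed

lemma kernel_dim_eq_1:
  fixes A :: "'a :: field mat"
  assumes A: "A \<in> carrier_mat m n" and u: "u \<in> mat_kernel A" "u \<noteq> 0\<^sub>v n"
    and span: "\<And>v. v \<in> mat_kernel A \<Longrightarrow> \<exists>t. v = t \<cdot>\<^sub>v u"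
  shows "kernel_dim A = 1"
proof -
  interpret kernel m n A by unfold_locales (rule A)
  have "span {u} = mat_kernel A"
  proof
    show "span {u} \<subseteq> mat_kernel A" using u by (intro Ker.span_is_subset2) auto
    show "mat_kernel A \<subseteq> span {u}"
    proof
      fix v assume "v \<in> mat_kernel A"
      then obtain t where v: "v = t \<cdot>\<^sub>v u" using span by blast
      have c: "{u} \<subseteq> carrier_vec n" using mat_kernelD(1)[OF A u(1)] by simp
      have "u \<in> NC.span {u}" using c by (intro NC.span_mem) auto
      then have "t \<cdot>\<^sub>v u \<in> NC.span {u}" using c by (intro NC.smult_in_span) auto
      then show "v \<in> span {u}" unfolding v using u(1) by (subst span_same) auto
    qed
  qed
  moreover have "lin_indpt {u}"
  proof (rule Ker.finite_lin_indpt2)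
    fix a assume a: "lincomb a {u} = 0\<^sub>v n"
    have "u \<in> carrier_vec n" by (rule mat_kernelD(1)[OF A u(1)])
    then obtain i where i: "i < n" "u $ i \<noteq> 0" using u(2) by (auto simp: vec_eq_iff)
    have "a u * u $ i = lincomb a {u} $ i" using lincomb_index[OF i(1), of "{u}" a] u(1) by simp
    also have "\<dots> = 0" unfolding a using i(1) by simp
    finally have "a u * u $ i = 0" .
    then show "\<forall>v\<in>{u}. a v = 0" using i(2) by simp
  qed (use u in auto)
  ultimately have "basis {u}" unfolding Ker.basis_def using u by auto
  from Ker.dim_basis[OF _ this] show ?thesis by simp
qed

text \<open>Transfers a computation in code coordinates to the matrix: \<open>k\<close> is a
  non-zero integer solution of the system, and the last assumption says that it spans all real
  ones.\<close>

lemma kernel_dim_sos_mat: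
  assumes p: "bij_betw p {..<n} {..<m}" and pos: "\<forall>(w, l)\<in>set sq. 0 < w"
    and k: "\<forall>(w, l)\<in>set sq. (\<Sum>a<m. l ! a * k ! a) = 0" "a0 < m" "k ! a0 \<noteq> 0"
    and ker: "\<And>y :: nat \<Rightarrow> real. \<forall>(w, l)\<in>set sq. (\<Sum>a<m. real_of_int (l ! a) * y a) = 0 \<Longrightarrow>
      \<exists>t. \<forall>a<m. y a = t * real_of_int (k ! a)"
  shows "kernel_dim (sos_mat n p sq) = 1"
proof -
  let ?u = "vec n (\<lambda>i. real_of_int (k ! p i))"
  have pi: "p i < m" if "i < n" for i using bij_betw_apply[OF p, of i] that by simp
  have inv: "inv_into {..<n} p a < n" "p (inv_into {..<n} p a) = a" if "a < m" for a
    using that bij_betw_inv_into_right[OF p, of a] bij_betw_apply[OF bij_betw_inv_into[OF p], of a] by auto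
  show ?thesis
  proof (rule kernel_dim_eq_1)
    show "sos_mat n p sq \<in> carrier_mat n n" by (simp add: sos_mat_def)
    have "lin_form n p l ?u = real_of_int (\<Sum>a<m. l ! a * k ! a)" for l
      unfolding lin_form_reindex[OF p] of_int_sum
      by (intro sum.cong refl) (simp add: inv)
    then have "\<forall>(w, l)\<in>set sq. lin_form n p l ?u = 0"
      using k(1) by (simp add: split_beta del: of_int_sum of_int_mult)
    then show "?u \<in> mat_kernel (sos_mat n p sq)"
      unfolding mat_kernel_sos_mat[OF pos] by simp
    show "?u \<noteq> 0\<^sub>v n"
    proof
      assume "?u = 0\<^sub>v n"
      then have "?u $ inv_into {..<n} p a0 = 0\<^sub>v n $ inv_into {..<n} p a0" by simp
      then show False using inv[OF k(2)] k(3) by simp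
    qed
    fix v assume "v \<in> mat_kernel (sos_mat n p sq)"
    then have v: "v \<in> carrier_vec n"
      "\<forall>(w, l)\<in>set sq. (\<Sum>a<m. real_of_int (l ! a) * v $ inv_into {..<n} p a) = 0"
      unfolding mat_kernel_sos_mat[OF pos] lin_form_reindex[OF p] by auto
    from ker[OF v(2)] obtain t where t: "\<forall>a<m. v $ inv_into {..<n} p a = t * real_of_int (k ! a)"
      by blast
    have "v $ i = t * real_of_int (k ! p i)" if "i < n" for i
      using t pi[OF that] bij_betw_inv_into_left[OF p, of i] that by auto
    then have "v = t \<cdot>\<^sub>v ?u" using v(1) by (intro eq_vecI) auto
    then show "\<exists>t. v = t \<cdot>\<^sub>v ?u" by blast
  qed
qed

section \<open>The matrices of the certificate and their kernels\<close>

definition type_squares :: "nat sgraph \<Rightarrow> (int \<times> int list) list" where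
  "type_squares \<tau> =
    (if \<tau> = type_one then squares_one
     else if \<tau> = type_sigma then squares_sigma
     else if \<tau> = type_mu then squares_mu
     else if \<tau> = type_nu then squares_nu
     else [])"

definition cert_mat :: "nat sgraph \<Rightarrow> real mat" where
  "cert_mat \<tau> = (let rs = flag_reps \<tau> (flag_size 5 (order \<tau>))
    in sos_mat (length rs) (\<lambda>i. flag_code \<tau> (rs ! i)) (type_squares \<tau>))"

lemma squares_pos:
  "\<forall>(w, l)\<in>set squares_one. 0 < w" "\<forall>(w, l)\<in>set squares_sigma. 0 < w"
  "\<forall>(w, l)\<in>set squares_mu. 0 < w" "\<forall>(w, l)\<in>set squares_nu. 0 < w"
  by (simp_all add: squares_one_def squares_sigma_def squares_mu_def squares_nu_def)

lemma type_squares_pos: "\<forall>(w, l)\<in>set (type_squares \<tau>). 0 < w"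
  using squares_pos by (simp add: type_squares_def)

lemma edges_types:
  "card (edges type_sigma) = 0" "card (edges type_mu) = 1" "card (edges type_nu) = 2"
  by (simp_all add: type_sigma_def type_mu_def type_nu_def doubleton_eq_iff)

lemma types_distinct [simp]:
  "type_one \<noteq> type_sigma" "type_one \<noteq> type_mu" "type_one \<noteq> type_nu" "type_sigma \<noteq> type_mu"
  "type_sigma \<noteq> type_nu" "type_mu \<noteq> type_nu"
proof -
  show "type_sigma \<noteq> type_mu" "type_sigma \<noteq> type_nu" "type_mu \<noteq> type_nu"
    using edges_types by auto
  have "order type_one = 1" "order type_sigma = 3" "order type_mu = 3" "order type_nu = 3"
    by (simp_all add: type_one_def type_sigma_def type_mu_def type_nu_def)
  then show "type_one \<noteq> type_sigma" "type_one \<noteq> type_mu" "type_one \<noteq> type_nu" by auto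
qed

lemma type_squares_simps [simp]:
  "type_squares type_one = squares_one" "type_squares type_sigma = squares_sigma"
  "type_squares type_mu = squares_mu" "type_squares type_nu = squares_nu"
  using types_distinct by (auto simp: type_squares_def simp del: types_distinct)

lemma is_type_named:
  "is_type 1 type_one" "is_type 3 type_sigma" "is_type 3 type_mu" "is_type 3 type_nu"
  by (auto simp: is_type_def is_graph_def type_one_def type_sigma_def type_mu_def type_nu_def)

lemma flag_size_5: "q = 1 \<or> q = 3 \<Longrightarrow> flag_size 5 q = q + rest_size q"
  by (auto simp: flag_size_def rest_size_def)

lemma cert_mat_eq:
  assumes "is_type q \<tau>" "q = 1 \<or> q = 3"
  shows "cert_mat \<tau> = sos_mat (length (flag_reps \<tau> (q + rest_size q)))
    (\<lambda>i. flag_code \<tau> (flag_reps \<tau> (q + rest_size q) ! i)) (type_squares \<tau>)"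
  using assms flag_size_5[OF assms(2)] by (simp add: cert_mat_def is_type_def Let_def)

lemma kernel_dim_one: "kernel_dim (cert_mat type_one) = 1"
  unfolding cert_mat_eq[OF is_type_named(1) disjI1[OF refl]] type_squares_simps
proof (rule kernel_dim_sos_mat[OF _ squares_pos(1)])
  show "bij_betw (\<lambda>i. flag_code type_one (flag_reps type_one (1 + rest_size 1) ! i))
      {..<length (flag_reps type_one (1 + rest_size 1))} {..<6}"
    using flag_reps_codes(4)[OF is_type_named(1) disjI1[OF refl]] by (simp add: code_bound_def)
  \<comment> \<open>The vector holds the flag densities seen from a root of the extremal
    configuration, times 144. Two vertices on the root's own side contribute 36 to code 0; two on
    the opposite side contribute 1, 10, 25 to codes 0, 1, 2; one on each side contributes 2, 10, 10,
    50 to codes 0, 1, 3, 4.\<close>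
  show "\<forall>(w, l)\<in>set squares_one. (\<Sum>a<6. l ! a * [39, 20, 25, 10, 50, 0] ! a) = 0"
    by (simp add: squares_one_def numeral_eq_Suc)
  show "(0 :: nat) < 6" "[39, 20, 25, 10, 50, 0] ! 0 \<noteq> (0 :: int)" by simp_all
  fix y :: "nat \<Rightarrow> real"
  assume "\<forall>(w, l)\<in>set squares_one. (\<Sum>a<6. real_of_int (l ! a) * y a) = 0"
  then have "y a = y 0 / 39 * real_of_int ([39, 20, 25, 10, 50, 0] ! a)" if "a < 6" for a
    using that by (auto simp: squares_one_def numeral_eq_Suc less_Suc_eq)
  then show "\<exists>t. \<forall>a<6. y a = t * real_of_int ([39, 20, 25, 10, 50, 0] ! a)" by blast
qed

lemma kernel_dim_nu: "kernel_dim (cert_mat type_nu) = 1"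
  unfolding cert_mat_eq[OF is_type_named(4) disjI2[OF refl]] type_squares_simps
proof (rule kernel_dim_sos_mat[OF _ squares_pos(4)])
  show "bij_betw (\<lambda>i. flag_code type_nu (flag_reps type_nu (3 + rest_size 3) ! i))
      {..<length (flag_reps type_nu (3 + rest_size 3))} {..<8}"
    using flag_reps_codes(4)[OF is_type_named(4) disjI2[OF refl]] by (simp add: code_bound_def)
  \<comment> \<open>Again flag densities, times 72. A vertex on the side of the leaves contributes 6
    and 30 to codes 0 and 1. A vertex on the side of the centre, with independent edges to the two
    leaves, contributes 1, 5, 5, 25 to codes 0, 2, 4, 6.\<close>
  show "\<forall>(w, l)\<in>set squares_nu. (\<Sum>a<8. l ! a * [7, 30, 5, 0, 5, 0, 25, 0] ! a) = 0"
    by (simp add: squares_nu_def numeral_eq_Suc)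
  show "(0 :: nat) < 8" "[7, 30, 5, 0, 5, 0, 25, 0] ! 0 \<noteq> (0 :: int)" by simp_all
  fix y :: "nat \<Rightarrow> real"
  assume "\<forall>(w, l)\<in>set squares_nu. (\<Sum>a<8. real_of_int (l ! a) * y a) = 0"
  then have "y a = y 0 / 7 * real_of_int ([7, 30, 5, 0, 5, 0, 25, 0] ! a)" if "a < 8" for a
    using that by (auto simp: squares_nu_def numeral_eq_Suc less_Suc_eq)
  then show "\<exists>t. \<forall>a<8. y a = t * real_of_int ([7, 30, 5, 0, 5, 0, 25, 0] ! a)" by blast
qed

text \<open>The codes 3, 5, 6, 7 are those below 8 with at least two binary digits equal to
  1.\<close>

lemma edges_to_roots_ge_2:
  assumes F: "is_flag \<tau> (H, h)" "is_type 3 \<tau>" and size: "order H = 4"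
    and code: "flag_code \<tau> (H, h) \<in> {3, 5, 6, 7}"
  shows "2 \<le> edges_to_roots \<tau> (H, h)"
proof -
  note f = flag_basics[OF F]
  let ?U = "verts H - h ` {..<3}"
  have "card ?U = 1"
    using f(2,3,7) size by (simp add: card_Diff_subset card_image)
  then obtain x where U: "?U = {x}" by (auto simp: card_1_singleton_iff)
  have "flag_code \<tau> (H, h) = of_bool ({h 0, x} \<in> edges H) + 2 * of_bool ({h 1, x} \<in> edges H)
      + 4 * of_bool ({h 2, x} \<in> edges H)"
    unfolding flag_code_def unlabelled_code_def fst_conv f(4) U f(6) prod.case by simp
  then obtain i j :: nat where ij: "i < 3" "j < 3" "i \<noteq> j" "{h i, x} \<in> edges H" "{h j, x} \<in> edges H"
    using code that[of 0 1] that[of 0 2] that[of 1 2]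
    by (auto simp: of_bool_def split: if_splits)
  have ne: "h i \<noteq> h j" using ij f(2) by (auto simp: inj_on_def)
  have x: "x \<in> verts H" "x \<notin> h ` {..<3}" using U by auto
  then have "{x, h i} \<noteq> {x, h j}" using ne by (auto simp: doubleton_eq_iff)
  then have "2 = card {{x, h i}, {x, h j}}" by simp
  also have "\<dots> \<le> card {{x, r} | x r. x \<in> verts H - roots \<tau> (H, h) \<and> r \<in> roots \<tau> (H, h) \<and> {x, r} \<in> edges H}"
  proof (rule card_mono)
    have "{{x, r} | x r. x \<in> verts H - roots \<tau> (H, h) \<and> r \<in> roots \<tau> (H, h) \<and> {x, r} \<in> edges H}
        \<subseteq> Pow (verts H)"
      using f(3,4) by auto
    then show "finite {{x, r} | x r. x \<in> verts H - roots \<tau> (H, h) \<and> r \<in> roots \<tau> (H, h) \<and> {x, r} \<in> edges H}"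
      using f(7) finite_subset by blast
    have "{x, h i} \<in> edges H" "{x, h j} \<in> edges H" using ij by (simp_all add: insert_commute)
    then show "{{x, h i}, {x, h j}} \<subseteq> {{x, r} | x r. x \<in> verts H - roots \<tau> (H, h)
        \<and> r \<in> roots \<tau> (H, h) \<and> {x, r} \<in> edges H}"
      unfolding f(4) using x ij(1,2) by blast
  qed
  finally show ?thesis by (simp add: edges_to_roots_def)
qed

text \<open>The support condition kills the coordinates with codes 3, 5, 6, 7. What remains is a
  linear system in the four unknowns with codes 0, 1, 2, 4.\<close>

lemma kernel_few_edges:
  assumes \<tau>: "is_type 3 \<tau>" and v: "v \<in> mat_kernel (cert_mat \<tau>)"
    and sup: "supported_on (flag_reps \<tau> 4) (\<lambda>\<Phi>. edges_to_roots \<tau> \<Phi> \<le> 1) v"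
    and alg: "\<And>(y :: nat \<Rightarrow> real) a. \<forall>(w, l)\<in>set (type_squares \<tau>). (\<Sum>a<8. real_of_int (l ! a) * y a) = 0
      \<Longrightarrow> y 3 = 0 \<Longrightarrow> y 5 = 0 \<Longrightarrow> y 6 = 0 \<Longrightarrow> y 7 = 0 \<Longrightarrow> a < 8 \<Longrightarrow> y a = 0"
  shows "v = 0\<^sub>v (dim_vec v)"
proof -
  let ?rs = "flag_reps \<tau> 4" and ?p = "\<lambda>i. flag_code \<tau> (flag_reps \<tau> 4 ! i)"
  let ?n = "length ?rs"
  note rep = flag_reps_codes[OF \<tau> disjI2[OF refl], unfolded rest_size_def code_bound_def, simplified]
  have b: "bij_betw ?p {..<?n} {..<8}" by (rule rep(4))
  have V: "v \<in> carrier_vec ?n" "\<forall>(w, l)\<in>set (type_squares \<tau>). lin_form ?n ?p l v = 0"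
    using v unfolding cert_mat_eq[OF \<tau> disjI2[OF refl]] mat_kernel_sos_mat[OF type_squares_pos]
    by (simp_all add: rest_size_def)
  define y where "y a = v $ inv_into {..<?n} ?p a" for a
  have eqs: "\<forall>(w, l)\<in>set (type_squares \<tau>). (\<Sum>a<8. real_of_int (l ! a) * y a) = 0"
    using V(2) unfolding lin_form_reindex[OF b] y_def .
  have inv: "inv_into {..<?n} ?p a < ?n" "?p (inv_into {..<?n} ?p a) = a" if "a < 8" for a
    using that bij_betw_inv_into_right[OF b, of a] bij_betw_apply[OF bij_betw_inv_into[OF b], of a] by auto
  have zero: "y a = 0" if "a \<in> {3, 5, 6, 7}" for a
  proof (rule ccontr)
    assume "y a \<noteq> 0"
    have a: "a < 8" using that by auto
    let ?i = "inv_into {..<?n} ?p a"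
    obtain H h where Hh: "?rs ! ?i = (H, h)" by fastforce
    have "edges_to_roots \<tau> (H, h) \<le> 1"
      using sup inv(1)[OF a] \<open>y a \<noteq> 0\<close> unfolding supported_on_def y_def Hh[symmetric] by blast
    moreover have "is_flag \<tau> (H, h)" "order H = 4"
      using rep(2)[OF nth_mem[OF inv(1)[OF a]]] Hh by auto
    moreover have "flag_code \<tau> (H, h) \<in> {3, 5, 6, 7}"
      using inv(2)[OF a] Hh that by simp
    ultimately show False using edges_to_roots_ge_2[OF _ \<tau>, of H h] by simp
  qed
  have "v $ i = 0" if i: "i < ?n" for i
  proof -
    have p8: "?p i < 8" using bij_betw_apply[OF b, of i] i by simp
    have "y (?p i) = 0" by (rule alg[OF eqs _ _ _ _ p8]) (rule zero, simp)+
    moreover have "v $ i = y (?p i)" using bij_betw_inv_into_left[OF b, of i] i by (simp add: y_def)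
    ultimately show ?thesis by (simp only:)
  qed
  then show ?thesis using V(1) by (intro eq_vecI) auto
qed

text \<open>The extremal configuration forces four kernel vectors: all roots on one side, or one of
  the three roots apart. Only the first is non-zero at code 7, and each of the others is the only
  one of the three that is non-zero at its own code among 3, 5, 6. Hence no non-zero combination of
  them has the stated support, and the four forms leave room for no further vectors.\<close>

lemma kernel_sigma:
  assumes "v \<in> mat_kernel (cert_mat type_sigma)"
    and "supported_on (flag_reps type_sigma 4) (\<lambda>\<Phi>. edges_to_roots type_sigma \<Phi> \<le> 1) v"
  shows "v = 0\<^sub>v (dim_vec v)"
proof (rule kernel_few_edges[OF is_type_named(2) assms])
  fix y :: "nat \<Rightarrow> real" and a :: nat
  assume "\<forall>(w, l)\<in>set (type_squares type_sigma). (\<Sum>a<8. real_of_int (l ! a) * y a) = 0"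
    "y 3 = 0" "y 5 = 0" "y 6 = 0" "y 7 = 0" "a < 8"
  then show "y a = 0"
    by (auto simp: squares_sigma_def numeral_eq_Suc less_Suc_eq)
qed

text \<open>The adjacent roots lie on opposite sides and the third root joins either of them, which
  forces two kernel vectors. Code 6 occurs in one of them only, code 5 in the other only.\<close>

lemma kernel_mu:
  assumes "v \<in> mat_kernel (cert_mat type_mu)"
    and "supported_on (flag_reps type_mu 4) (\<lambda>\<Phi>. edges_to_roots type_mu \<Phi> \<le> 1) v"
  shows "v = 0\<^sub>v (dim_vec v)"
proof (rule kernel_few_edges[OF is_type_named(3) assms])
  fix y :: "nat \<Rightarrow> real" and a :: nat
  assume "\<forall>(w, l)\<in>set (type_squares type_mu). (\<Sum>a<8. real_of_int (l ! a) * y a) = 0"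
    "y 3 = 0" "y 5 = 0" "y 6 = 0" "y 7 = 0" "a < 8"
  then show "y a = 0"
    by (auto simp: squares_mu_def numeral_eq_Suc less_Suc_eq)
qed

section \<open>Counting ordered quintuples\<close>

definition adjacent :: "'a sgraph \<Rightarrow> 'a \<Rightarrow> 'a \<Rightarrow> bool" where
  "adjacent G x y \<longleftrightarrow> {x, y} \<in> edges G"

definition quints :: "'a set \<Rightarrow> 'a list set" where
  "quints V = {xs. set xs \<subseteq> V \<and> length xs = 5}"

definition distinct_quints :: "'a set \<Rightarrow> 'a list set" where
  "distinct_quints V = {xs. set xs \<subseteq> V \<and> length xs = 5 \<and> distinct xs}"

definition gram_total :: "'a sgraph \<Rightarrow> int" where
  "gram_total G = (\<Sum>xs\<in>distinct_quints (verts G). gram_term (adjacent G) xs)"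

lemma length_5E:
  assumes "length xs = 5"
  obtains a b c x y where "xs = [a, b, c, x, y]"
  using assms by (auto simp: numeral_eq_Suc length_Suc_conv)

lemma gram_term_eq_0: "length xs \<noteq> 5 \<Longrightarrow> gram_term e xs = 0"
  by (auto simp: gram_term_def split: list.split)

text \<open>The weight of a tuple sees only adjacencies among its entries. Isomorphism invariance,
  restriction to induced subgraphs and renumbering of vertices all rest on this.\<close>

lemma gram_term_map:
  assumes "\<And>x y. x \<in> set xs \<Longrightarrow> y \<in> set xs \<Longrightarrow> e' (\<phi> x) (\<phi> y) = e x y"
  shows "gram_term e' (map \<phi> xs) = gram_term e xs"
proof (cases "length xs = 5")
  case True
  then obtain a b c x y where "xs = [a, b, c, x, y]" by (rule length_5E)
  then show ?thesis using assms by (simp add: gram_term_def pair_code_def star_code_def)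
next
  case False
  then have "length (map \<phi> xs) \<noteq> 5" by simp
  from gram_term_eq_0[OF this] gram_term_eq_0[OF False] show ?thesis by simp
qed

lemma finite_quints: "finite V \<Longrightarrow> finite (quints V)"
  unfolding quints_def by (rule finite_lists_length_eq)

lemma distinct_quints_subset: "distinct_quints V \<subseteq> quints V"
  by (auto simp: distinct_quints_def quints_def)

lemma finite_distinct_quints: "finite V \<Longrightarrow> finite (distinct_quints V)"
  using finite_quints distinct_quints_subset by (rule finite_subset[rotated])

lemma distinct_quints_image:
  assumes "bij_betw \<phi> V W"
  shows "bij_betw (map \<phi>) (distinct_quints V) (distinct_quints W)"
  unfolding bij_betw_def
proof
  have inj: "inj_on \<phi> V" and W: "W = \<phi> ` V" using assms by (auto simp: bij_betw_def)
  show "inj_on (map \<phi>) (distinct_quints V)"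
    by (rule inj_on_mapI, rule inj_on_subset[OF inj]) (auto simp: distinct_quints_def)
  show "map \<phi> ` distinct_quints V = distinct_quints W"
  proof
    show "map \<phi> ` distinct_quints V \<subseteq> distinct_quints W"
    proof
      fix ys assume "ys \<in> map \<phi> ` distinct_quints V"
      then obtain xs where xs: "ys = map \<phi> xs" "set xs \<subseteq> V" "length xs = 5" "distinct xs"
        by (auto simp: distinct_quints_def)
      have "distinct ys" unfolding xs(1) distinct_map using xs(4) inj_on_subset[OF inj xs(2)] by simp
      then show "ys \<in> distinct_quints W"
        using image_mono[OF xs(2), of \<phi>] xs(1,3) by (simp add: distinct_quints_def W)
    qed
    show "distinct_quints W \<subseteq> map \<phi> ` distinct_quints V"
    proof
      fix ys assume ys: "ys \<in> distinct_quints W"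
      let ?xs = "map (inv_into V \<phi>) ys"
      have "map \<phi> ?xs = ys"
        using ys by (auto simp: distinct_quints_def W f_inv_into_f intro!: map_idI)
      moreover have "set ?xs \<subseteq> V"
        using ys by (auto simp: distinct_quints_def W inv_into_into)
      moreover have "distinct ?xs"
        using ys by (auto simp: distinct_quints_def W distinct_map intro: inj_on_subset[OF inj_on_inv_into])
      ultimately show "ys \<in> map \<phi> ` distinct_quints V"
        using ys by (intro image_eqI[of _ _ ?xs]) (auto simp: distinct_quints_def)
    qed
  qed
qed

lemma gram_total_iso:
  assumes "graph_iso G H"
  shows "gram_total G = gram_total H"
proof -
  obtain \<phi> where \<phi>: "bij_betw \<phi> (verts G) (verts H)" "edge_compat \<phi> G H"
    using assms unfolding graph_iso_def by blast
  have "gram_total H = (\<Sum>xs\<in>distinct_quints (verts G). gram_term (adjacent H) (map \<phi> xs))"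
    unfolding gram_total_def by (rule sum.reindex_bij_betw[OF distinct_quints_image[OF \<phi>(1)], symmetric])
  also have "\<dots> = gram_total G"
    unfolding gram_total_def
  proof (rule sum.cong[OF refl])
    fix xs assume "xs \<in> distinct_quints (verts G)"
    then have "set xs \<subseteq> verts G" by (simp add: distinct_quints_def)
    then show "gram_term (adjacent H) (map \<phi> xs) = gram_term (adjacent G) xs"
      using \<phi>(2) by (intro gram_term_map) (simp add: adjacent_def edge_compat_def subset_iff)
  qed
  finally show ?thesis ..
qed

text \<open>Tuples with five distinct entries are grouped by their set of entries; on such a set,
  adjacency in \<open>G\<close> and in the induced graph agree.\<close>

lemma gram_total_split:
  assumes "is_graph G"
  shows "gram_total G = (\<Sum>X | X \<subseteq> verts G \<and> card X = 5. gram_total (induced G X))"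
proof -
  have fin: "finite (verts G)" using assms by (simp add: is_graph_def)
  have "gram_total (induced G X) = (\<Sum>xs | xs \<in> distinct_quints (verts G) \<and> set xs = X. gram_term (adjacent G) xs)"
    if X: "X \<subseteq> verts G" "card X = 5" for X
    unfolding gram_total_def
  proof (rule sum.cong)
    have "finite X" using X(1) fin finite_subset by blast
    then have "set xs = X" if "set xs \<subseteq> X" "length xs = 5" "distinct xs" for xs
      using that X(2) by (metis card_subset_eq distinct_card)
    then show "distinct_quints (verts (induced G X)) = {xs \<in> distinct_quints (verts G). set xs = X}"
      using X(1) unfolding distinct_quints_def verts_induced by blast
    fix xs assume "xs \<in> {xs \<in> distinct_quints (verts G). set xs = X}"
    then have "set xs = X" by simp
    then show "gram_term (adjacent (induced G X)) xs = gram_term (adjacent G) xs"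
      using gram_term_map[of xs "adjacent (induced G X)" id "adjacent G"]
      by (simp add: adjacent_def edges_induced)
  qed
  then have "(\<Sum>X | X \<subseteq> verts G \<and> card X = 5. gram_total (induced G X))
      = (\<Sum>X | X \<subseteq> verts G \<and> card X = 5. \<Sum>xs | xs \<in> distinct_quints (verts G) \<and> set xs = X. gram_term (adjacent G) xs)"
    by (intro sum.cong) auto
  also have "\<dots> = gram_total G"
    unfolding gram_total_def
    by (rule sum.group) (use fin finite_distinct_quints in \<open>auto simp: distinct_quints_def distinct_card\<close>)
  finally show ?thesis ..
qed

text \<open>A numbering \<open>xs\<close> of the vertices turns the total weight into an executable
  sum over the permutations of five indices.\<close>

lemma gram_total_eq_table_sum:
  assumes G: "is_graph G" and xs: "distinct xs" "set xs = verts G" "length xs = 5"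
  defines "e \<equiv> \<lambda>i j. adjacent G (xs ! i) (xs ! j)"
  shows "gram_total G = table_sum table_one table_sigma table_mu table_nu
    (permutations_of_set_list [0, 1, 2, 3, 4])
    (adj_rows [e 0 1, e 0 2, e 0 3, e 0 4, e 1 2, e 1 3, e 1 4, e 2 3, e 2 4, e 3 4])"
    (is "_ = table_sum _ _ _ _ ?ps ?A")
proof -
  have nth: "?A ! i ! j = e i j" if "i < 5" "j < 5" for i j
  proof -
    have "\<not> e i i" "e i j = e j i" for i j
      using is_graph_no_loop[OF G] by (auto simp: e_def adjacent_def insert_commute)
    then show ?thesis
      using that by (auto simp: adj_rows_def less_Suc_eq numeral_eq_Suc)
  qed
  have ps: "set ?ps = distinct_quints {..<5}"
  proof -
    have "set ?ps = permutations_of_set (set [0, 1, 2, 3, 4 :: nat])"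
      by (subst permutations_of_list) simp
    also have "set [0, 1, 2, 3, 4 :: nat] = {..<5}" by auto
    also have "permutations_of_set {..<5 :: nat} = distinct_quints {..<5}"
    proof -
      have "set ys = {..<5}" if "set ys \<subseteq> {..<5 :: nat}" "length ys = 5" "distinct ys" for ys
        using that by (intro card_subset_eq) (simp_all add: distinct_card)
      moreover have "length ys = 5" if "set ys = {..<5 :: nat}" "distinct ys" for ys
        using that distinct_card[of ys] by simp
      ultimately show ?thesis
        unfolding permutations_of_set_def distinct_quints_def by blast
    qed
    finally show ?thesis .
  qed
  have "bij_betw ((!) xs) {..<5} (verts G)"
    using bij_betw_nth[OF xs(1), of "{..<5}" "verts G"] xs by simp
  from sum.reindex_bij_betw[OF distinct_quints_image[OF this], of "gram_term (adjacent G)"]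
  have "gram_total G = (\<Sum>p\<in>distinct_quints {..<5}. gram_term (adjacent G) (map ((!) xs) p))"
    unfolding gram_total_def by simp
  also have "\<dots> = (\<Sum>p\<in>distinct_quints {..<5}. gram_term (\<lambda>i j. ?A ! i ! j) p)"
  proof (rule sum.cong[OF refl])
    fix p assume "p \<in> distinct_quints {..<5 :: nat}"
    then have "set p \<subseteq> {..<5}" by (simp add: distinct_quints_def)
    then show "gram_term (adjacent G) (map ((!) xs) p) = gram_term (\<lambda>i j. ?A ! i ! j) p"
      by (intro gram_term_map) (use nth in \<open>auto simp: e_def subset_iff\<close>)
  qed
  also have "\<dots> = (\<Sum>p\<in>set ?ps. table_term table_one table_sigma table_mu table_nu (\<lambda>i j. ?A ! i ! j) p)"
    unfolding ps gram_term_eq_table_term ..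
  also have "\<dots> = table_sum table_one table_sigma table_mu table_nu ?ps ?A"
    unfolding table_sum_def 
    by (rule sum_list_distinct_conv_sum_set[symmetric], rule distinct_permutations_of_set_list) simp
  finally show ?thesis .
qed

text \<open>The vertices may be numbered by increasing degree, and degrees are the row sums of the
  adjacency matrix. So checking the sorted matrices is enough.\<close>

lemma gram_total_le:
  assumes G: "is_graph G" and "order G = 5"
  shows "gram_total G \<le> 303750000"
proof -
  have fin: "finite (verts G)" using G by (simp add: is_graph_def)
  obtain ys where ys: "set ys = verts G" "distinct ys" using finite_distinct_list[OF fin] by blast
  define deg where "deg v = card {u \<in> verts G. adjacent G v u}" for v
  define xs where "xs = sort_key deg ys"
  have xs: "distinct xs" "set xs = verts G" "length xs = 5"
    using ys assms(2) distinct_card[of ys] by (simp_all add: xs_def)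
  let ?e = "\<lambda>i j. adjacent G (xs ! i) (xs ! j)"
  let ?b = "[?e 0 1, ?e 0 2, ?e 0 3, ?e 0 4, ?e 1 2, ?e 1 3, ?e 1 4, ?e 2 3, ?e 2 4, ?e 3 4]"
  have loop: "\<not> adjacent G v v" and sym: "adjacent G v w = adjacent G w v" for v w
    using is_graph_no_loop[OF G] by (auto simp: adjacent_def insert_commute)
  obtain a b c d f where abc: "xs = [a, b, c, d, f]" using length_5E[OF xs(3)] .
  have "adj_rows ?b = map (\<lambda>v. map (adjacent G v) xs) xs"
    unfolding abc using loop by (simp add: adj_rows_def sym)
  then have "row_sums (adj_rows ?b) = map (\<lambda>v. length (filter (adjacent G v) xs)) xs"
    by (simp add: row_sums_def filter_map comp_def)
  also have "\<dots> = map deg xs"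
  proof (rule map_cong[OF refl])
    fix v
    have "length (filter (adjacent G v) xs) = card (set (filter (adjacent G v) xs))"
      using xs(1) by (intro distinct_card[symmetric]) simp
    then show "length (filter (adjacent G v) xs) = deg v"
      by (simp add: deg_def xs(2))
  qed
  finally have "sorted (row_sums (adj_rows ?b))" by (simp add: xs_def)
  then show ?thesis
    using sorted_bound_all[of ?b] unfolding gram_total_eq_table_sum[OF G xs] sorted_bound_def by simp
qed

lemma is_graph_C4_pendant: "is_graph C4_pendant" "order C4_pendant = 5"
  by (auto simp: C4_pendant_def is_graph_def)

lemma gram_total_C4_pendant: "gram_total C4_pendant \<le> 303750000 - 4 * 302330880"
proof -
  have "gram_total C4_pendant = table_sum table_one table_sigma table_mu table_nu
     (permutations_of_set_list [0, 1, 2, 3, 4])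
     (adj_rows [True, False, True, True, True, False, False, True, False, False])"
    by (subst gram_total_eq_table_sum[OF is_graph_C4_pendant(1), of "[0, 1, 2, 3, 4]"])
      (auto simp: C4_pendant_def adjacent_def doubleton_eq_iff)
  then show ?thesis using table_sum_C4_pendant by simp
qed

text \<open>A repetition occupies at least one of the 10 pairs of positions, and each pair leaves
  four free entries.\<close>

lemma card_repeating_quints:
  assumes "finite V" "5 \<le> card V"
  shows "card (quints V - distinct_quints V) \<le> 10 * card V ^ 4"
proof -
  \<comment> \<open>Writing the size as \<open>m + 5\<close> removes truncated subtraction, and the
    final inequality then holds coefficient by coefficient in \<open>m\<close>.\<close>
  obtain m where m: "card V = m + 5" using assms(2) le_Suc_ex by (metis add.commute)
  have "card (distinct_quints V) = \<Prod>{card V - 5 + 1..card V}"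
    using card_lists_distinct_length_eq[OF assms]
    by (simp add: distinct_quints_def conj_ac)
  also have "\<dots> = (m + 1) * (m + 2) * (m + 3) * (m + 4) * (m + 5)"
  proof -
    have "{card V - 5 + 1..card V} = {m + 1, m + 2, m + 3, m + 4, m + 5}" using m by auto
    then show ?thesis by (simp add: algebra_simps)
  qed
  finally have d: "card (distinct_quints V) = (m + 1) * (m + 2) * (m + 3) * (m + 4) * (m + 5)" .
  have q: "card (quints V) = (m + 5) ^ 5"
    unfolding quints_def using card_lists_length_eq[OF assms(1), of 5] m by simp
  have "(m + 5) ^ 5 \<le> (m + 1) * (m + 2) * (m + 3) * (m + 4) * (m + 5) + 10 * (m + 5) ^ 4"
  proof -
    have "x ^ 5 = x * x * x * x * x" "x ^ 4 = x * x * x * x" for x :: nat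
      by (simp_all add: numeral_eq_Suc)
    then show ?thesis by (simp add: algebra_simps)
  qed
  moreover have "card (quints V - distinct_quints V) = card (quints V) - card (distinct_quints V)"
    using assms(1) distinct_quints_subset finite_distinct_quints by (intro card_Diff_subset) auto
  ultimately show ?thesis unfolding d q m by linarith
qed

text \<open>Expanding a quadratic form produces tuples in which some entries may coincide. Such an
  index set lies between the distinct tuples and all tuples, so replacing it by the distinct ones
  costs at most \<open>K\<close> for each repeating tuple.\<close>

lemma sum_encoded_quints:
  fixes g :: "'a list \<Rightarrow> real"
  assumes V: "finite V" "5 \<le> card V" and A: "inj_on enc A" "enc ` A \<subseteq> quints V"
      "distinct_quints V \<subseteq> enc ` A"
    and g: "\<And>xs. xs \<in> quints V \<Longrightarrow> \<bar>g xs\<bar> \<le> K"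
  shows "\<bar>(\<Sum>a\<in>A. g (enc a)) - (\<Sum>xs\<in>distinct_quints V. g xs)\<bar> \<le> 10 * K * real (card V) ^ 4"
proof -
  have fin: "finite (enc ` A)" using A(2) finite_quints[OF V(1)] finite_subset by blast
  have "V \<noteq> {}" using V(2) by auto
  then obtain v where "v \<in> V" by blast
  then have "replicate 5 v \<in> quints V" by (simp add: quints_def)
  then have K: "0 \<le> K" using g abs_ge_zero order_trans by blast
  have "(\<Sum>a\<in>A. g (enc a)) - (\<Sum>xs\<in>distinct_quints V. g xs)
      = (\<Sum>xs\<in>enc ` A - distinct_quints V. g xs)"
    using A(1,3) fin by (simp add: sum_diff sum.reindex)
  also have "\<bar>\<dots>\<bar> \<le> (\<Sum>xs\<in>enc ` A - distinct_quints V. K)"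
    using A(2) g by (intro order_trans[OF sum_abs] sum_mono) blast
  also have "\<dots> = real (card (enc ` A - distinct_quints V)) * K" by simp
  also have "\<dots> \<le> real (10 * card V ^ 4) * K"
  proof (intro mult_right_mono K of_nat_mono)
    have "card (enc ` A - distinct_quints V) \<le> card (quints V - distinct_quints V)"
      using A(2) finite_quints[OF V(1)] by (intro card_mono) auto
    then show "card (enc ` A - distinct_quints V) \<le> 10 * card V ^ 4"
      using card_repeating_quints[OF V] by linarith
  qed
  finally show ?thesis by (simp add: mult_ac)
qed

section \<open>The certificate identity\<close>

text \<open>Expanding every square lets \<open>x\<close> and \<open>y\<close> range independently
  over \<open>A\<close>; the weights then collect into Gram entries.\<close>

lemma gram_square:
  fixes c :: "'x \<Rightarrow> nat"
  shows "(\<Sum>(w, l)\<leftarrow>sq. real_of_int w * (\<Sum>x\<in>A. real_of_int (l ! c x))\<^sup>2)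
    = (\<Sum>x\<in>A. \<Sum>y\<in>A. real_of_int (gram sq (c x) (c y)))"
proof (induction sq)
  case (Cons p sq)
  obtain w l where p: "p = (w, l)" by fastforce
  have "real_of_int w * (\<Sum>x\<in>A. real_of_int (l ! c x))\<^sup>2
      = (\<Sum>x\<in>A. \<Sum>y\<in>A. real_of_int (w * l ! c x * l ! c y))"
  proof -
    have "(\<Sum>x\<in>A. real_of_int (l ! c x))\<^sup>2 = (\<Sum>x\<in>A. \<Sum>y\<in>A. real_of_int (l ! c x) * real_of_int (l ! c y))"
      by (simp only: power2_eq_square sum_product)
    then show ?thesis by (simp add: sum_distrib_left mult.assoc)
  qed
  then show ?case using Cons by (simp add: p gram_Cons sum.distrib)
qed (simp add: gram_def)

text \<open>Each 2-set arises from two ordered pairs. This is the source of the relative weight 1 /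
  4 of the single-vertex type, whose forms enter squared.\<close>

lemma sum_ordered_pairs:
  fixes g :: "'a set \<Rightarrow> real"
  assumes "finite A"
  shows "(\<Sum>(x, y) | x \<in> A \<and> y \<in> A \<and> x \<noteq> y. g {x, y}) = 2 * (\<Sum>X | X \<subseteq> A \<and> card X = 2. g X)"
proof -
  let ?P = "{(x, y). x \<in> A \<and> y \<in> A \<and> x \<noteq> y}" and ?S = "{X. X \<subseteq> A \<and> card X = 2}"
  have finP: "finite ?P" by (rule finite_subset[of _ "A \<times> A"]) (use assms in auto)
  have "(\<Sum>X\<in>?S. \<Sum>p | p \<in> ?P \<and> (\<lambda>(x, y). {x, y}) p = X. case p of (x, y) \<Rightarrow> g {x, y})
      = (\<Sum>p\<in>?P. case p of (x, y) \<Rightarrow> g {x, y})"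
    by (rule sum.group[OF finP]) (use assms in \<open>auto simp: card_2_iff\<close>)
  moreover have "(\<Sum>p | p \<in> ?P \<and> (\<lambda>(x, y). {x, y}) p = X. case p of (x, y) \<Rightarrow> g {x, y}) = 2 * g X"
    if "X \<in> ?S" for X
  proof -
    from that obtain a b where ab: "X = {a, b}" "a \<noteq> b" "a \<in> A" "b \<in> A"
      by (auto simp: card_2_iff)
    then have "{p. p \<in> ?P \<and> (\<lambda>(x, y). {x, y}) p = X} = {(a, b), (b, a)}"
      by (auto simp: doubleton_eq_iff)
    then show ?thesis using ab(2) by (simp add: ab(1) insert_commute)
  qed
  ultimately show ?thesis by (simp add: sum_distrib_left)
qed

lemma unlabelled_code_pair:
  assumes "is_graph G" "x \<noteq> y"
  shows "unlabelled_code 1 (G, f) {x, y} = pair_code (adjacent G) (f 0) x y"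
proof -
  have "{z \<in> {x, y}. {f 0, z} \<in> edges G}
      = (if adjacent G (f 0) x then {x} else {}) \<union> (if adjacent G (f 0) y then {y} else {})"
    by (auto simp: adjacent_def)
  then have "card {z \<in> {x, y}. {f 0, z} \<in> edges G} = of_bool (adjacent G (f 0) x) + of_bool (adjacent G (f 0) y)"
    using assms(2) by simp
  moreover have "(\<exists>u\<in>{x, y}. \<exists>v\<in>{x, y}. {u, v} \<in> edges G) \<longleftrightarrow> adjacent G x y"
    using is_graph_no_loop[OF assms(1)] by (auto simp: adjacent_def insert_commute)
  ultimately show ?thesis by (simp add: unlabelled_code_def pair_code_def)
qed

lemma unlabelled_code_single:
  "unlabelled_code 3 (G, f) {x} = star_code (adjacent G) (f 0) (f 1) (f 2) x"
  by (simp add: unlabelled_code_def star_code_def adjacent_def)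

lemma type3_eqI:
  assumes "is_type 3 \<tau>" "is_type 3 \<tau>'"
    and "{0, 1} \<in> edges \<tau> \<longleftrightarrow> {0, 1} \<in> edges \<tau>'" "{0, 2} \<in> edges \<tau> \<longleftrightarrow> {0, 2} \<in> edges \<tau>'"
      "{1, 2} \<in> edges \<tau> \<longleftrightarrow> {1, 2} \<in> edges \<tau>'"
  shows "\<tau> = \<tau>'"
proof (rule prod_eqI)
  show "verts \<tau> = verts \<tau>'" using assms(1,2) by (simp add: is_type_def)
  have E: "e = {0, 1} \<or> e = {0, 2} \<or> e = {1, 2}" if "is_type 3 \<sigma>" "e \<in> edges \<sigma>" for e \<sigma>
  proof -
    have "e \<subseteq> {..<3}" "card e = 2" using that by (auto simp: is_type_def is_graph_def)
    then obtain i j where "e = {i, j}" "i \<noteq> j" "i < 3" "j < 3" by (auto simp: card_2_iff)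
    moreover from this have "i = 0 \<or> i = 1 \<or> i = 2" "j = 0 \<or> j = 1 \<or> j = 2" by linarith+
    ultimately show ?thesis by (auto simp: insert_commute)
  qed
  show "edges \<tau> = edges \<tau>'"
    using E[OF assms(1)] E[OF assms(2)] assms(3-5) by blast
qed

lemma type_edges:
  "{0, 1} \<notin> edges type_sigma" "{0, 2} \<notin> edges type_sigma" "{1, 2} \<notin> edges type_sigma"
  "{0, 1} \<in> edges type_mu" "{0, 2} \<notin> edges type_mu" "{1, 2} \<notin> edges type_mu"
  "{0, 1} \<in> edges type_nu" "{0, 2} \<in> edges type_nu" "{1, 2} \<notin> edges type_nu"
  by (simp_all add: type_sigma_def type_mu_def type_nu_def doubleton_eq_iff)

text \<open>Comparison of types becomes three edge tests, which can be read off in the ambient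
  graph.\<close>

lemma type_squares_type3:
  assumes "is_type 3 \<tau>"
  shows "type_squares \<tau> = root_squares ({0, 1} \<in> edges \<tau>) ({0, 2} \<in> edges \<tau>) ({1, 2} \<in> edges \<tau>)"
proof -
  have one: "\<tau> \<noteq> type_one"
  proof
    assume "\<tau> = type_one"
    then have "order \<tau> = 1" by (simp add: type_one_def)
    moreover have "order \<tau> = 3" using assms by (simp add: is_type_def)
    ultimately show False by simp
  qed
  have sigma: "\<tau> = type_sigma \<longleftrightarrow> {0, 1} \<notin> edges \<tau> \<and> {0, 2} \<notin> edges \<tau> \<and> {1, 2} \<notin> edges \<tau>"
    by (intro iffI type3_eqI[OF assms is_type_named(2)]) (simp_all only: type_edges simp_thms)
  have mu: "\<tau> = type_mu \<longleftrightarrow> {0, 1} \<in> edges \<tau> \<and> {0, 2} \<notin> edges \<tau> \<and> {1, 2} \<notin> edges \<tau>"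
    by (intro iffI type3_eqI[OF assms is_type_named(3)]) (simp_all only: type_edges simp_thms)
  have nu: "\<tau> = type_nu \<longleftrightarrow> {0, 1} \<in> edges \<tau> \<and> {0, 2} \<in> edges \<tau> \<and> {1, 2} \<notin> edges \<tau>"
    by (intro iffI type3_eqI[OF assms is_type_named(4)]) (simp_all only: type_edges simp_thms)
  have "(if \<not> p \<and> \<not> q \<and> \<not> r then A else if p \<and> \<not> q \<and> \<not> r then B
        else if p \<and> q \<and> \<not> r then C else D)
      = (if r then D else if p then if q then C else B else if q then D else A)"
    for p q r and A B C D :: "(int \<times> int list) list"
    by simp
  then show ?thesis
    unfolding type_squares_def root_squares_def sigma mu nu if_not_P[OF one] .
qed

lemma type_of_1:
  assumes "is_graph G"
  shows "type_of 1 f G = type_one"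
proof (rule prod_eqI)
  have "{i, j} \<notin> edges (type_of 1 f G)" if "i < 1" "j < 1" for i j
    using that is_graph_no_loop[OF is_type_type_of[OF assms, of 1 f, unfolded is_type_def, THEN conjunct1]]
    by simp
  then show "edges (type_of 1 f G) = edges type_one"
    by (auto simp: type_of_def type_one_def)
qed (simp add: type_of_def type_one_def)

lemma type_squares_type_of:
  assumes "is_graph G"
  shows "type_squares (type_of 3 f G)
    = root_squares (adjacent G (f 0) (f 1)) (adjacent G (f 0) (f 2)) (adjacent G (f 1) (f 2))"
proof -
  have "{i, j} \<in> edges (type_of 3 f G) \<longleftrightarrow> adjacent G (f i) (f j)" if "i < 3" "j < 3" for i j
    using edge_compat_type_of[of f 3 G] that
    by (simp add: edge_compat_def adjacent_def type_of_def)
  then show ?thesis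
    by (simp add: type_squares_type3[OF is_type_type_of[OF assms]])
qed

definition flag_quadratic :: "nat \<Rightarrow> nat sgraph \<Rightarrow> (nat \<Rightarrow> nat) \<Rightarrow> real" where
  "flag_quadratic q G f = (let \<tau> = type_of q f G; v = flag_vec \<tau> (flag_size 5 q) (G, f)
     in v \<bullet> (cert_mat \<tau> *\<^sub>v v))"

lemma flag_quadratic_eq:
  assumes G: "is_graph G" and f: "f \<in> injections q (verts G)" and q: "q = 1 \<or> q = 3"
  shows "flag_quadratic q G f = (\<Sum>(w, l)\<leftarrow>type_squares (type_of q f G).
    real_of_int w * (\<Sum>X | X \<subseteq> verts G - f ` {..<q} \<and> card X = rest_size q.
      real_of_int (l ! unlabelled_code q (G, f) X))\<^sup>2) / 302330880"
proof -
  let ?\<tau> = "type_of q f G" and ?s = "q + rest_size q"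
  let ?v = "flag_vec ?\<tau> ?s (G, f)" and ?n = "length (flag_reps ?\<tau> ?s)"
  have "?v \<in> carrier_vec ?n" unfolding flag_vec_def by (rule carrier_vecI) simp
  then have "flag_quadratic q G f = (\<Sum>(w, l)\<leftarrow>type_squares ?\<tau>.
      real_of_int w * (lin_form ?n (\<lambda>i. flag_code ?\<tau> (flag_reps ?\<tau> ?s ! i)) l ?v)\<^sup>2) / 302330880"
    unfolding flag_quadratic_def flag_size_5[OF q] cert_mat_eq[OF is_type_type_of[OF G] q] Let_def
    by (rule sos_mat_quadratic)
  moreover have "lin_form ?n (\<lambda>i. flag_code ?\<tau> (flag_reps ?\<tau> ?s ! i)) l ?v
      = (\<Sum>X | X \<subseteq> verts G - f ` {..<q} \<and> card X = rest_size q.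
          real_of_int (l ! unlabelled_code q (G, f) X))" for l
    unfolding lin_form_def by (rule flag_vec_sum[OF G f q])
  ultimately show ?thesis by (simp only:)
qed

definition one_term :: "('a \<Rightarrow> 'a \<Rightarrow> bool) \<Rightarrow> 'a list \<Rightarrow> real" where
  "one_term e xs = real_of_int
     (gram squares_one (pair_code e (xs ! 0) (xs ! 1) (xs ! 2)) (pair_code e (xs ! 0) (xs ! 3) (xs ! 4)))"

definition three_term :: "('a \<Rightarrow> 'a \<Rightarrow> bool) \<Rightarrow> 'a list \<Rightarrow> real" where
  "three_term e xs = real_of_int
     (gram (root_squares (e (xs ! 0) (xs ! 1)) (e (xs ! 0) (xs ! 2)) (e (xs ! 1) (xs ! 2)))
       (star_code e (xs ! 0) (xs ! 1) (xs ! 2) (xs ! 3)) (star_code e (xs ! 0) (xs ! 1) (xs ! 2) (xs ! 4)))"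

lemma gram_term_eq_one_three:
  assumes "length xs = 5"
  shows "real_of_int (gram_term e xs) = one_term e xs + 4 * three_term e xs"
  using assms by (elim length_5E) (simp add: gram_term_def one_term_def three_term_def)

lemma gram_bounded: "\<exists>K. \<forall>a<8. \<forall>b<8. \<bar>real_of_int (gram sq a b)\<bar> \<le> K"
proof (intro exI allI impI)
  fix a b :: nat assume "a < 8" "b < 8"
  then show "\<bar>real_of_int (gram sq a b)\<bar> \<le> (\<Sum>(a, b)\<in>{..<8} \<times> {..<8}. \<bar>real_of_int (gram sq a b)\<bar>)"
    using member_le_sum[of "(a, b)" "{..<8} \<times> {..<8}" "\<lambda>(a, b). \<bar>real_of_int (gram sq a b)\<bar>"] by auto
qed

text \<open>One constant serves all graphs of any order, because codes stay below 8 whatever the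
  relation and the list. The error term O(n^4) depends on this uniformity.\<close>

lemma terms_bounded: "\<exists>K. \<forall>(e :: 'a \<Rightarrow> 'a \<Rightarrow> bool) xs. \<bar>one_term e xs\<bar> \<le> K \<and> \<bar>three_term e xs\<bar> \<le> K"
proof -
  obtain K1 where 1: "\<forall>a<8. \<forall>b<8. \<bar>real_of_int (gram squares_one a b)\<bar> \<le> K1"
    using gram_bounded[of squares_one] by blast
  obtain Ks where 2: "\<forall>a<8. \<forall>b<8. \<bar>real_of_int (gram squares_sigma a b)\<bar> \<le> Ks"
    using gram_bounded[of squares_sigma] by blast
  obtain Km where 3: "\<forall>a<8. \<forall>b<8. \<bar>real_of_int (gram squares_mu a b)\<bar> \<le> Km"
    using gram_bounded[of squares_mu] by blast
  obtain Kn where 4: "\<forall>a<8. \<forall>b<8. \<bar>real_of_int (gram squares_nu a b)\<bar> \<le> Kn"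
    using gram_bounded[of squares_nu] by blast
  let ?K = "\<bar>K1\<bar> + \<bar>Ks\<bar> + \<bar>Km\<bar> + \<bar>Kn\<bar>"
  have pc: "pair_code e r x y < 8" for e and r x y :: 'a
    using pair_code_less[of e r x y] by linarith
  have "\<bar>one_term e xs\<bar> \<le> ?K" for e and xs :: "'a list"
  proof -
    have "\<bar>one_term e xs\<bar> \<le> K1" unfolding one_term_def by (rule 1[rule_format, OF pc pc])
    then show ?thesis by linarith
  qed
  moreover have "\<bar>real_of_int (gram (root_squares p q r) a b)\<bar> \<le> ?K" if "a < 8" "b < 8" for p q r a b
    using 2[rule_format, OF that] 3[rule_format, OF that] 4[rule_format, OF that]
    by (cases p; cases q; cases r) (simp_all add: root_squares_def)
  note root = this
  have "\<bar>three_term e xs\<bar> \<le> ?K" for e and xs :: "'a list"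
    unfolding three_term_def by (rule root[OF star_code_less star_code_less])
  ultimately show ?thesis by blast
qed

text \<open>Injections are extensional, hence determined by their values below \<open>q\<close>;
  this makes the encoding of embeddings by lists injective.\<close>

lemma injections_eqI:
  assumes "f \<in> injections q A" "g \<in> injections q A" "\<And>i. i < q \<Longrightarrow> f i = g i"
  shows "f = g"
  using assms by (intro PiE_ext[of f "{..<q}" "\<lambda>_. A" g]) (auto simp: injections_def)

text \<open>Two ordered pairs, one for each factor of a square. Each pair has distinct entries and
  avoids the root, but the pairs may overlap; the overlaps are the repeating tuples that go into the
  error term.\<close>

definition one_index :: "'a set \<Rightarrow> ((nat \<Rightarrow> 'a) \<times> ('a \<times> 'a) \<times> ('a \<times> 'a)) set" where
  "one_index V = (SIGMA f:injections 1 V.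
     {(x, y). x \<in> V - f ` {..<1} \<and> y \<in> V - f ` {..<1} \<and> x \<noteq> y}
     \<times> {(x, y). x \<in> V - f ` {..<1} \<and> y \<in> V - f ` {..<1} \<and> x \<noteq> y})"

definition three_index :: "'a set \<Rightarrow> ((nat \<Rightarrow> 'a) \<times> 'a \<times> 'a) set" where
  "three_index V = (SIGMA f:injections 3 V. (V - f ` {..<3}) \<times> (V - f ` {..<3}))"

definition one_list :: "(nat \<Rightarrow> 'a) \<times> ('a \<times> 'a) \<times> ('a \<times> 'a) \<Rightarrow> 'a list" where
  "one_list = (\<lambda>(f, (x, y), (x', y')). [f 0, x, y, x', y'])"

definition three_list :: "(nat \<Rightarrow> 'a) \<times> 'a \<times> 'a \<Rightarrow> 'a list" where
  "three_list = (\<lambda>(f, x, y). [f 0, f 1, f 2, x, y])"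

lemma one_list_props:
  "inj_on one_list (one_index V)" "one_list ` one_index V \<subseteq> quints V"
  "distinct_quints V \<subseteq> one_list ` one_index V"
proof -
  show "inj_on one_list (one_index V)"
    by (rule inj_onI) (auto simp: one_list_def one_index_def intro: injections_eqI)
  show "one_list ` one_index V \<subseteq> quints V"
    by (auto simp: one_list_def one_index_def quints_def injections_def)
  show "distinct_quints V \<subseteq> one_list ` one_index V"
  proof
    fix xs assume xs: "xs \<in> distinct_quints V"
    then have "length xs = 5" by (simp add: distinct_quints_def)
    then obtain a b c x y where xs5: "xs = [a, b, c, x, y]" by (rule length_5E)
    let ?p = "(restrict (\<lambda>_. a) {..<1}, (b, c), (x, y))"
    have "?p \<in> one_index V"
      using xs unfolding xs5 by (auto simp: one_index_def distinct_quints_def injections_def inj_on_def)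
    moreover have "one_list ?p = xs" by (simp add: one_list_def xs5)
    ultimately show "xs \<in> one_list ` one_index V" by blast
  qed
qed

lemma three_list_props:
  "inj_on three_list (three_index V)" "three_list ` three_index V \<subseteq> quints V"
  "distinct_quints V \<subseteq> three_list ` three_index V"
proof -
  have less3: "i = 0 \<or> i = 1 \<or> i = 2" if "i < 3" for i :: nat using that by linarith
  show "inj_on three_list (three_index V)"
  proof (rule inj_onI)
    fix p p' :: "(nat \<Rightarrow> 'a) \<times> 'a \<times> 'a"
    assume p: "p \<in> three_index V" "p' \<in> three_index V" "three_list p = three_list p'"
    obtain f x y f' x' y' where pp: "p = (f, x, y)" "p' = (f', x', y')"
      by (cases p; cases p') auto
    have "f = f'"
    proof (rule injections_eqI)
      show "f \<in> injections 3 V" "f' \<in> injections 3 V" using p by (auto simp: pp three_index_def)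
      fix i :: nat assume "i < 3"
      from less3[OF this] show "f i = f' i"
        using p(3) by (elim disjE) (simp_all add: pp three_list_def)
    qed
    then show "p = p'" using p(3) by (simp add: pp three_list_def)
  qed
  show "three_list ` three_index V \<subseteq> quints V"
    by (auto simp: three_list_def three_index_def quints_def injections_def PiE_def Pi_def)
  show "distinct_quints V \<subseteq> three_list ` three_index V"
  proof
    fix xs assume xs: "xs \<in> distinct_quints V"
    then have "length xs = 5" by (simp add: distinct_quints_def)
    then obtain a b c x y where xs5: "xs = [a, b, c, x, y]" by (rule length_5E)
    let ?f = "restrict (\<lambda>i. [a, b, c] ! i) {..<3}"
    have abc: "a \<in> V" "b \<in> V" "c \<in> V" "x \<in> V" "y \<in> V" "distinct [a, b, c, x, y]"
      using xs unfolding xs5 by (auto simp: distinct_quints_def)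
    have img: "{..<3 :: nat} = {0, 1, 2}" by auto
    have "?f ` {..<3} = {a, b, c}" unfolding img by auto
    moreover have "inj_on ?f {..<3}" unfolding img inj_on_def using abc(6) by auto
    ultimately have "(?f, x, y) \<in> three_index V"
      using abc by (simp add: three_index_def injections_def PiE_def)
        (auto simp: Pi_def img)
    moreover have "three_list (?f, x, y) = xs" by (simp add: three_list_def xs5)
    ultimately show "xs \<in> three_list ` three_index V" by (metis image_eqI)
  qed
qed

lemma sum_flag_quadratic_1:
  assumes G: "is_graph G"
  shows "4 * 302330880 * (\<Sum>f\<in>injections 1 (verts G). flag_quadratic 1 G f)
    = (\<Sum>p\<in>one_index (verts G). one_term (adjacent G) (one_list p))"
proof -
  let ?V = "verts G"
  let ?P = "\<lambda>f :: nat \<Rightarrow> nat. {(x, y). x \<in> ?V - f ` {..<1} \<and> y \<in> ?V - f ` {..<1} \<and> x \<noteq> y}"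
  let ?c = "\<lambda>f (x, y). pair_code (adjacent G) (f (0 :: nat)) x y"
  have fin: "finite ?V" using G by (simp add: is_graph_def)
  have finP: "finite (?P f)" for f
    by (rule finite_subset[of _ "?V \<times> ?V"]) (use fin in auto)
  have "4 * 302330880 * flag_quadratic 1 G f
      = (\<Sum>a\<in>?P f \<times> ?P f. one_term (adjacent G) (one_list (f, a)))"
    if f: "f \<in> injections 1 ?V" for f
  proof -
    let ?S = "\<lambda>l. \<Sum>X | X \<subseteq> ?V - f ` {..<1} \<and> card X = rest_size 1.
        real_of_int (l ! unlabelled_code 1 (G, f) X)"
    have half: "2 * ?S l = (\<Sum>p\<in>?P f. real_of_int (l ! ?c f p))" for l
    proof -
      have "2 * ?S l = (\<Sum>(x, y)\<in>?P f. real_of_int (l ! unlabelled_code 1 (G, f) {x, y}))"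
        using sum_ordered_pairs[of "?V - f ` {..<1}" "\<lambda>X. real_of_int (l ! unlabelled_code 1 (G, f) X)"] fin
        by (simp add: rest_size_def)
      also have "\<dots> = (\<Sum>p\<in>?P f. real_of_int (l ! ?c f p))"
        by (rule sum.cong[OF refl]) (auto simp: unlabelled_code_pair[OF G, unfolded One_nat_def])
      finally show ?thesis .
    qed
    \<comment> \<open>Both factors of a square pass from unordered to ordered pairs, hence the
      4.\<close>
    have "4 * (\<Sum>(w, l)\<leftarrow>sq. real_of_int w * (?S l)\<^sup>2)
        = (\<Sum>(w, l)\<leftarrow>sq. real_of_int w * (2 * ?S l)\<^sup>2)" for sq
      by (induction sq) (auto simp: power_mult_distrib distrib_left)
    note four = this
    have "4 * 302330880 * flag_quadratic 1 G f
        = 4 * (\<Sum>(w, l)\<leftarrow>squares_one. real_of_int w * (?S l)\<^sup>2)"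
      using flag_quadratic_eq[OF G f disjI1[OF refl]] unfolding type_of_1[OF G] type_squares_simps
      by simp
    also have "\<dots> = (\<Sum>(w, l)\<leftarrow>squares_one. real_of_int w * (2 * ?S l)\<^sup>2)"
      by (rule four)
    also have "\<dots> = (\<Sum>p\<in>?P f. \<Sum>p'\<in>?P f. real_of_int (gram squares_one (?c f p) (?c f p')))"
      unfolding half by (rule gram_square)
    also have "\<dots> = (\<Sum>a\<in>?P f \<times> ?P f. one_term (adjacent G) (one_list (f, a)))"
      unfolding sum.cartesian_product
      by (rule sum.cong[OF refl]) (auto simp: one_term_def one_list_def)
    finally show ?thesis .
  qed
  then have "4 * 302330880 * (\<Sum>f\<in>injections 1 ?V. flag_quadratic 1 G f)
      = (\<Sum>f\<in>injections 1 ?V. \<Sum>a\<in>?P f \<times> ?P f. one_term (adjacent G) (one_list (f, a)))"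
    unfolding sum_distrib_left by (intro sum.cong refl)
  also have "\<dots> = (\<Sum>(f, a)\<in>(SIGMA f:injections 1 ?V. ?P f \<times> ?P f). one_term (adjacent G) (one_list (f, a)))"
    using finP fin by (intro sum.Sigma) (auto simp: injections_def finite_PiE)
  finally show ?thesis by (simp add: one_index_def split_beta)
qed

lemma sum_flag_quadratic_3:
  assumes G: "is_graph G"
  shows "302330880 * (\<Sum>f\<in>injections 3 (verts G). flag_quadratic 3 G f)
    = (\<Sum>p\<in>three_index (verts G). three_term (adjacent G) (three_list p))"
proof -
  let ?V = "verts G" and ?c = "\<lambda>f x. star_code (adjacent G) (f (0 :: nat)) (f 1) (f 2) x"
  have fin: "finite ?V" using G by (simp add: is_graph_def)
  have "302330880 * flag_quadratic 3 G f
      = (\<Sum>a\<in>(?V - f ` {..<3}) \<times> (?V - f ` {..<3}). three_term (adjacent G) (three_list (f, a)))"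
    if f: "f \<in> injections 3 ?V" for f
  proof -
    let ?U = "?V - f ` {..<3}" and ?sq = "type_squares (type_of 3 f G)"
    let ?S = "\<lambda>l. \<Sum>X | X \<subseteq> ?U \<and> card X = rest_size 3. real_of_int (l ! unlabelled_code 3 (G, f) X)"
    have single: "?S l = (\<Sum>x\<in>?U. real_of_int (l ! ?c f x))" for l
    proof -
      have "{X. X \<subseteq> ?U \<and> card X = rest_size 3} = (\<lambda>x. {x}) ` ?U"
        by (auto simp: rest_size_def card_1_singleton_iff)
      then show ?thesis by (simp add: sum.reindex unlabelled_code_single)
    qed
    have "302330880 * flag_quadratic 3 G f = (\<Sum>(w, l)\<leftarrow>?sq. real_of_int w * (?S l)\<^sup>2)"
      using flag_quadratic_eq[OF G f disjI2[OF refl]] by simp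
    also have "\<dots> = (\<Sum>x\<in>?U. \<Sum>y\<in>?U. real_of_int (gram ?sq (?c f x) (?c f y)))"
      unfolding single by (rule gram_square)
    also have "\<dots> = (\<Sum>a\<in>?U \<times> ?U. three_term (adjacent G) (three_list (f, a)))"
      unfolding sum.cartesian_product type_squares_type_of[OF G]
      by (rule sum.cong[OF refl]) (auto simp: three_term_def three_list_def)
    finally show ?thesis .
  qed
  then have "302330880 * (\<Sum>f\<in>injections 3 ?V. flag_quadratic 3 G f)
      = (\<Sum>f\<in>injections 3 ?V. \<Sum>a\<in>(?V - f ` {..<3}) \<times> (?V - f ` {..<3}). three_term (adjacent G) (three_list (f, a)))"
    unfolding sum_distrib_left by (intro sum.cong refl)
  also have "\<dots> = (\<Sum>(f, a)\<in>(SIGMA f:injections 3 ?V. (?V - f ` {..<3}) \<times> (?V - f ` {..<3})).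
      three_term (adjacent G) (three_list (f, a)))"
    using fin by (intro sum.Sigma) (auto simp: injections_def finite_PiE)
  finally show ?thesis by (simp add: three_index_def split_beta)
qed

lemma type_sizes_5: "type_sizes 5 = {1, 3}"
proof -
  have "q = 1 \<or> q = 3" if "1 \<le> q" "q + 2 \<le> 5" "q mod 2 = 1" for q :: nat
  proof -
    have "q = 1 \<or> q = 2 \<or> q = 3" using that(1,2) by linarith
    then show ?thesis using that(3) by auto
  qed
  then show ?thesis by (auto simp: type_sizes_def)
qed

text \<open>The quadratic forms and the total weight differ only in tuples with repetitions.\<close>

lemma quadratic_error:
  "\<exists>C. \<forall>G. is_graph G \<and> 5 \<le> order G \<longrightarrow>
    \<bar>(\<Sum>q\<in>type_sizes 5. \<Sum>f\<in>injections q (verts G). flag_quadratic q G f)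
      - real_of_int (gram_total G) / (4 * 302330880)\<bar> \<le> C * real (order G) ^ 4"
proof -
  obtain K where K: "\<And>(e :: nat \<Rightarrow> nat \<Rightarrow> bool) xs. \<bar>one_term e xs\<bar> \<le> K \<and> \<bar>three_term e xs\<bar> \<le> K"
    using terms_bounded[where 'a = nat] by (elim exE) blast
  have "\<bar>(\<Sum>q\<in>type_sizes 5. \<Sum>f\<in>injections q (verts G). flag_quadratic q G f)
      - real_of_int (gram_total G) / (4 * 302330880)\<bar> \<le> 50 * K * real (order G) ^ 4"
    if G: "is_graph G" "5 \<le> order G" for G :: "nat sgraph"
  proof -
    let ?V = "verts G" and ?e = "adjacent G" and ?B = "10 * K * real (order G) ^ 4"
    have fin: "finite ?V" using G by (simp add: is_graph_def)
    define q1 q3 where "q1 = (\<Sum>f\<in>injections 1 ?V. flag_quadratic 1 G f)"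
      and "q3 = (\<Sum>f\<in>injections 3 ?V. flag_quadratic 3 G f)"
    define s1 s3 where "s1 = (\<Sum>xs\<in>distinct_quints ?V. one_term ?e xs)"
      and "s3 = (\<Sum>xs\<in>distinct_quints ?V. three_term ?e xs)"
    have 1: "\<bar>4 * 302330880 * q1 - s1\<bar> \<le> ?B"
      unfolding q1_def s1_def sum_flag_quadratic_1[OF G(1)]
      using K by (intro sum_encoded_quints[OF fin G(2) one_list_props]) blast
    have 3: "\<bar>302330880 * q3 - s3\<bar> \<le> ?B"
      unfolding q3_def s3_def sum_flag_quadratic_3[OF G(1)]
      using K by (intro sum_encoded_quints[OF fin G(2) three_list_props]) blast
    have "real_of_int (gram_total G) = s1 + 4 * s3"
      unfolding gram_total_def s1_def s3_def of_int_sum sum_distrib_left sum.distrib[symmetric]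
      by (intro sum.cong refl gram_term_eq_one_three) (simp add: distinct_quints_def)
    moreover have "(\<Sum>q\<in>type_sizes 5. \<Sum>f\<in>injections q ?V. flag_quadratic q G f) = q1 + q3"
      by (simp add: type_sizes_5 q1_def q3_def)
    \<comment> \<open>The errors add up to at most \<open>?B + 4 * ?B\<close>, that is
      \<open>50 * K\<close> times the fourth power; dividing by the scale only decreases
      this.\<close>
    moreover have "\<bar>q1 + q3 - (s1 + 4 * s3) / (4 * 302330880)\<bar> \<le> 50 * K * real (order G) ^ 4"
      using 1 3 by (simp add: abs_le_iff field_simps)
    ultimately show ?thesis by simp
  qed
  then show ?thesis by blast
qed

section \<open>The slack coefficients on five vertices\<close>

lemma ind_density_same_order:
  assumes "is_graph G" "order G = order F"
  shows "ind_density F G = of_bool (graph_iso F G)"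
proof -
  have fin: "finite (verts G)" using assms(1) by (simp add: is_graph_def)
  have "induced G (verts G) = G"
    using assms(1) by (intro prod_eqI) (auto simp: induced_def is_graph_def)
  moreover have "X \<subseteq> verts G \<and> card X = order F \<longleftrightarrow> X = verts G" for X
    using card_subset_eq[OF fin, of X] assms(2) by auto
  then have "{X. X \<subseteq> verts G \<and> card X = order F \<and> graph_iso F (induced G X)}
      = {X. X = verts G \<and> graph_iso F (induced G X)}"
    by (simp only: conj_assoc[symmetric])
  ultimately have "{X. X \<subseteq> verts G \<and> card X = order F \<and> graph_iso F (induced G X)}
      = (if graph_iso F G then {verts G} else {})"
    by auto
  then show ?thesis by (simp add: ind_density_def ind_count_def assms(2))
qed

text \<open>Taking the exact difference makes the certificate identity hold by construction, up to
  repeating tuples. All content moves into non-negativity, which is a finite question.\<close>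

definition cert_slack :: "nat sgraph \<Rightarrow> real" where
  "cert_slack F' = 15625 / 62208 - ind_density C4_pendant F' - real_of_int (gram_total F') / (4 * 302330880)"

text \<open>On five vertices the density of \<open>C4_pendant\<close> is 0 or 1, and after scaling
  the two cases are the two finite checks.\<close>

lemma cert_slack_nonneg:
  assumes "is_graph F'" "order F' = 5"
  shows "0 \<le> cert_slack F'"
proof (cases "graph_iso C4_pendant F'")
  case True
  then have "gram_total F' \<le> 303750000 - 4 * 302330880"
    using gram_total_C4_pendant gram_total_iso by metis
  then have "real_of_int (gram_total F') \<le> 303750000 - 4 * 302330880" by linarith
  then show ?thesis
    using True assms by (simp add: cert_slack_def ind_density_same_order is_graph_C4_pendant(2))
next
  case False
  have "real_of_int (gram_total F') \<le> 303750000" using gram_total_le[OF assms] by linarith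
  then show ?thesis
    using False assms by (simp add: cert_slack_def ind_density_same_order is_graph_C4_pendant(2))
qed

lemma graph_reps_5:
  assumes "F' \<in> set (graph_reps 5)"
  shows "is_graph F'" "order F' = 5"
  using assms graph_reps_spec(1)[of 5] by auto

lemma sum_gram_total:
  fixes G :: "nat sgraph"
  assumes "is_graph G"
  shows "(\<Sum>F'\<in>set (graph_reps 5). real_of_int (gram_total F') * real (ind_count F' G))
    = real_of_int (gram_total G)"
proof -
  have "real_of_int (gram_total G)
      = (\<Sum>X | X \<subseteq> verts G \<and> card X = 5. real_of_int (gram_total (induced G X)))"
    by (subst gram_total_split[OF assms]) simp
  also have "\<dots> = (\<Sum>F'\<in>set (graph_reps 5). real_of_int (gram_total F') * real (ind_count F' G))"
    by (rule sum_over_reps[OF assms]) (simp add: gram_total_iso)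
  finally show ?thesis ..
qed

lemma slack_identity:
  fixes G :: "nat sgraph"
  assumes "is_graph G"
  shows "(\<Sum>F'\<in>set (graph_reps 5). (15625 / 62208 - ind_density C4_pendant F') * real (ind_count F' G))
    - (\<Sum>F'\<in>set (graph_reps 5). cert_slack F' * real (ind_count F' G))
    = real_of_int (gram_total G) / (4 * 302330880)"
  unfolding sum_gram_total[OF assms, symmetric] sum_subtractf[symmetric] sum_divide_distrib
  by (intro sum.cong refl) (simp add: cert_slack_def algebra_simps)

section \<open>Isomorphism classes of types on one and three vertices\<close>

definition type_triangle :: "nat sgraph" where
  "type_triangle = ({..<3}, {{0, 1}, {0, 2}, {1, 2}})"

text \<open>Three vertices carry four isomorphism classes, one for each number of edges; the
  triangle completes them.\<close>

definition listed_types :: "nat sgraph set" where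
  "listed_types = {type_one, type_sigma, type_mu, type_nu, type_triangle}"

text \<open>An isomorphism maps edges injectively to edges, and symmetry gives the converse
  inequality. Order and number of edges together separate the listed types.\<close>

lemma graph_iso_card_edges:
  fixes G H :: "nat sgraph"
  assumes "is_graph G" "is_graph H" "graph_iso G H"
  shows "card (edges G) = card (edges H)"
proof -
  have le: "card (edges G) \<le> card (edges H)" if iso: "graph_iso G H" and G: "is_graph G" and H: "is_graph H"
    for G H :: "nat sgraph"
  proof -
    obtain \<phi> where \<phi>: "bij_betw \<phi> (verts G) (verts H)" "edge_compat \<phi> G H"
      using iso unfolding graph_iso_def by blast
    have sub: "edges G \<subseteq> Pow (verts G)" "edges H \<subseteq> Pow (verts H)" "finite (verts H)"
      using G H by (auto simp: is_graph_def)
    have "inj_on ((`) \<phi>) (edges G)"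
      using \<phi>(1) sub(1) by (intro inj_on_subset[OF inj_on_image_Pow]) (auto simp: bij_betw_def)
    moreover have "(`) \<phi> ` edges G \<subseteq> edges H"
    proof
      fix d assume "d \<in> (`) \<phi> ` edges G"
      then obtain e where e: "e \<in> edges G" "d = \<phi> ` e" by blast
      then have "card e = 2" "e \<subseteq> verts G" using G by (auto simp: is_graph_def)
      then obtain u v where "e = {u, v}" "u \<in> verts G" "v \<in> verts G" by (auto simp: card_2_iff)
      then show "d \<in> edges H" using e \<phi>(2) by (auto simp: edge_compat_def)
    qed
    moreover have "finite (edges H)" using sub(2,3) by (meson finite_Pow_iff finite_subset)
    ultimately show ?thesis by (metis card_image card_mono)
  qed
  show ?thesis using le[OF assms(3)] le[OF graph_iso_sym[OF assms(3)]] assms by force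
qed

lemma is_type_triangle: "is_type 3 type_triangle"
  by (auto simp: is_type_def is_graph_def type_triangle_def)

lemma card_edges_triangle: "card (edges type_triangle) = 3"
  by (simp add: type_triangle_def doubleton_eq_iff)

lemma graph_iso_type3I:
  assumes \<tau>: "is_type 3 \<tau>" and \<tau>': "is_type 3 \<tau>'" and abc: "{a, b, c} = {0, 1, 2 :: nat}"
    and "{a, b} \<in> edges \<tau> \<longleftrightarrow> {0, 1} \<in> edges \<tau>'" "{a, c} \<in> edges \<tau> \<longleftrightarrow> {0, 2} \<in> edges \<tau>'"
      "{b, c} \<in> edges \<tau> \<longleftrightarrow> {1, 2} \<in> edges \<tau>'"
  shows "graph_iso \<tau>' \<tau>"
proof -
  have three: "{..<3 :: nat} = {0, 1, 2}" by auto
  define \<phi> where "\<phi> i = (if i = 0 then a else if i = 1 then b else c)" for i :: nat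
  have phi: "\<phi> 0 = a" "\<phi> 1 = b" "\<phi> 2 = c" by (simp_all add: \<phi>_def)
  have V: "verts \<tau> = {0, 1, 2}" "verts \<tau>' = {0, 1, 2}"
    using \<tau> \<tau>' three by (simp_all add: is_type_def)
  have "\<phi> ` {0, 1, 2} = {0, 1, 2}"
    using abc by (simp only: image_insert image_empty phi)
  then have bij: "bij_betw \<phi> (verts \<tau>') (verts \<tau>)"
    unfolding V bij_betw_def by (intro conjI eq_card_imp_inj_on) simp_all
  have loop: "{x, x} \<notin> edges \<tau>" "{x, x} \<notin> edges \<tau>'" for x
    using \<tau> \<tau>' is_graph_no_loop[of \<tau>] is_graph_no_loop[of \<tau>'] by (simp_all add: is_type_def)
  have comm: "{b, a} = {a, b}" "{c, a} = {a, c}" "{c, b} = {b, c}"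
    "{1, 0} = {0, 1 :: nat}" "{2, 0} = {0, 2 :: nat}" "{2, 1} = {1, 2 :: nat}"
    by (rule insert_commute)+
  have "{u, v} \<in> edges \<tau>' \<longleftrightarrow> {\<phi> u, \<phi> v} \<in> edges \<tau>"
    if "u \<in> {0, 1, 2}" "v \<in> {0, 1, 2}" for u v
  proof -
    have "u = 0 \<or> u = 1 \<or> u = 2" "v = 0 \<or> v = 1 \<or> v = 2" using that by simp_all
    then show ?thesis
      by (elim disjE) (simp_all only: phi comm loop assms(4-6))
  qed
  then show ?thesis unfolding graph_iso_def edge_compat_def V using bij[unfolded V] by blast
qed

text \<open>There are eight labelled graphs on three vertices. A relabelling moves a single edge to
  \<open>{0, 1}\<close> and the centre of a cherry to \<open>0\<close>.\<close>

lemma listed_types_ex: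
  assumes \<tau>: "is_type 3 \<tau>"
  shows "\<exists>\<tau>'\<in>{type_sigma, type_mu, type_nu, type_triangle}. graph_iso \<tau> \<tau>'"
proof -
  note iso = graph_iso_sym[OF graph_iso_type3I[OF \<tau>]]
  have tri: "{0, 1} \<in> edges type_triangle" "{0, 2} \<in> edges type_triangle" "{1, 2} \<in> edges type_triangle"
    by (simp_all add: type_triangle_def)
  note te = type_edges tri
  have comm: "{1, 0} = {0, 1 :: nat}" "{2, 0} = {0, 2 :: nat}" "{2, 1} = {1, 2 :: nat}"
    by (simp_all add: insert_commute)
  have sets: "{0, 1, 2} = {0, 1, 2 :: nat}" "{0, 2, 1} = {0, 1, 2 :: nat}" "{1, 2, 0} = {0, 1, 2 :: nat}"
    "{1, 0, 2} = {0, 1, 2 :: nat}" "{2, 0, 1} = {0, 1, 2 :: nat}"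
    by auto
  consider
      "{0, 1} \<notin> edges \<tau>" "{0, 2} \<notin> edges \<tau>" "{1, 2} \<notin> edges \<tau>"
    | "{0, 1} \<in> edges \<tau>" "{0, 2} \<notin> edges \<tau>" "{1, 2} \<notin> edges \<tau>"
    | "{0, 1} \<notin> edges \<tau>" "{0, 2} \<in> edges \<tau>" "{1, 2} \<notin> edges \<tau>"
    | "{0, 1} \<notin> edges \<tau>" "{0, 2} \<notin> edges \<tau>" "{1, 2} \<in> edges \<tau>"
    | "{0, 1} \<in> edges \<tau>" "{0, 2} \<in> edges \<tau>" "{1, 2} \<notin> edges \<tau>"
    | "{0, 1} \<in> edges \<tau>" "{0, 2} \<notin> edges \<tau>" "{1, 2} \<in> edges \<tau>"
    | "{0, 1} \<notin> edges \<tau>" "{0, 2} \<in> edges \<tau>" "{1, 2} \<in> edges \<tau>"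
    | "{0, 1} \<in> edges \<tau>" "{0, 2} \<in> edges \<tau>" "{1, 2} \<in> edges \<tau>"
    by blast
  then show ?thesis
  proof cases
    case 1
    then have "graph_iso \<tau> type_sigma" by (intro iso[OF is_type_named(2) sets(1)]) (simp_all only: te simp_thms)
    then show ?thesis by blast
  next
    case 2
    then have "graph_iso \<tau> type_mu" by (intro iso[OF is_type_named(3) sets(1)]) (simp_all only: te simp_thms)
    then show ?thesis by blast
  next
    case 3
    then have "graph_iso \<tau> type_mu" by (intro iso[OF is_type_named(3) sets(2)]) (simp_all only: te comm simp_thms)
    then show ?thesis by blast
  next
    case 4
    then have "graph_iso \<tau> type_mu" by (intro iso[OF is_type_named(3) sets(3)]) (simp_all only: te comm simp_thms)
    then show ?thesis by blast
  next
    case 5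
    then have "graph_iso \<tau> type_nu" by (intro iso[OF is_type_named(4) sets(1)]) (simp_all only: te simp_thms)
    then show ?thesis by blast
  next
    case 6
    then have "graph_iso \<tau> type_nu" by (intro iso[OF is_type_named(4) sets(4)]) (simp_all only: te comm simp_thms)
    then show ?thesis by blast
  next
    case 7
    then have "graph_iso \<tau> type_nu" by (intro iso[OF is_type_named(4) sets(5)]) (simp_all only: te comm simp_thms)
    then show ?thesis by blast
  next
    case 8
    then have "graph_iso \<tau> type_triangle" by (intro iso[OF is_type_triangle sets(1)]) (simp_all only: te simp_thms)
    then show ?thesis by blast
  qed
qed

lemma type_listing_listed_types: "type_listing 5 listed_types"
  unfolding type_listing_def type_sizes_5
proof (intro conjI ballI allI impI)
  fix \<tau> assume "\<tau> \<in> listed_types"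
  then show "\<exists>q\<in>{1, 3}. is_type q \<tau>"
    using is_type_named is_type_triangle by (auto simp: listed_types_def)
next
  fix q \<tau> assume q: "q \<in> {1, 3 :: nat}" and \<tau>: "is_type q \<tau>"
  have gr: "is_graph \<tau>'" if "\<tau>' \<in> listed_types" for \<tau>'
    using that is_type_named is_type_triangle by (auto simp: listed_types_def is_type_def)
  have ord: "order type_one = 1" "order type_sigma = 3" "order type_mu = 3" "order type_nu = 3"
      "order type_triangle = 3"
    using is_type_named is_type_triangle by (simp_all add: is_type_def)
  have uniq: "\<tau>1 = \<tau>2" if t: "\<tau>1 \<in> listed_types" "\<tau>2 \<in> listed_types" "graph_iso \<tau> \<tau>1" "graph_iso \<tau> \<tau>2"
    for \<tau>1 \<tau>2
  proof -
    have iso: "graph_iso \<tau>1 \<tau>2" using graph_iso_trans[OF graph_iso_sym[OF t(3)] t(4)] .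
    then have "order \<tau>1 = order \<tau>2" by (auto simp: graph_iso_def dest: bij_betw_same_card)
    moreover have "card (edges \<tau>1) = card (edges \<tau>2)"
      by (rule graph_iso_card_edges[OF gr[OF t(1)] gr[OF t(2)] iso])
    ultimately show ?thesis
      using t(1,2) ord edges_types card_edges_triangle unfolding listed_types_def
      by (elim insertE emptyE) simp_all
  qed
  have "\<exists>\<tau>'. \<tau>' \<in> listed_types \<and> graph_iso \<tau> \<tau>'"
  proof (cases "q = 1")
    case True
    \<comment> \<open>A one-vertex type is the type of its own identity embedding.\<close>
    have "\<tau> = type_of 1 (\<lambda>i. i) \<tau>"
      using \<tau> True by (intro type_of_unique) (auto simp: edge_compat_def)
    also have "\<dots> = type_one" using \<tau> by (intro type_of_1) (simp add: is_type_def)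
    finally have "\<tau> = type_one" .
    moreover have "type_one \<in> listed_types" by (simp add: listed_types_def)
    ultimately show ?thesis using graph_iso_refl[of type_one] by blast
  next
    case False
    then have "is_type 3 \<tau>" using q \<tau> by simp
    from listed_types_ex[OF this] show ?thesis unfolding listed_types_def by blast
  qed
  then show "\<exists>!\<tau>'. \<tau>' \<in> listed_types \<and> graph_iso \<tau> \<tau>'" using uniq by blast
qed

section \<open>Assembly of the certificate and the upper bound\<close>

lemma sos_mat_Nil: "sos_mat n p [] = 0\<^sub>m n n"
  by (rule eq_matI) (auto simp: sos_mat_def)

lemma certificate_cert_mat:
  "certificate C4_pendant 5 (15625 / 62208) listed_types cert_mat cert_slack"
  unfolding certificate_def
proof (intro conjI ballI allI impI)
  show "order C4_pendant \<le> 5" by (simp add: is_graph_C4_pendant)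
  show "type_listing 5 listed_types" by (rule type_listing_listed_types)
  fix q \<tau> assume "q \<in> type_sizes 5" and \<tau>: "is_type q \<tau>"
  then have q: "q = 1 \<or> q = 3" by (simp add: type_sizes_5)
  have nil: "type_squares \<tau> = []" if "\<tau> \<notin> listed_types"
    using that by (simp add: type_squares_def listed_types_def)
  have "\<forall>(w, l)\<in>set (type_squares \<tau>). 0 \<le> w"
    using type_squares_pos[of \<tau>] by auto
  then show "let d = length (flag_reps \<tau> (flag_size 5 q))
      in psd d (cert_mat \<tau>) \<and> (\<tau> \<notin> listed_types \<longrightarrow> cert_mat \<tau> = 0\<^sub>m d d)"
    unfolding Let_def flag_size_5[OF q] cert_mat_eq[OF \<tau> q]
    by (intro conjI impI psd_sos_mat) (simp_all add: nil sos_mat_Nil)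
next
  fix F' assume "F' \<in> set (graph_reps 5)"
  then show "0 \<le> cert_slack F'" by (intro cert_slack_nonneg graph_reps_5)
next
  obtain C where C: "\<And>G. is_graph G \<Longrightarrow> 5 \<le> order G \<Longrightarrow>
    \<bar>(\<Sum>q\<in>type_sizes 5. \<Sum>f\<in>injections q (verts G). flag_quadratic q G f)
      - real_of_int (gram_total G) / (4 * 302330880)\<bar> \<le> C * real (order G) ^ 4"
    using quadratic_error by (elim exE) blast
  show "\<exists>C n\<^sub>0. \<forall>G :: nat sgraph. is_graph G \<and> n\<^sub>0 \<le> order G \<longrightarrow>
      \<bar>(\<Sum>F'\<in>set (graph_reps 5). (15625 / 62208 - ind_density C4_pendant F') * real (ind_count F' G))
        - ((\<Sum>q\<in>type_sizes 5. \<Sum>f\<in>injections q (verts G).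
              let \<tau> = type_of q f G; v = flag_vec \<tau> (flag_size 5 q) (G, f)
              in v \<bullet> (cert_mat \<tau> *\<^sub>v v))
           + (\<Sum>F'\<in>set (graph_reps 5). cert_slack F' * real (ind_count F' G)))\<bar>
      \<le> C * real (order G) ^ (5 - 1)"
  proof (rule exI[of _ C], rule exI[of _ 5], intro allI impI)
    fix G :: "nat sgraph" assume G: "is_graph G \<and> 5 \<le> order G"
    then show "\<bar>(\<Sum>F'\<in>set (graph_reps 5). (15625 / 62208 - ind_density C4_pendant F') * real (ind_count F' G))
        - ((\<Sum>q\<in>type_sizes 5. \<Sum>f\<in>injections q (verts G).
              let \<tau> = type_of q f G; v = flag_vec \<tau> (flag_size 5 q) (G, f)
              in v \<bullet> (cert_mat \<tau> *\<^sub>v v))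
           + (\<Sum>F'\<in>set (graph_reps 5). cert_slack F' * real (ind_count F' G)))\<bar>
      \<le> C * real (order G) ^ (5 - 1)"
      using C[of G] slack_identity[of G] unfolding flag_quadratic_def[symmetric] by (simp add: abs_le_iff)
  qed
qed

lemma flag_quadratic_nonneg:
  assumes "is_graph G" "f \<in> injections q (verts G)" "q = 1 \<or> q = 3"
  shows "0 \<le> flag_quadratic q G f"
  unfolding flag_quadratic_eq[OF assms]
  using type_squares_pos[of "type_of q f G"]
  by (intro divide_nonneg_nonneg sum_list_nonneg) (auto simp: less_imp_le)

text \<open>The left side of the certificate identity is \<open>15625 / 62208 * (n choose 5)\<close>
  minus the number of copies. The quadratic forms and the slack terms are non-negative, so it can be
  negative only by the error of order n^4.\<close>

lemma ind_count_upper: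
  "\<exists>C. \<forall>G :: nat sgraph. is_graph G \<and> 5 \<le> order G \<longrightarrow>
    real (ind_count C4_pendant G) \<le> 15625 / 62208 * real (order G choose 5) + C * real (order G) ^ 4"
proof -
  obtain C where C: "\<And>G. is_graph G \<Longrightarrow> 5 \<le> order G \<Longrightarrow>
    \<bar>(\<Sum>q\<in>type_sizes 5. \<Sum>f\<in>injections q (verts G). flag_quadratic q G f)
      - real_of_int (gram_total G) / (4 * 302330880)\<bar> \<le> C * real (order G) ^ 4"
    using quadratic_error by (elim exE) blast
  have "real (ind_count C4_pendant G) \<le> 15625 / 62208 * real (order G choose 5) + C * real (order G) ^ 4"
    if G: "is_graph G" "5 \<le> order G" for G :: "nat sgraph"
  proof -
    have fin: "finite (verts G)" using G by (simp add: is_graph_def)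
    let ?\<X> = "{X. X \<subseteq> verts G \<and> card X = 5}"
    have finX: "finite ?\<X>" using fin by simp
    have "(\<Sum>F'\<in>set (graph_reps 5). real (ind_count F' G)) = real (order G choose 5)"
      using sum_over_reps[OF G(1), of "\<lambda>_. 1" 5] n_subsets[OF fin, of 5] by simp
    moreover have "(\<Sum>F'\<in>set (graph_reps 5). ind_density C4_pendant F' * real (ind_count F' G))
        = real (ind_count C4_pendant G)"
    proof -
      have "(\<Sum>F'\<in>set (graph_reps 5). ind_density C4_pendant F' * real (ind_count F' G))
          = (\<Sum>F'\<in>set (graph_reps 5). of_bool (graph_iso C4_pendant F') * real (ind_count F' G))"
      proof (rule sum.cong[OF refl])
        fix F' assume F': "F' \<in> set (graph_reps 5)"
        have "ind_density C4_pendant F' = of_bool (graph_iso C4_pendant F')"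
          by (rule ind_density_same_order[OF graph_reps_5(1)[OF F']])
            (simp add: graph_reps_5(2)[OF F'] is_graph_C4_pendant(2))
        then show "ind_density C4_pendant F' * real (ind_count F' G)
            = of_bool (graph_iso C4_pendant F') * real (ind_count F' G)" by simp
      qed
      also have "\<dots> = (\<Sum>X\<in>?\<X>. of_bool (graph_iso C4_pendant (induced G X)))"
      proof (rule sum_over_reps[OF G(1), symmetric])
        fix H K :: "nat sgraph" assume "graph_iso H K"
        then have "graph_iso C4_pendant H \<longleftrightarrow> graph_iso C4_pendant K"
          using graph_iso_trans graph_iso_sym by blast
        then show "of_bool (graph_iso C4_pendant H) = (of_bool (graph_iso C4_pendant K) :: real)" by simp
      qed
      also have "\<dots> = real (ind_count C4_pendant G)"
        using finX by (simp add: ind_count_def is_graph_C4_pendant Int_def of_bool_def sum.If_cases conj_assoc)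
      finally show ?thesis .
    qed
    moreover have "0 \<le> (\<Sum>F'\<in>set (graph_reps 5). cert_slack F' * real (ind_count F' G))"
      using cert_slack_nonneg graph_reps_5 by (intro sum_nonneg mult_nonneg_nonneg) auto
    moreover have "0 \<le> (\<Sum>q\<in>type_sizes 5. \<Sum>f\<in>injections q (verts G). flag_quadratic q G f)"
      using flag_quadratic_nonneg[OF G(1)] by (intro sum_nonneg) (auto simp: type_sizes_5)
    moreover have "(\<Sum>F'\<in>set (graph_reps 5). (15625 / 62208 - ind_density C4_pendant F') * real (ind_count F' G))
        = 15625 / 62208 * (\<Sum>F'\<in>set (graph_reps 5). real (ind_count F' G))
          - (\<Sum>F'\<in>set (graph_reps 5). ind_density C4_pendant F' * real (ind_count F' G))"
      unfolding left_diff_distrib sum_subtractf sum_distrib_left ..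
    ultimately show ?thesis
      using C[OF G] slack_identity[OF G(1)] by linarith
  qed
  then show ?thesis by blast
qed

section \<open>The lower bound\<close>

text \<open>The cycle is \<open>a b c d\<close>, and \<open>f\<close> hangs at
  \<open>a\<close>.\<close>

lemma graph_iso_C4_pendantI:
  assumes G: "is_graph G" and d: "distinct [a, b, c, d, f]"
    and e: "{a, b} \<in> edges G" "{b, c} \<in> edges G" "{c, d} \<in> edges G" "{a, d} \<in> edges G" "{a, f} \<in> edges G"
    and n: "{a, c} \<notin> edges G" "{b, d} \<notin> edges G" "{b, f} \<notin> edges G" "{c, f} \<notin> edges G" "{d, f} \<notin> edges G"
  shows "graph_iso C4_pendant (induced G {a, b, c, d, f})"
proof -
  let ?X = "{a, b, c, d, f}"
  define \<phi> where "\<phi> i = (if i = 0 then a else if i = 1 then b else if i = 2 then c else if i = 3 then d else f)"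
    for i :: nat
  have phi: "\<phi> 0 = a" "\<phi> 1 = b" "\<phi> 2 = c" "\<phi> 3 = d" "\<phi> 4 = f" by (simp_all add: \<phi>_def)
  have five: "{..<5 :: nat} = {0, 1, 2, 3, 4}" by auto
  have img: "\<phi> ` {0, 1, 2, 3, 4} = ?X" by (simp only: image_insert image_empty phi)
  moreover have "card ?X = 5" using d by simp
  ultimately have "bij_betw \<phi> {0, 1, 2, 3, 4} ?X"
    unfolding bij_betw_def by (intro conjI eq_card_imp_inj_on) simp_all
  moreover have "{u, v} \<in> edges C4_pendant \<longleftrightarrow> {\<phi> u, \<phi> v} \<in> edges (induced G ?X)"
    if "u \<in> {0, 1, 2, 3, 4}" "v \<in> {0, 1, 2, 3, 4}" for u v
  proof -
    have "{\<phi> u, \<phi> v} \<subseteq> ?X" using that img by auto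
    then have ind: "{\<phi> u, \<phi> v} \<in> edges (induced G ?X) \<longleftrightarrow> {\<phi> u, \<phi> v} \<in> edges G"
      by (simp add: induced_def)
    have loop: "{x} \<notin> edges G" for x using G by (auto simp: is_graph_def)
    have comm: "{b, a} = {a, b}" "{c, a} = {a, c}" "{d, a} = {a, d}" "{f, a} = {a, f}" "{c, b} = {b, c}"
      "{d, b} = {b, d}" "{f, b} = {b, f}" "{d, c} = {c, d}" "{f, c} = {c, f}" "{f, d} = {d, f}"
      by (rule insert_commute)+
    have cases: "u = 0 \<or> u = 1 \<or> u = 2 \<or> u = 3 \<or> u = 4" "v = 0 \<or> v = 1 \<or> v = 2 \<or> v = 3 \<or> v = 4"
      using that by simp_all
    have C: "{u, v} \<in> edges C4_pendant \<longleftrightarrow>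
        (u, v) \<in> {(0, 1), (1, 0), (1, 2), (2, 1), (2, 3), (3, 2), (3, 0), (0, 3), (0, 4), (4, 0)}"
      by (auto simp: C4_pendant_def doubleton_eq_iff)
    have "{\<phi> u, \<phi> v} \<in> edges G \<longleftrightarrow>
        (u, v) \<in> {(0, 1), (1, 0), (1, 2), (2, 1), (2, 3), (3, 2), (3, 0), (0, 3), (0, 4), (4, 0)}"
      using cases by (elim disjE) (simp_all add: phi[unfolded One_nat_def] comm loop e n del: insert_iff add: insert_iff[of "(_, _)"])
    then show ?thesis using C ind by simp
  qed
  ultimately show ?thesis
    unfolding graph_iso_def edge_compat_def by (intro exI[of _ \<phi>]) (simp add: C4_pendant_def five induced_def)
qed

text \<open>If \<open>E\<close> contains each element of \<open>P\<close> independently with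
  probability \<open>p\<close>, this is the probability that \<open>E\<close> meets \<open>R\<close>
  exactly in \<open>Y\<close>.\<close>

lemma sum_weights_fixed:
  fixes p :: real
  assumes P: "finite P" and R: "R \<subseteq> P" and Y: "Y \<subseteq> R"
  shows "(\<Sum>E\<in>Pow P. of_bool (E \<inter> R = Y) * (p ^ card E * (1 - p) ^ card (P - E)))
    = p ^ card Y * (1 - p) ^ card (R - Y)"
proof -
  \<comment> \<open>Factors are set to zero at wrong decisions, so that expanding the product of
    \<open>f x + g x\<close> keeps exactly the sets with \<open>E \<inter> R = Y\<close>. Outside
    \<open>R\<close> each factor is \<open>p + (1 - p) = 1\<close>.\<close>
  define f where "f x = (if x \<in> R - Y then 0 else p)" for x
  define g where "g x = (if x \<in> Y then 0 else 1 - p)" for x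
  have "(\<Sum>E\<in>Pow P. of_bool (E \<inter> R = Y) * (p ^ card E * (1 - p) ^ card (P - E)))
      = (\<Sum>E\<in>Pow P. (\<Prod>x\<in>E. f x) * (\<Prod>x\<in>P - E. g x))"
  proof (rule sum.cong[OF refl])
    fix E assume "E \<in> Pow P"
    then have E: "E \<subseteq> P" "finite E" using P finite_subset by auto
    show "of_bool (E \<inter> R = Y) * (p ^ card E * (1 - p) ^ card (P - E))
        = (\<Prod>x\<in>E. f x) * (\<Prod>x\<in>P - E. g x)"
    proof (cases "E \<inter> R = Y")
      case True
      then have "(\<Prod>x\<in>E. f x) = (\<Prod>x\<in>E. p)" "(\<Prod>x\<in>P - E. g x) = (\<Prod>x\<in>P - E. 1 - p)"
        by (auto intro!: prod.cong simp: f_def g_def)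
      then show ?thesis using True by simp
    next
      case False
      then consider x where "x \<in> E" "x \<in> R - Y" | x where "x \<in> Y" "x \<in> P - E" using Y R by blast
      then have "(\<Prod>x\<in>E. f x) = 0 \<or> (\<Prod>x\<in>P - E. g x) = 0"
      proof cases
        case 1
        then have "(\<Prod>x\<in>E. f x) = 0" using E(2) by (intro prod_zero) (auto simp: f_def)
        then show ?thesis ..
      next
        case 2
        then have "(\<Prod>x\<in>P - E. g x) = 0" using P by (intro prod_zero) (auto simp: g_def)
        then show ?thesis ..
      qed
      then show ?thesis using False by auto
    qed
  qed
  also have "\<dots> = (\<Prod>x\<in>P. f x + g x)" by (rule prod_add[OF P, symmetric])
  also have "\<dots> = (\<Prod>x\<in>R. f x + g x)"
    by (rule prod.mono_neutral_right[OF P R]) (use Y in \<open>auto simp: f_def g_def\<close>)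
  also have "\<dots> = (\<Prod>x\<in>Y. f x + g x) * (\<Prod>x\<in>R - Y. f x + g x)"
    using prod.subset_diff[OF Y finite_subset[OF R P]] by (simp add: mult.commute)
  also have "(\<Prod>x\<in>Y. f x + g x) = (\<Prod>x\<in>Y. p)" by (rule prod.cong) (auto simp: f_def g_def)
  also have "(\<Prod>x\<in>R - Y. f x + g x) = (\<Prod>x\<in>R - Y. 1 - p)" by (rule prod.cong) (auto simp: f_def g_def)
  finally show ?thesis by simp
qed

section \<open>Copies in random bipartite graphs\<close>

locale bipartition =
  fixes A B :: "nat set"
  assumes finA: "finite A" and finB: "finite B" and disj: "A \<inter> B = {}"
begin

definition bip_graph :: "(nat \<times> nat) set \<Rightarrow> nat sgraph" where
  "bip_graph E = (A \<union> B, {{x, y} | x y. (x, y) \<in> E})"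

definition parts :: "(nat set \<times> nat set) set" where
  "parts = {S. S \<subseteq> A \<and> card S = 3} \<times> {T. T \<subseteq> B \<and> card T = 2}
    \<union> {S. S \<subseteq> A \<and> card S = 2} \<times> {T. T \<subseteq> B \<and> card T = 3}"

text \<open>A pattern is a potential copy of K_2,3 across the bipartition with one edge marked as
  the missing one; \<open>good E\<close> collects the patterns that \<open>E\<close>
  realises.\<close>

definition patterns :: "((nat set \<times> nat set) \<times> (nat \<times> nat)) set" where
  "patterns = (SIGMA ST:parts. fst ST \<times> snd ST)"

definition good :: "(nat \<times> nat) set \<Rightarrow> ((nat set \<times> nat set) \<times> (nat \<times> nat)) set" where
  "good E = {((S, T), p) | S T p. ((S, T), p) \<in> patterns \<and> E \<inter> (S \<times> T) = S \<times> T - {p}}"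

lemma is_graph_bip_graph:
  assumes "E \<subseteq> A \<times> B"
  shows "is_graph (bip_graph E)"
proof -
  have "card {x, y} = 2 \<and> {x, y} \<subseteq> A \<union> B" if "(x, y) \<in> E" for x y
  proof -
    have "x \<in> A" "y \<in> B" using that assms by auto
    then have "x \<noteq> y" using disj by auto
    then show ?thesis using \<open>x \<in> A\<close> \<open>y \<in> B\<close> by simp
  qed
  then show ?thesis using finA finB by (auto simp: is_graph_def bip_graph_def)
qed

lemma edges_bip_graph:
  assumes "E \<subseteq> A \<times> B"
  shows "x \<in> A \<Longrightarrow> y \<in> B \<Longrightarrow> {x, y} \<in> edges (bip_graph E) \<longleftrightarrow> (x, y) \<in> E"
    "x \<in> A \<Longrightarrow> y \<in> B \<Longrightarrow> {y, x} \<in> edges (bip_graph E) \<longleftrightarrow> (x, y) \<in> E"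
    "x \<in> A \<Longrightarrow> y \<in> A \<Longrightarrow> {x, y} \<notin> edges (bip_graph E)"
    "x \<in> B \<Longrightarrow> y \<in> B \<Longrightarrow> {x, y} \<notin> edges (bip_graph E)"
  using assms disj by (auto simp: bip_graph_def doubleton_eq_iff)

text \<open>In K_2,3 minus an edge, the end of the missing edge in the larger part keeps a single
  neighbour, the other vertex of the smaller part. It is the pendant vertex, and the remaining four
  vertices form the cycle.\<close>

lemma good_iso:
  assumes E: "E \<subseteq> A \<times> B" and g: "((S, T), p) \<in> good E"
  shows "graph_iso C4_pendant (induced (bip_graph E) (S \<union> T))"
proof -
  obtain s t where p: "p = (s, t)" by fastforce
  have st: "s \<in> S" "t \<in> T" and par: "(S, T) \<in> parts" and ER: "E \<inter> (S \<times> T) = S \<times> T - {(s, t)}"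
    using g by (auto simp: good_def patterns_def p)
  have sub: "S \<subseteq> A" "T \<subseteq> B" using par by (auto simp: parts_def)
  have adj: "(x, y) \<in> E \<longleftrightarrow> (x, y) \<noteq> (s, t)" if "x \<in> S" "y \<in> T" for x y
    using ER that by blast
  note eb = edges_bip_graph[OF E]
  from par consider "card S = 3" "card T = 2" | "card S = 2" "card T = 3"
    by (auto simp: parts_def)
  then show ?thesis
  proof cases
    case 1
    have "card (S - {s}) = 2" "card (T - {t}) = 1" using 1 st by simp_all
    then obtain u v w where "S - {s} = {u, v}" "u \<noteq> v" "T - {t} = {w}"
      by (auto simp: card_2_iff card_1_singleton_iff)
    then have ST: "S = {s, u, v}" "T = {t, w}" "s \<noteq> u" "s \<noteq> v" "u \<noteq> v" "t \<noteq> w" using st by auto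
    have mem: "s \<in> A" "u \<in> A" "v \<in> A" "t \<in> B" "w \<in> B" using ST(1,2) sub by auto
    have ne: "x \<noteq> y" if "x \<in> A" "y \<in> B" for x y using that disj by auto
    have "graph_iso C4_pendant (induced (bip_graph E) {w, u, t, v, s})"
    proof (rule graph_iso_C4_pendantI[OF is_graph_bip_graph[OF E]])
      show "distinct [w, u, t, v, s]"
        using ST(3-6) mem ne[of u w] ne[of v w] ne[of s w] ne[of u t] ne[of v t] ne[of s t] by auto
    qed (use ST mem adj in \<open>simp_all add: eb\<close>)
    moreover have "{w, u, t, v, s} = S \<union> T" unfolding ST(1,2) by blast
    ultimately show ?thesis by simp
  next
    case 2
    have "card (S - {s}) = 1" "card (T - {t}) = 2" using 2 st by simp_all
    then obtain u v w where "T - {t} = {u, v}" "u \<noteq> v" "S - {s} = {w}"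
      by (auto simp: card_2_iff card_1_singleton_iff)
    then have ST: "T = {t, u, v}" "S = {s, w}" "t \<noteq> u" "t \<noteq> v" "u \<noteq> v" "s \<noteq> w" using st by auto
    have mem: "t \<in> B" "u \<in> B" "v \<in> B" "s \<in> A" "w \<in> A" using ST(1,2) sub by auto
    have ne: "x \<noteq> y" if "x \<in> A" "y \<in> B" for x y using that disj by auto
    have "graph_iso C4_pendant (induced (bip_graph E) {w, u, s, v, t})"
    proof (rule graph_iso_C4_pendantI[OF is_graph_bip_graph[OF E]])
      show "distinct [w, u, s, v, t]"
        using ST(3-6) mem ne[of w u] ne[of w v] ne[of w t] ne[of s u] ne[of s v] ne[of s t] by auto
    qed (use ST mem adj in \<open>simp_all add: eb\<close>)
    moreover have "{w, u, s, v, t} = S \<union> T" unfolding ST(1,2) by blast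
    ultimately show ?thesis by simp
  qed
qed

lemma finite_patterns: "finite patterns"
proof -
  have "patterns \<subseteq> (Pow A \<times> Pow B) \<times> (A \<times> B)" by (auto simp: patterns_def parts_def)
  then show ?thesis by (rule finite_subset) (simp add: finA finB)
qed

text \<open>A good pattern is recovered from its vertex set: the parts are the intersections with
  \<open>A\<close> and \<open>B\<close>, and the mark is the pair missing from \<open>E\<close>. So
  distinct good patterns give distinct copies.\<close>

lemma card_good_le:
  assumes E: "E \<subseteq> A \<times> B"
  shows "card (good E) \<le> ind_count C4_pendant (bip_graph E)"
  unfolding ind_count_def
proof (rule card_inj_on_le)
  let ?h = "\<lambda>((S, T), p :: nat \<times> nat). S \<union> T :: nat set"
  show "inj_on ?h (good E)"
  proof (rule inj_onI)
    fix x y assume xy: "x \<in> good E" "y \<in> good E" "?h x = ?h y"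
    obtain S T p where x: "x = ((S, T), p)" by (cases x) auto
    obtain S' T' p' where y: "y = ((S', T'), p')" by (cases y) auto
    have 1: "(S, T) \<in> parts" "p \<in> S \<times> T" "E \<inter> (S \<times> T) = S \<times> T - {p}"
      and 2: "(S', T') \<in> parts" "p' \<in> S' \<times> T'" "E \<inter> (S' \<times> T') = S' \<times> T' - {p'}"
      using xy(1,2) by (auto simp: x y good_def patterns_def)
    have sub: "S \<subseteq> A" "T \<subseteq> B" "S' \<subseteq> A" "T' \<subseteq> B" using 1(1) 2(1) by (auto simp: parts_def)
    have un: "S \<union> T = S' \<union> T'" using xy(3) by (simp add: x y)
    have "S = (S \<union> T) \<inter> A" "S' = (S' \<union> T') \<inter> A" "T = (S \<union> T) \<inter> B" "T' = (S' \<union> T') \<inter> B"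
      using sub disj by blast+
    then have eq: "S = S'" "T = T'" using un by metis+
    then have "S \<times> T - {p} = S \<times> T - {p'}" using 1(3) 2(3) by simp
    then have "p = p'" using 1(2) 2(2) eq by blast
    then show "x = y" using eq by (simp add: x y)
  qed
  show "?h ` good E \<subseteq> {X. X \<subseteq> verts (bip_graph E) \<and> card X = order C4_pendant \<and>
      graph_iso C4_pendant (induced (bip_graph E) X)}"
  proof
    fix X assume "X \<in> ?h ` good E"
    then obtain S T p where X: "X = S \<union> T" "((S, T), p) \<in> good E" by (auto simp: good_def)
    have par: "(S, T) \<in> parts" using X(2) by (auto simp: good_def patterns_def)
    then have sub: "S \<subseteq> A" "T \<subseteq> B" and c: "card S + card T = 5" by (auto simp: parts_def)
    have "card X = card S + card T"
      unfolding X(1) using sub finA finB disj finite_subset by (intro card_Un_disjoint) blast+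
    moreover have "X \<subseteq> verts (bip_graph E)" using sub by (auto simp: X(1) bip_graph_def)
    ultimately show "X \<in> {X. X \<subseteq> verts (bip_graph E) \<and> card X = order C4_pendant \<and>
      graph_iso C4_pendant (induced (bip_graph E) X)}"
      using good_iso[OF E X(2)] c by (simp add: X(1) C4_pendant_def)
  qed
  have "finite (verts (bip_graph E))" using finA finB by (simp add: bip_graph_def)
  then show "finite {X. X \<subseteq> verts (bip_graph E) \<and> card X = order C4_pendant \<and>
      graph_iso C4_pendant (induced (bip_graph E) X)}" by simp
qed

lemma card_patterns:
  "card patterns = 6 * ((card A choose 3) * (card B choose 2) + (card A choose 2) * (card B choose 3))"
proof -
  have fin: "finite parts"
    by (rule finite_subset[of _ "Pow A \<times> Pow B"]) (auto simp: parts_def finA finB)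
  have "card parts = (card A choose 3) * (card B choose 2) + (card A choose 2) * (card B choose 3)"
    unfolding parts_def using finA finB
    by (subst card_Un_disjoint) (auto simp: card_cartesian_product n_subsets)
  moreover have "card patterns = (\<Sum>ST\<in>parts. card (fst ST \<times> snd ST))"
    unfolding patterns_def
  proof (rule card_SigmaI[OF fin], rule ballI)
    fix ST assume "ST \<in> parts"
    then have "fst ST \<subseteq> A" "snd ST \<subseteq> B" by (auto simp: parts_def)
    then show "finite (fst ST \<times> snd ST)"
      using finA finB finite_subset by (intro finite_cartesian_product) blast+
  qed
  moreover have "(\<Sum>ST\<in>parts. card (fst ST \<times> snd ST)) = (\<Sum>ST\<in>parts. 6)"
    by (rule sum.cong) (auto simp: parts_def card_cartesian_product)
  ultimately show ?thesis by simp
qed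

text \<open>First moment method: if every \<open>E\<close> stayed below the bound, so would the mean
  over random \<open>E\<close> with edge probability 5/6, yet the mean equals the bound.\<close>

lemma ex_many_copies:
  "\<exists>E\<subseteq>A \<times> B. (5 / 6) ^ 5 * real ((card A choose 3) * (card B choose 2) + (card A choose 2) * (card B choose 3))
    \<le> real (ind_count C4_pendant (bip_graph E))"
proof (rule ccontr)
  let ?P = "A \<times> B" and ?N = "(card A choose 3) * (card B choose 2) + (card A choose 2) * (card B choose 3)"
  let ?w = "\<lambda>E. (5 / 6 :: real) ^ card E * (1 - 5 / 6) ^ card (?P - E)"
  assume "\<not> ?thesis"
  then have lt: "real (card (good E)) < (5 / 6) ^ 5 * real ?N" if "E \<subseteq> ?P" for E
    using card_good_le[OF that] that by (meson le_less_trans not_le of_nat_le_iff)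
  have fin: "finite ?P" using finA finB by simp
  have pos: "0 < ?w E" for E by simp
  have total: "(\<Sum>E\<in>Pow ?P. ?w E) = 1"
    using sum_weights_fixed[OF fin, of "{}" "{}" "5 / 6"] by simp
  have "(\<Sum>E\<in>Pow ?P. ?w E * real (card (good E)))
      = (\<Sum>E\<in>Pow ?P. \<Sum>x\<in>patterns. case x of ((S, T), p) \<Rightarrow> of_bool (E \<inter> (S \<times> T) = S \<times> T - {p}) * ?w E)"
  proof (rule sum.cong[OF refl])
    fix E
    have "good E = {x \<in> patterns. case x of ((S, T), p) \<Rightarrow> E \<inter> (S \<times> T) = S \<times> T - {p}}"
      by (auto simp: good_def)
    then have "real (card (good E))
        = (\<Sum>x\<in>patterns. of_bool (case x of ((S, T), p) \<Rightarrow> E \<inter> (S \<times> T) = S \<times> T - {p}))"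
      using finite_patterns by (simp add: sum.If_cases Int_def of_bool_def)
    then show "?w E * real (card (good E))
        = (\<Sum>x\<in>patterns. case x of ((S, T), p) \<Rightarrow> of_bool (E \<inter> (S \<times> T) = S \<times> T - {p}) * ?w E)"
      by (simp add: sum_distrib_left split_beta mult.commute)
  qed
  also have "\<dots> = (\<Sum>x\<in>patterns. \<Sum>E\<in>Pow ?P. case x of ((S, T), p) \<Rightarrow> of_bool (E \<inter> (S \<times> T) = S \<times> T - {p}) * ?w E)"
    by (rule sum.swap)
  \<comment> \<open>A pattern is realised when its five unmarked pairs lie in \<open>E\<close> and
    the marked pair does not. The six possible marks later cancel the factor
    \<open>1 / 6\<close>.\<close>
  also have "\<dots> = (\<Sum>x\<in>patterns. (5 / 6) ^ 5 * (1 / 6))"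
  proof (rule sum.cong[OF refl])
    fix x assume x: "x \<in> patterns"
    obtain S T p where xp: "x = ((S, T), p)" by (cases x) auto
    have par: "(S, T) \<in> parts" "p \<in> S \<times> T" using x by (auto simp: xp patterns_def)
    then have c: "card (S \<times> T) = 6" and sub: "S \<times> T \<subseteq> ?P"
      by (auto simp: parts_def card_cartesian_product)
    have "card (S \<times> T - {p}) = 5" using c par(2) by simp
    moreover have "S \<times> T - (S \<times> T - {p}) = {p}" using par(2) by blast
    ultimately show "(\<Sum>E\<in>Pow ?P. case x of ((S, T), p) \<Rightarrow> of_bool (E \<inter> (S \<times> T) = S \<times> T - {p}) * ?w E)
        = (5 / 6) ^ 5 * (1 / 6)"
      using sum_weights_fixed[OF fin sub, of "S \<times> T - {p}" "5 / 6"] by (simp add: xp)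
  qed
  also have "\<dots> = (5 / 6) ^ 5 * real ?N" by (simp add: card_patterns)
  finally have "(\<Sum>E\<in>Pow ?P. ?w E * real (card (good E))) = (5 / 6) ^ 5 * real ?N" .
  moreover have "(\<Sum>E\<in>Pow ?P. ?w E * real (card (good E))) < (\<Sum>E\<in>Pow ?P. ?w E * ((5 / 6) ^ 5 * real ?N))"
    using fin lt pos by (intro sum_strict_mono mult_strict_left_mono) auto
  moreover have "(\<Sum>E\<in>Pow ?P. ?w E * ((5 / 6) ^ 5 * real ?N)) = (5 / 6) ^ 5 * real ?N"
    unfolding sum_distrib_right[symmetric] total by simp
  ultimately show False by simp
qed

end

lemma choose_2_3_5:
  "real (n choose 2) = real n * (real n - 1) / 2"
  "real (n choose 3) = real n * (real n - 1) * (real n - 2) / 6"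
  "real (n choose 5) = real n * (real n - 1) * (real n - 2) * (real n - 3) * (real n - 4) / 120"
  by (simp_all add: binomial_gbinomial gbinomial_prod_rev numeral_eq_Suc prod.atLeast0_lessThan_Suc)

text \<open>Every factor of the falling factorials is at least \<open>a - 2\<close>, and this is at
  least \<open>(n - 5) / 2\<close>.\<close>

lemma choose_lower:
  assumes "5 \<le> n" "real n - 1 \<le> 2 * real a"
  shows "((real n - 5) / 2) ^ 2 / 2 \<le> real (a choose 2)" "((real n - 5) / 2) ^ 3 / 6 \<le> real (a choose 3)"
proof -
  let ?x = "(real n - 5) / 2"
  have x: "0 \<le> ?x" "?x \<le> real a - 2" using assms by (simp_all add: field_simps of_nat_diff)
  have "?x * ?x \<le> real a * (real a - 1)" using x by (intro mult_mono) auto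
  then show "?x ^ 2 / 2 \<le> real (a choose 2)" by (simp add: choose_2_3_5 power2_eq_square)
  have "?x * ?x * ?x \<le> real a * (real a - 1) * (real a - 2)" using x by (intro mult_mono) auto
  then show "?x ^ 3 / 6 \<le> real (a choose 3)" by (simp add: choose_2_3_5 power3_eq_cube)
qed

lemma ex_dense_graph:
  assumes n: "5 \<le> n"
  shows "\<exists>G :: nat sgraph. is_graph G \<and> order G = n \<and>
    15625 / 62208 * ((real n - 5) / real n) ^ 5 \<le> ind_density C4_pendant G"
proof -
  \<comment> \<open>Both parts of this split have at least \<open>(n - 1) / 2\<close> vertices,
    whatever the parity of \<open>n\<close>.\<close>
  define a b where "a = n div 2" and "b = n - n div 2"
  interpret bipartition "{..<a}" "{a..<a + b}" by unfold_locales auto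
  obtain E where E: "E \<subseteq> {..<a} \<times> {a..<a + b}"
    "(5 / 6) ^ 5 * real ((a choose 3) * (b choose 2) + (a choose 2) * (b choose 3))
      \<le> real (ind_count C4_pendant (bip_graph E))"
    using ex_many_copies by auto
  let ?x = "(real n - 5) / 2"
  have "n \<le> 2 * a + 1" "n \<le> 2 * b + 1" and n_eq: "a + b = n"
    by (auto simp: a_def b_def)
  then have ab: "real n - 1 \<le> 2 * real a" "real n - 1 \<le> 2 * real b" by linarith+
  note A = choose_lower[OF n ab(1)] and B = choose_lower[OF n ab(2)]
  have x: "0 \<le> ?x" using n by simp
  have "?x ^ 3 / 6 * (?x ^ 2 / 2) + ?x ^ 2 / 2 * (?x ^ 3 / 6)
      \<le> real (a choose 3) * real (b choose 2) + real (a choose 2) * real (b choose 3)"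
    using x by (intro add_mono mult_mono A B) auto
  moreover have "?x ^ 3 / 6 * (?x ^ 2 / 2) + ?x ^ 2 / 2 * (?x ^ 3 / 6) = (real n - 5) ^ 5 / 192"
    by (simp add: power_divide numeral_eq_Suc)
  ultimately have N: "(real n - 5) ^ 5 / 192
      \<le> real ((a choose 3) * (b choose 2) + (a choose 2) * (b choose 3))"
    by simp
  have "(5 / 6) ^ 5 * ((real n - 5) ^ 5 / 192)
      \<le> (5 / 6) ^ 5 * real ((a choose 3) * (b choose 2) + (a choose 2) * (b choose 3))"
    by (rule mult_left_mono[OF N]) simp
  also note E(2)
  finally have cnt: "(5 / 6) ^ 5 * ((real n - 5) ^ 5 / 192) \<le> real (ind_count C4_pendant (bip_graph E))" .
  have "real (n choose 5) \<le> real n ^ 5 / 120"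
  proof -
    have "real n * (real n - 1) * (real n - 2) * (real n - 3) * (real n - 4)
        \<le> real n * real n * real n * real n * real n"
      using n by (intro mult_mono mult_nonneg_nonneg) auto
    moreover have "real n ^ 5 = real n * real n * real n * real n * real n"
      by (simp add: numeral_eq_Suc)
    ultimately show ?thesis unfolding choose_2_3_5(3) by (simp only: divide_right_mono)
  qed
  moreover have pos: "0 < real (n choose 5)" using n by (simp add: zero_less_binomial)
  moreover have "0 \<le> (5 / 6) ^ 5 * ((real n - 5) ^ 5 / 192)" using n by simp
  ultimately have le: "(5 / 6) ^ 5 * ((real n - 5) ^ 5 / 192) / (real n ^ 5 / 120)
      \<le> real (ind_count C4_pendant (bip_graph E)) / real (n choose 5)"
    using cnt by (intro frac_le) auto
  \<comment> \<open>The quotient \<open>120 / 192 = 5 / 8\<close> is the probability of a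
    \<open>3 + 2\<close> split.\<close>
  have eq: "(5 / 6) ^ 5 * ((real n - 5) ^ 5 / 192) / (real n ^ 5 / 120)
      = 15625 / 62208 * ((real n - 5) / real n) ^ 5"
    by (simp add: power_divide)
  have ord: "order (bip_graph E) = n"
  proof -
    have "{..<a} \<union> {a..<a + b} = {..<n}" using n_eq by auto
    then show ?thesis by (simp add: bip_graph_def)
  qed
  have "15625 / 62208 * ((real n - 5) / real n) ^ 5 \<le> ind_density C4_pendant (bip_graph E)"
    using le unfolding eq ind_density_def is_graph_C4_pendant(2) ord .
  then show ?thesis using is_graph_bip_graph[OF E(1)] ord by blast
qed

section \<open>The limit of the maximal densities\<close>

lemma max_ind_density_le:
  assumes "\<And>G :: nat sgraph. is_graph G \<Longrightarrow> order G = n \<Longrightarrow> ind_density F G \<le> u"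
  shows "max_ind_density F n \<le> u"
proof -
  let ?D = "{ind_density F G | G :: nat sgraph. is_graph G \<and> order G = n}"
  \<comment> \<open>The edgeless graph shows that the set under \<open>Max\<close> is
    non-empty.\<close>
  have "is_graph ({..<n}, {} :: nat set set)" "order ({..<n}, {} :: nat set set) = n"
    by (simp_all add: is_graph_def)
  then have ne: "?D \<noteq> {}" by blast
  show ?thesis
    unfolding max_ind_density_def
  proof (rule Max.boundedI[OF finite_ind_densities ne])
    fix x assume "x \<in> ?D"
    then obtain G :: "nat sgraph" where "x = ind_density F G" "is_graph G" "order G = n" by blast
    then show "x \<le> u" using assms by simp
  qed
qed

lemma le_max_ind_density:
  fixes G :: "nat sgraph"
  assumes "is_graph G"
  shows "ind_density F G \<le> max_ind_density F (order G)"
  unfolding max_ind_density_def using assms by (intro Max_ge[OF finite_ind_densities]) blast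

lemma tendsto_density_lower: "(\<lambda>n. u * ((real n - 5) / real n) ^ 5) \<longlonglongrightarrow> u"
  by real_asymp

lemma tendsto_density_upper: "(\<lambda>n. u + C * (real n ^ 4 / real (n choose 5))) \<longlonglongrightarrow> u"
  unfolding choose_2_3_5(3) by real_asymp

text \<open>\<open>inducibility\<close> is a \<open>lim\<close>, which is informative only for
  convergent sequences, so convergence is proved together with the value: the certificate bounds
  from above, the random bipartite graphs from below.\<close>

lemma max_ind_density_tendsto: "max_ind_density C4_pendant \<longlonglongrightarrow> 15625 / 62208"
proof -
  obtain C where C: "\<And>G :: nat sgraph. is_graph G \<Longrightarrow> 5 \<le> order G \<Longrightarrow>
      real (ind_count C4_pendant G) \<le> 15625 / 62208 * real (order G choose 5) + C * real (order G) ^ 4"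
    using ind_count_upper by (elim exE) blast
  have up: "max_ind_density C4_pendant n \<le> 15625 / 62208 + C * (real n ^ 4 / real (n choose 5))"
    if n: "5 \<le> n" for n
  proof (rule max_ind_density_le)
    fix G :: "nat sgraph" assume G: "is_graph G" "order G = n"
    have "0 < real (n choose 5)" using n by simp
    then show "ind_density C4_pendant G \<le> 15625 / 62208 + C * (real n ^ 4 / real (n choose 5))"
      using C[OF G(1)] n by (simp add: ind_density_def is_graph_C4_pendant(2) G(2) field_simps)
  qed
  have low: "15625 / 62208 * ((real n - 5) / real n) ^ 5 \<le> max_ind_density C4_pendant n"
    if n: "5 \<le> n" for n
  proof -
    obtain G :: "nat sgraph" where G: "is_graph G" "order G = n"
      "15625 / 62208 * ((real n - 5) / real n) ^ 5 \<le> ind_density C4_pendant G"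
      using ex_dense_graph[OF n] by blast
    then show ?thesis using le_max_ind_density[OF G(1), of C4_pendant] by simp
  qed
  show ?thesis
  proof (rule tendsto_sandwich[OF _ _ tendsto_density_lower tendsto_density_upper[of _ C]])
    show "\<forall>\<^sub>F n in sequentially. 15625 / 62208 * ((real n - 5) / real n) ^ 5 \<le> max_ind_density C4_pendant n"
      using low by (auto simp: eventually_sequentially)
    show "\<forall>\<^sub>F n in sequentially. max_ind_density C4_pendant n
        \<le> 15625 / 62208 + C * (real n ^ 4 / real (n choose 5))"
      using up by (auto simp: eventually_sequentially)
  qed
qed

theorem theorem3p15:
  shows "inducibility C4_pendant = 5 ^ 6 / (2 ^ 8 * 3 ^ 5) \<and>
    (5 ^ 6 / (2 ^ 8 * 3 ^ 5) :: real) = 15625 / 62208 \<and>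
    (\<exists>T X c.
      certificate C4_pendant 5 (5 ^ 6 / (2 ^ 8 * 3 ^ 5)) T X c \<and>
      {type_one, type_nu, type_sigma, type_mu} \<subseteq> T \<and>
      kernel_dim (X type_one) = 1 \<and>
      kernel_dim (X type_nu) = 1 \<and>
      \<not> (\<exists>v \<in> mat_kernel (X type_sigma). v \<noteq> 0\<^sub>v (dim_vec v) \<and>
            supported_on (flag_reps type_sigma 4) (\<lambda>\<Phi>. edges_to_roots type_sigma \<Phi> \<le> 1) v) \<and>
      \<not> (\<exists>v \<in> mat_kernel (X type_mu). v \<noteq> 0\<^sub>v (dim_vec v) \<and>
            supported_on (flag_reps type_mu 4) (\<lambda>\<Phi>. edges_to_roots type_mu \<Phi> \<le> 1) v))"
proof -
  have u: "(5 ^ 6 / (2 ^ 8 * 3 ^ 5) :: real) = 15625 / 62208" by simp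
  have "inducibility C4_pendant = 15625 / 62208"
    unfolding inducibility_def by (rule limI[OF max_ind_density_tendsto])
  then show ?thesis
    unfolding u
    using certificate_cert_mat kernel_dim_one kernel_dim_nu kernel_sigma kernel_mu
    by (intro conjI refl exI[of _ listed_types] exI[of _ cert_mat] exI[of _ cert_slack])
      (auto simp: listed_types_def)
qed

end
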